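(* Let $a,b,n,s$ be positive integers with $s\ge n+1$, $b(s-n)+1\le a\le sb$ and $a>(b-1)s+1$. Put $\delta=a-(b-1)s-1$ and suppose that $\delta\ge s-n$. Let $\mathcal{F}=\{f_1,\dots,f_s\}$ be an $(s-\delta)$-generic set of forms of degree $d$ in $R=\mathbb{K}[x_0,\dots,x_n]$, let $\mathcal{F}_{\boldsymbol z}=\{z_1,\dots,z_s\}\subseteq T=\mathbb{K}[z_1,\dots,z_s]$, and let $\varphi:T\to R$ be the $\mathbb{K}$-algebra homomorphism induced by $z_i\mapsto f_i$ for each $i$. Fix a positive integer $m$ and let $\boldsymbol{F}_\bullet$ be a graded minimal free resolution of $T/I_a(\mathcal{F}_{\boldsymbol z}^b)^{(m)}$ over $T$. Then $I_a(\mathcal{F}^b)^{(m)}=\varphi(I_a(\mathcal{F}_{\boldsymbol z}^b)^{(m)})$, and $\boldsymbol{F}_\bullet\otimes_T R$ is a graded minimal free resolution of $R/I_a(\mathcal{F}^b)^{(m)}$. In particular, a minimal generating set of $I_a(\mathcal{F}^b)^{(m)}$ is given by $$\{\varphi(g): g\in G(I_a(\mathcal{F}_{\boldsymbol z}^b)^{(m)})\},$$ where $G(I_a(\mathcal{F}_{\boldsymbol z}^b)^{(m)})$ is the minimal monomial generating set of the monomial ideal $I_a(\mathcal{F}_{\boldsymbol z}^b)^{(m)}$.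
   Context: $\mathbb{K}$ is an infinite field; polynomial rings are standard graded; a form is a homogeneous polynomial of positive degree. $R$ is a $T$-algebra via $\varphi$ (degrees are multiplied by $d$ under $\varphi$). For an ideal $J\subseteq T$, $\varphi(J)$ denotes the ideal of $R$ generated by the image of $J$. A set of forms is $c$-generic if every subset of size at most $c+1$ forms a regular sequence. For a set $\mathcal{G}=\{g_1,\dots,g_s\}$, $I_a(\mathcal{G}^b)=\langle g_1^{n_1}\cdots g_s^{n_s}: 0\le n_i\le b,\ \sum_i n_i=a\rangle$. For a homogeneous ideal $I$ of a polynomial ring $P$ and $m\ge1$, the $m$-th symbolic power is $I^{(m)}=\bigcap_{\mathfrak{p}\in\operatorname{Ass}(P/I)}(I^mP_{\mathfrak{p}}\cap P)$. *)

theory Defs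
  imports
    "HOL-Library.Poly_Mapping"
    "HOL-Library.FuncSet"
    "Jordan_Normal_Form.Matrix_Kernel"
begin

section \<open>Polynomial rings\<close>

text \<open>
  Polynomials with coefficients in \<open>'k\<close> and variables indexed by the finite type \<open>'x\<close>; the
  exponent vectors are the elements of \<open>'x \<Rightarrow>\<^sub>0 nat\<close>.
\<close>

type_synonym ('x, 'k) mpoly = "('x \<Rightarrow>\<^sub>0 nat) \<Rightarrow>\<^sub>0 'k"

definition Const :: "'k \<Rightarrow> ('x, 'k::zero) mpoly" where
  "Const c = Poly_Mapping.single 0 c"

definition Var :: "'x \<Rightarrow> ('x, 'k::zero_neq_one) mpoly" where
  "Var i = Poly_Mapping.single (Poly_Mapping.single i 1) 1"

definition monomials :: "('x, 'k::zero_neq_one) mpoly set" where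
  "monomials = range (\<lambda>t. Poly_Mapping.single t 1)"

definition tdeg :: "('x::finite \<Rightarrow>\<^sub>0 nat) \<Rightarrow> nat" where
  "tdeg t = (\<Sum>i\<in>UNIV. Poly_Mapping.lookup t i)"

text \<open>
  \<open>homogeneous e p\<close> says that \<open>p\<close> lies in the graded piece of degree \<open>e\<close>, so \<open>0\<close> is homogeneous of
  every degree. Degrees are integers because they will be differences of degree shifts; the pieces
  of negative degree are \<open>{0}\<close>.
\<close>

definition homogeneous :: "int \<Rightarrow> ('x::finite, 'k::zero) mpoly \<Rightarrow> bool" where
  "homogeneous e p \<longleftrightarrow> (\<forall>t\<in>Poly_Mapping.keys p. int (tdeg t) = e)"

definition is_form :: "nat \<Rightarrow> ('x::finite, 'k::zero) mpoly \<Rightarrow> bool" where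
  "is_form d f \<longleftrightarrow> d > 0 \<and> homogeneous (int d) f"


section \<open>Ideals\<close>

definition is_ideal :: "'a::comm_ring_1 set \<Rightarrow> bool" where
  "is_ideal = Modules.module.subspace (*)"

definition ideal_gen :: "'a::comm_ring_1 set \<Rightarrow> 'a set" where
  "ideal_gen = Modules.module.span (*)"

definition prime_ideal :: "'a::comm_ring_1 set \<Rightarrow> bool" where
  "prime_ideal p \<longleftrightarrow> is_ideal p \<and> p \<noteq> UNIV \<and> (\<forall>x y. x * y \<in> p \<longrightarrow> x \<in> p \<or> y \<in> p)"

primrec ideal_power :: "'a::comm_ring_1 set \<Rightarrow> nat \<Rightarrow> 'a set" where
  "ideal_power I 0 = UNIV"
| "ideal_power I (Suc m) = ideal_gen {x * y | x y. x \<in> I \<and> y \<in> ideal_power I m}"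

text \<open>The set \<open>Ass (P / I)\<close>: the primes that are annihilators of elements of \<open>P / I\<close>.\<close>

definition Ass_quot :: "'a::comm_ring_1 set \<Rightarrow> 'a set set" where
  "Ass_quot I = {p. prime_ideal p \<and> (\<exists>x. p = {r. r * x \<in> I})}"

text \<open>
  The contraction \<open>J P\<^sub>p \<inter> P\<close> of the extension of the ideal \<open>J\<close> to the localization at \<open>p\<close>. The
  elements of \<open>J P\<^sub>p\<close> are the fractions \<open>y / u\<close> with \<open>y \<in> J\<close> and \<open>u \<notin> p\<close>, and \<open>x / 1 = y / u\<close> holds in
  \<open>P\<^sub>p\<close> iff \<open>w * (u * x - y) = 0\<close> for some \<open>w \<notin> p\<close>.
\<close>

definition local_contraction :: "'a::comm_ring_1 set \<Rightarrow> 'a set \<Rightarrow> 'a set" where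
  "local_contraction p J = {x. \<exists>y\<in>J. \<exists>u. u \<notin> p \<and> (\<exists>w. w \<notin> p \<and> w * (u * x - y) = 0)}"

definition symbolic_power :: "'a::comm_ring_1 set \<Rightarrow> nat \<Rightarrow> 'a set" where
  "symbolic_power I m = (\<Inter>p\<in>Ass_quot I. local_contraction p (ideal_power I m))"

definition minimal_generating_set :: "'a::comm_ring_1 set \<Rightarrow> 'a set \<Rightarrow> bool" where
  "minimal_generating_set G I \<longleftrightarrow> ideal_gen G = I \<and> (\<forall>H. H \<subset> G \<longrightarrow> ideal_gen H \<noteq> I)"

text \<open>Meaningful for monomial ideals only, where the minimal monomial generating set is unique.\<close>

definition minimal_monomial_gens :: "('x, 'k::comm_ring_1) mpoly set \<Rightarrow> ('x, 'k) mpoly set" where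
  "minimal_monomial_gens I = (THE G. G \<subseteq> monomials \<and> minimal_generating_set G I)"


section \<open>Generic sets of forms and the ideals they define\<close>

definition regular_sequence :: "'a::comm_ring_1 list \<Rightarrow> bool" where
  "regular_sequence fs \<longleftrightarrow>
     (\<forall>i<length fs. \<forall>r. fs ! i * r \<in> ideal_gen (set (take i fs)) \<longrightarrow> r \<in> ideal_gen (set (take i fs)))
     \<and> ideal_gen (set fs) \<noteq> UNIV"

text \<open>
  A set is said to form a regular sequence if each of its enumerations does; for forms of positive
  degree the order is irrelevant.
\<close>

definition generic :: "nat \<Rightarrow> 'a::comm_ring_1 set \<Rightarrow> bool" where
  "generic c G \<longleftrightarrow>
     (\<forall>fs. distinct fs \<and> set fs \<subseteq> G \<and> length fs \<le> c + 1 \<longrightarrow> regular_sequence fs)"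

text \<open>The ideal \<open>I\<^sub>a (G\<^sup>b)\<close> of a finite set \<open>G\<close>.\<close>

definition power_product_ideal :: "nat \<Rightarrow> nat \<Rightarrow> 'a::comm_ring_1 set \<Rightarrow> 'a set" where
  "power_product_ideal a b G =
     ideal_gen {(\<Prod>g\<in>G. g ^ e g) | e. (\<forall>g\<in>G. e g \<le> b) \<and> (\<Sum>g\<in>G. e g) = a}"


section \<open>Graded minimal free resolutions\<close>

text \<open>
  A sequence of finitely generated graded free modules \<open>F\<^sub>i = P(- c\<^sub>0) \<oplus> \<dots> \<oplus> P(- c\<^sub>r)\<close> over \<open>P\<close>,
  represented as column vectors, with \<open>r + 1 = frank C i\<close> and \<open>c\<^sub>j = fdeg C i j\<close> the degree of the
  \<open>j\<close>-th basis vector. The matrix \<open>fdiff C i\<close> represents the map from \<open>F\<close> at \<open>i + 1\<close> to \<open>F\<close> at \<open>i\<close>.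
  The augmentation \<open>F\<^sub>0 \<rightarrow> P / J\<close> is given by (homogeneous) representatives in \<open>P\<close> of the images of
  the basis vectors. All free modules in a graded minimal free resolution of a cyclic graded module
  over a polynomial ring are of this form.
\<close>

record 'a free_complex =
  frank :: "nat \<Rightarrow> nat"
  fdeg :: "nat \<Rightarrow> nat \<Rightarrow> int"
  fdiff :: "nat \<Rightarrow> 'a mat"
  faug :: "'a vec"

definition mat_image :: "'a::comm_ring_1 mat \<Rightarrow> 'a vec set" where
  "mat_image A = {A *\<^sub>v v | v. v \<in> carrier_vec (dim_col A)}"

text \<open>All maps, including the augmentation, are homogeneous of degree \<open>0\<close>.\<close>

definition graded_free_sequence :: "('x::finite, 'k::comm_ring_1) mpoly free_complex \<Rightarrow> bool" where
  "graded_free_sequence C \<longleftrightarrow>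
     faug C \<in> carrier_vec (frank C 0)
     \<and> (\<forall>j<frank C 0. homogeneous (fdeg C 0 j) (faug C $ j))
     \<and> (\<forall>i. fdiff C i \<in> carrier_mat (frank C i) (frank C (Suc i)))
     \<and> (\<forall>i. \<forall>j<frank C i. \<forall>k<frank C (Suc i).
           homogeneous (fdeg C (Suc i) k - fdeg C i j) (fdiff C i $$ (j, k)))"

definition resolves_quotient :: "'a::comm_ring_1 free_complex \<Rightarrow> 'a set \<Rightarrow> bool" where
  "resolves_quotient C J \<longleftrightarrow>
     (\<forall>y. \<exists>v\<in>carrier_vec (frank C 0). y - faug C \<bullet> v \<in> J)
     \<and> {v \<in> carrier_vec (frank C 0). faug C \<bullet> v \<in> J} = mat_image (fdiff C 0)
     \<and> (\<forall>i. mat_kernel (fdiff C i) = mat_image (fdiff C (Suc i)))"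

text \<open>Minimality: the image of each differential lies in \<open>\<mm> F\<^sub>i\<close>, \<open>\<mm>\<close> generated by the variables.\<close>

definition minimal_sequence :: "('x, 'k::comm_ring_1) mpoly free_complex \<Rightarrow> bool" where
  "minimal_sequence C \<longleftrightarrow>
     (\<forall>i. \<forall>v\<in>mat_image (fdiff C i). \<forall>j<frank C i. v $ j \<in> ideal_gen (range Var))"

definition graded_minimal_free_resolution ::
    "('x::finite, 'k::comm_ring_1) mpoly free_complex \<Rightarrow> ('x, 'k) mpoly set \<Rightarrow> bool" where
  "graded_minimal_free_resolution C J \<longleftrightarrow>
     graded_free_sequence C \<and> resolves_quotient C J \<and> minimal_sequence C"

text \<open>
  The tensor product of a sequence with \<open>R\<close> along a ring homomorphism \<open>\<phi>\<close> that multiplies degrees by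
  \<open>d\<close>. A free module of rank \<open>n\<close> over the source of \<open>\<phi>\<close> becomes the free module of rank \<open>n\<close> over
  the target, with \<open>v \<otimes> 1\<close> being \<open>map_vec \<phi> v\<close>; the lemma \<open>extension_of_scalars_universal\<close> below
  shows that this is the tensor product. The map induced by a matrix \<open>A\<close> is the one given by
  \<open>map_mat \<phi> A\<close> (see the lemma \<open>semiring_hom.mult_mat_vec_hom\<close>).
\<close>

definition base_change ::
    "('a \<Rightarrow> 'b) \<Rightarrow> nat \<Rightarrow> 'a free_complex \<Rightarrow> 'b free_complex" where
  "base_change \<phi> d C =
     \<lparr> frank = frank C,
       fdeg = (\<lambda>i j. int d * fdeg C i j),
       fdiff = (\<lambda>i. map_mat \<phi> (fdiff C i)),
       faug = map_vec \<phi> (faug C) \<rparr>"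

lemma semilinear_expand:
  fixes \<phi> :: "'a::comm_ring_1 \<Rightarrow> 'b::comm_ring_1"
    and scale :: "'b \<Rightarrow> 'c::ab_group_add \<Rightarrow> 'c"
  assumes \<phi>: "comm_ring_hom \<phi>" and N: "Modules.module scale"
    and add: "\<And>v w. v \<in> carrier_vec n \<Longrightarrow> w \<in> carrier_vec n \<Longrightarrow> g (v + w) = g v + g w"
    and smult: "\<And>c v. v \<in> carrier_vec n \<Longrightarrow> g (c \<cdot>\<^sub>v v) = scale (\<phi> c) (g v)"
    and v: "v \<in> carrier_vec n"
  shows "g v = (\<Sum>i<n. scale (\<phi> (v $ i)) (g (unit_vec n i)))"
proof -
  define tr where "tr k = vec n (\<lambda>i. if i < k then v $ i else 0)" for k
  have tr: "tr k \<in> carrier_vec n" for k by (simp add: tr_def)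
  have g0: "g (0\<^sub>v n) = 0"
    using add[of "0\<^sub>v n" "0\<^sub>v n"] by simp
  have "g (tr k) = (\<Sum>i<k. scale (\<phi> (v $ i)) (g (unit_vec n i)))" if "k \<le> n" for k
    using that
  proof (induction k)
    case 0
    have "tr 0 = 0\<^sub>v n" by (auto simp: tr_def)
    then show ?case using g0 by simp
  next
    case (Suc k)
    have "tr (Suc k) = tr k + v $ k \<cdot>\<^sub>v unit_vec n k"
      using Suc.prems by (intro eq_vecI) (auto simp: tr_def unit_vec_def less_Suc_eq)
    then have "g (tr (Suc k)) = g (tr k) + scale (\<phi> (v $ k)) (g (unit_vec n k))"
      using add[OF tr] smult by simp
    then show ?case using Suc by simp
  qed
  moreover have "tr n = v" using v by (intro eq_vecI) (auto simp: tr_def)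
  ultimately show ?thesis by (metis order_refl)
qed

lemma extension_of_scalars_universal:
  fixes \<phi> :: "'a::comm_ring_1 \<Rightarrow> 'b::comm_ring_1"
    and scale :: "'b \<Rightarrow> 'c::ab_group_add \<Rightarrow> 'c"
  assumes \<phi>: "comm_ring_hom \<phi>" and N: "Modules.module scale"
    and add: "\<And>v w. v \<in> carrier_vec n \<Longrightarrow> w \<in> carrier_vec n \<Longrightarrow> g (v + w) = g v + g w"
    and smult: "\<And>c v. v \<in> carrier_vec n \<Longrightarrow> g (c \<cdot>\<^sub>v v) = scale (\<phi> c) (g v)"
  shows "\<exists>!h. h \<in> extensional (carrier_vec n)
           \<and> (\<forall>v\<in>carrier_vec n. \<forall>w\<in>carrier_vec n. h (v + w) = h v + h w)
           \<and> (\<forall>c. \<forall>v\<in>carrier_vec n. h (c \<cdot>\<^sub>v v) = scale c (h v))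
           \<and> (\<forall>v\<in>carrier_vec n. h (map_vec \<phi> v) = g v)"
    (is "\<exists>!h. ?P h")
proof -
  interpret \<phi>: comm_ring_hom \<phi> by (rule \<phi>)
  interpret N: Modules.module scale by (rule N)
  define h where
    "h = restrict (\<lambda>v. \<Sum>i<n. scale (v $ i) (g (unit_vec n i))) (carrier_vec n)"
  have "h (map_vec \<phi> v) = g v" if v: "v \<in> carrier_vec n" for v
  proof -
    have "g v = (\<Sum>i<n. scale (\<phi> (v $ i)) (g (unit_vec n i)))"
      by (rule semilinear_expand[OF \<phi> N add smult v])
    then show ?thesis using v by (simp add: h_def)
  qed
  then have "?P h"
    by (auto simp: h_def N.scale_left_distrib sum.distrib N.scale_sum_right)
  moreover have "h' = h" if P: "?P h'" for h'
  proof (rule extensionalityI[of _ "carrier_vec n"])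
    fix v :: "'b vec" assume v: "v \<in> carrier_vec n"
    have "comm_ring_hom (\<lambda>x::'b. x)" by unfold_locales auto
    then have "h' v = (\<Sum>i<n. scale (v $ i) (h' (unit_vec n i)))"
      using P by (intro semilinear_expand[OF _ N, of "\<lambda>x. x"] v) auto
    also have "\<dots> = (\<Sum>i<n. scale (v $ i) (g (unit_vec n i)))"
    proof (intro sum.cong refl arg_cong2[where f = scale])
      fix i assume "i \<in> {..<n}"
      have "map_vec \<phi> (unit_vec n i) = unit_vec n i"
        by (intro eq_vecI) (auto simp: unit_vec_def)
      then show "h' (unit_vec n i) = g (unit_vec n i)"
        using P by (metis unit_vec_carrier)
    qed
    finally show "h' v = h v" using v by (simp add: h_def)
  qed (use P in \<open>auto simp: h_def\<close>)
  ultimately show ?thesis by (rule ex1I)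
qed

end

(*
  Let c = s - \<delta>, so that s b - a = c - 1, let S = R[z] and g_i = z_i - f_i, so that R = S / (g_1, ..., g_s).
  A monomial ideal J of T is split along a variable by 0 -> T/(J : z_i) -> T/J -> T/(J + (z_i)) -> 0.
  The ideals that occur here consist of the monomials z^u for which the c largest of the numbers
  max(B_i - u_i, 0) have sum at most K. If one always splits along a variable with the largest remaining exponent, then only
  the quotients T/(z_i : i in D) with at most c (or c + 1) elements in D are left at the end, and on these
  the genericity of the f_i says that g_1, ..., g_s stays regular. Hence the sequence is regular on S/JS.
  This makes the resolution of T/J stay exact over R, and it makes colon ideals commute with \<phi>.
  The latter and a comparison of associated primes compute the symbolic powers of I_a(F^b), over R
  as well as over T, and show that no generator becomes redundant.
*)

theory Submission
  imports Defs
begin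

text \<open>The obstacle is that \<open>\<phi>\<close> is not flat in general: R can have fewer
  variables than there are forms, and only c + 1 forms at a time are known to behave like variables.
  On S/(z_i : i in D) an element z_i - f_i with i outside D is monic in z_i, hence regular for free,
  while for i in D it becomes -f_i. So only the forms indexed by D are tested, and the size of D is
  what matters; splitting in an arbitrary order can let D grow up to s.

  The constants: z^u lies in I_a(F_z^b) iff the deficits max(b - u_i, 0) have total at most s b - a
  = c - 1. Then fewer than c of them are nonzero, so the total is the sum of the c largest, and the
  ideal is the member B_i = b, K = c - 1 of the family. Its m-th power bounds the total of the
  deficits from m b by m (c - 1). At an associated prime at most c variables are not inverted, so
  the symbolic power bounds the c largest deficits instead. Sets D with c + 1 elements arise because
  a colon by z_i is controlled by the quotient by J + (z_i).

  T is the case \<open>f = Var\<close> of the same argument, so T and R receive the same exponent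
  sets.\<close>

abbreviation "keys \<equiv> Poly_Mapping.keys"
abbreviation "lookup \<equiv> Poly_Mapping.lookup"
abbreviation "single \<equiv> Poly_Mapping.single"

section \<open>Ideals\<close>

interpretation ideal: Modules.module "(*) :: 'a::comm_ring_1 \<Rightarrow> 'a \<Rightarrow> 'a"
  rewrites "Modules.module.subspace (*) = (is_ideal :: 'a set \<Rightarrow> bool)"
    and "Modules.module.span (*) = (ideal_gen :: 'a set \<Rightarrow> 'a set)"
  by unfold_locales (simp_all add: algebra_simps is_ideal_def ideal_gen_def)

declare ideal.scale_scale [simp del] One_nat_def [simp del]

lemma is_ideal_preimage:
  assumes "comm_ring_hom h" "is_ideal J"
  shows "is_ideal {x. h x \<in> J}"
proof -
  interpret h: comm_ring_hom h by fact
  show ?thesis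
    using assms(2)
    by (intro ideal.subspaceI)
      (auto simp: h.hom_add h.hom_mult ideal.subspace_0 ideal.subspace_add ideal.subspace_scale)
qed

lemma is_ideal_colon:
  assumes J: "is_ideal J"
  shows "is_ideal {x. t * x \<in> J}"
proof (rule ideal.subspaceI)
  show "c * x \<in> {x. t * x \<in> J}" if "x \<in> {x. t * x \<in> J}" for c x
    using that ideal.subspace_scale[OF J, of "t * x" c] by (simp add: mult.left_commute)
qed (use J in \<open>auto simp: ideal.subspace_0 ideal.subspace_add distrib_left\<close>)

lemma hom_mem_ideal_gen:
  assumes "comm_ring_hom h" "\<And>x. x \<in> G \<Longrightarrow> h x \<in> ideal_gen H" "y \<in> ideal_gen G"
  shows "h y \<in> ideal_gen H"
proof -
  have "ideal_gen G \<subseteq> {x. h x \<in> ideal_gen H}"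
    by (rule ideal.span_minimal) (use assms is_ideal_preimage[OF assms(1)] in auto)
  then show ?thesis
    using assms(3) by blast
qed

lemma mult_mem_ideal_gen_right: "x \<in> ideal_gen G \<Longrightarrow> x * y \<in> ideal_gen G"
  using ideal.span_scale[of x G y] by (simp add: mult.commute)

lemma ideal_one_eq_UNIV: "is_ideal J \<Longrightarrow> 1 \<in> J \<Longrightarrow> J = UNIV"
  using ideal.subspace_scale[of J 1] by fastforce

lemma mem_cong_diff: "x - y \<in> ideal_gen G \<Longrightarrow> x \<in> ideal_gen G \<longleftrightarrow> y \<in> ideal_gen G"
  using ideal.span_add_eq[of "x - y" G y] by simp

section \<open>Sequences that stay regular modulo an ideal\<close>

text \<open>Every order at once, and no properness: the unit ideal has to qualify, because it occurs
  as a colon ideal in the splittings.\<close>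

definition regular_mod :: "('i \<Rightarrow> 'a::comm_ring_1) \<Rightarrow> 'a set \<Rightarrow> bool" where
  "regular_mod g J \<longleftrightarrow>
     (\<forall>E i x. i \<notin> E \<longrightarrow> g i * x \<in> ideal_gen (J \<union> g ` E) \<longrightarrow> x \<in> ideal_gen (J \<union> g ` E))"

lemma regular_modD:
  "regular_mod g J \<Longrightarrow> i \<notin> E \<Longrightarrow> g i * x \<in> ideal_gen (J \<union> g ` E) \<Longrightarrow> x \<in> ideal_gen (J \<union> g ` E)"
  by (auto simp: regular_mod_def)

lemma regular_mod_UNIV: "regular_mod g UNIV"
  by (simp add: regular_mod_def)

lemma mem_ideal_gen_insert: "x \<in> ideal_gen (insert t A) \<longleftrightarrow> (\<exists>y. x - t * y \<in> ideal_gen A)"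
  by (simp add: ideal.span_breakdown_eq mult.commute)

text \<open>
  This says that \<open>0 \<rightarrow> S / (J : t) \<rightarrow> S / J \<rightarrow> S / (J + (t)) \<rightarrow> 0\<close> stays exact modulo every subset of
  the sequence; the induction step is the snake lemma for multiplication by the next element.
\<close>
lemma colon_regular_mod:
  fixes g :: "'i \<Rightarrow> 'a::comm_ring_1"
  assumes J: "is_ideal J" and reg: "regular_mod g (ideal_gen (insert t J))" and E: "finite E"
  shows "t * x \<in> ideal_gen (J \<union> g ` E) \<longleftrightarrow> x \<in> ideal_gen ({x. t * x \<in> J} \<union> g ` E)"
proof
  have gen: "ideal_gen (ideal_gen (insert t J) \<union> A) = ideal_gen (insert t (J \<union> A))" for A
  proof (rule antisym)
    show "ideal_gen (ideal_gen (insert t J) \<union> A) \<subseteq> ideal_gen (insert t (J \<union> A))"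
      by (rule ideal.span_minimal)
        (auto intro: ideal.span_base ideal.span_mono[THEN subsetD, rotated])
    show "ideal_gen (insert t (J \<union> A)) \<subseteq> ideal_gen (ideal_gen (insert t J) \<union> A)"
      by (rule ideal.span_mono) (auto intro: ideal.span_base)
  qed
  show "t * x \<in> ideal_gen (J \<union> g ` E)" if "x \<in> ideal_gen ({x. t * x \<in> J} \<union> g ` E)"
  proof -
    have "is_ideal {x. t * x \<in> ideal_gen (J \<union> g ` E)}"
      by (rule is_ideal_colon) simp
    then have "ideal_gen ({x. t * x \<in> J} \<union> g ` E) \<subseteq> {x. t * x \<in> ideal_gen (J \<union> g ` E)}"
      by (intro ideal.span_minimal) (auto intro: ideal.span_base ideal.span_scale)
    then show ?thesis using that by auto
  qed
  show "t * x \<in> ideal_gen (J \<union> g ` E) \<Longrightarrow> x \<in> ideal_gen ({x. t * x \<in> J} \<union> g ` E)"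
    using E
  proof (induction E arbitrary: x)
    case empty
    then show ?case
      using J by (simp add: ideal.span_base ideal.span_eq_iff[THEN iffD2])
  next
    case (insert i E)
    let ?C = "{x. t * x \<in> J}"
    obtain y where y: "t * x - g i * y \<in> ideal_gen (J \<union> g ` E)"
      using insert.prems by (auto simp: mem_ideal_gen_insert)
    \<comment> \<open>Modulo \<open>t\<close> the relation reads \<open>g i * y = 0\<close>, so
      regularity modulo \<open>J\<close> and \<open>t\<close> makes \<open>y\<close> a multiple
      \<open>t * y'\<close>; after that \<open>t\<close> can be factored out.\<close>
    have "- (g i * y) - t * (- x) \<in> ideal_gen (J \<union> g ` E)"
      using y by (simp add: algebra_simps)
    then have "- (g i * y) \<in> ideal_gen (insert t (J \<union> g ` E))"
      by (subst mem_ideal_gen_insert) blast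
    then have "g i * y \<in> ideal_gen (insert t (J \<union> g ` E))"
      using ideal.span_neg by fastforce
    then have "y \<in> ideal_gen (insert t (J \<union> g ` E))"
      using regular_modD[OF reg insert.hyps(2)] unfolding gen by blast
    then obtain y' where y': "y - t * y' \<in> ideal_gen (J \<union> g ` E)"
      by (auto simp: mem_ideal_gen_insert)
    have "(t * x - g i * y) + g i * (y - t * y') \<in> ideal_gen (J \<union> g ` E)"
      by (intro ideal.span_add y ideal.span_scale y')
    then have "t * (x - g i * y') \<in> ideal_gen (J \<union> g ` E)"
      by (simp add: algebra_simps)
    then have "x - g i * y' \<in> ideal_gen (?C \<union> g ` E)"
      by (rule insert.IH)
    then show ?case
      by (auto simp: mem_ideal_gen_insert)
  qed
qed

text \<open>Regularity passes from the outer terms of the short exact sequence to the middle one: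
  the right-hand term turns \<open>x\<close> into \<open>t * y\<close>, and
  \<open>colon_regular_mod\<close> moves \<open>y\<close> to the left-hand term, where
  \<open>g i * y = 0\<close> forces \<open>y = 0\<close>.\<close>

lemma regular_mod_extension:
  fixes g :: "'i::finite \<Rightarrow> 'a::comm_ring_1"
  assumes J: "is_ideal J" and reg: "regular_mod g (ideal_gen (insert t J))"
    and reg_colon: "regular_mod g {x. t * x \<in> J}"
  shows "regular_mod g J"
  unfolding regular_mod_def
proof (intro allI impI)
  fix E i x
  assume i: "i \<notin> E" and x: "g i * x \<in> ideal_gen (J \<union> g ` E)"
  note colon = colon_regular_mod[OF J reg finite, of _ E]
  have "g i * x \<in> ideal_gen (ideal_gen (insert t J) \<union> g ` E)"
    by (rule subsetD[OF ideal.span_mono x]) (auto intro: ideal.span_base)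
  then have "x \<in> ideal_gen (ideal_gen (insert t J) \<union> g ` E)"
    by (rule regular_modD[OF reg i])
  also have "\<dots> \<subseteq> ideal_gen (insert t (J \<union> g ` E))"
    by (rule ideal.span_minimal)
      (auto intro: ideal.span_base ideal.span_mono[THEN subsetD, rotated])
  finally obtain y where y: "x - t * y \<in> ideal_gen (J \<union> g ` E)"
    by (auto simp: mem_ideal_gen_insert)
  have "g i * x - g i * (x - t * y) \<in> ideal_gen (J \<union> g ` E)"
    by (intro ideal.span_diff x ideal.span_scale y)
  then have "t * (g i * y) \<in> ideal_gen (J \<union> g ` E)"
    by (simp add: algebra_simps)
  then have "g i * y \<in> ideal_gen ({x. t * x \<in> J} \<union> g ` E)"
    by (simp only: colon)
  then have "y \<in> ideal_gen ({x. t * x \<in> J} \<union> g ` E)"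
    by (rule regular_modD[OF reg_colon i])
  then have "t * y \<in> ideal_gen (J \<union> g ` E)"
    by (simp only: colon)
  then show "x \<in> ideal_gen (J \<union> g ` E)"
    using y mem_cong_diff by blast
qed

section \<open>Evaluation of polynomials\<close>

definition power_prod :: "('z::finite \<Rightarrow> 'a::comm_monoid_mult) \<Rightarrow> ('z \<Rightarrow>\<^sub>0 nat) \<Rightarrow> 'a" where
  "power_prod g u = (\<Prod>i\<in>UNIV. g i ^ lookup u i)"

lemma power_prod_0 [simp]: "power_prod g 0 = 1"
  by (simp add: power_prod_def)

lemma power_prod_add: "power_prod g (u + v) = power_prod g u * power_prod g v"
  by (simp add: power_prod_def lookup_add power_add prod.distrib)

lemma power_prod_single [simp]: "power_prod g (single i n) = g i ^ n"
proof -
  have "power_prod g (single i n) = (\<Prod>j\<in>UNIV. if j = i then g i ^ n else 1)"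
    unfolding power_prod_def by (intro prod.cong) (auto simp: lookup_single when_def)
  then show ?thesis by simp
qed

lemma (in comm_ring_hom) hom_power_prod: "hom (power_prod g u) = power_prod (\<lambda>i. hom (g i)) u"
  by (simp add: power_prod_def hom_prod hom_power)

lemma sum_single_lookup: "(\<Sum>u\<in>keys p. single u (lookup p u)) = p"
  by (rule poly_mapping_eqI)
    (auto simp: lookup_sum lookup_single when_def in_keys_iff sum.delta)

text \<open>Serves polynomials, as sums of terms, and exponent vectors, as sums of
  \<open>single i n\<close>.\<close>

lemma poly_mapping_add_induct [case_names single add]:
  fixes p :: "'u \<Rightarrow>\<^sub>0 'a::comm_monoid_add"
  assumes "\<And>u a. P (single u a)" "\<And>p q. P p \<Longrightarrow> P q \<Longrightarrow> P (p + q)"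
  shows "P p"
proof -
  have "P (\<Sum>u\<in>A. single u (lookup p u))" if "finite A" for A
    using that assms(1)[of _ 0] by induction (auto intro: assms)
  then show ?thesis
    by (metis finite_keys sum_single_lookup)
qed

text \<open>Covers all the homomorphisms that occur: \<open>h\<close> the identity and
  \<open>g = f\<close> give S -> R, \<open>h = Const\<close> and \<open>g = f\<close> give
  \<open>\<phi>\<close>, and a nested \<open>Const\<close> with \<open>g = Var\<close> embeds T into
  S.\<close>

definition peval ::
    "('r \<Rightarrow> 'a) \<Rightarrow> ('z \<Rightarrow> 'a) \<Rightarrow> ('z::finite, 'r::comm_ring_1) mpoly \<Rightarrow> 'a::comm_ring_1" where
  "peval h g p = (\<Sum>u\<in>keys p. h (lookup p u) * power_prod g u)"

lemma peval_superset:
  assumes "h 0 = 0" "finite A" "keys p \<subseteq> A"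
  shows "peval h g p = (\<Sum>u\<in>A. h (lookup p u) * power_prod g u)"
  unfolding peval_def
  by (rule sum.mono_neutral_left) (use assms in \<open>auto simp: in_keys_iff\<close>)

lemma peval_single [simp]: "h 0 = 0 \<Longrightarrow> peval h g (single u a) = h a * power_prod g u"
  by (subst peval_superset[of h "{u}"]) auto

lemma comm_ring_hom_peval:
  assumes "comm_ring_hom h"
  shows "comm_ring_hom (peval h g :: ('z::finite, 'r::comm_ring_1) mpoly \<Rightarrow> _)"
proof -
  interpret h: comm_ring_hom h by fact
  have add: "peval h g (p + q) = peval h g p + peval h g q" for p q :: "('z, 'r) mpoly"
  proof -
    have "keys (p + q) \<subseteq> keys p \<union> keys q"
      by (rule Poly_Mapping.keys_add)
    then show ?thesis
      by (subst (1 2 3) peval_superset[of h "keys p \<union> keys q"])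
        (auto simp: lookup_add h.hom_add distrib_right sum.distrib)
  qed
  have "peval h g (p * q) = peval h g p * peval h g q" for p q :: "('z, 'r) mpoly"
  proof (induction p rule: poly_mapping_add_induct)
    case (single u a)
    show ?case
    proof (induction q rule: poly_mapping_add_induct)
      case (single v b)
      show ?case
        by (simp add: mult_single h.hom_mult power_prod_add mult_ac)
    qed (simp only: distrib_left add)
  qed (simp add: add distrib_right)
  moreover have "peval h g 1 = 1"
    by (simp flip: single_one)
  moreover have "peval h g 0 = 0"
    by (simp add: peval_def)
  ultimately show ?thesis
    by unfold_locales (simp_all add: add)
qed

lemma peval_Const [simp]: "h 0 = 0 \<Longrightarrow> peval h g (Const a) = h a"
  by (simp add: Const_def)

lemma peval_Var [simp]: "comm_ring_hom h \<Longrightarrow> peval h g (Var i) = g i"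
proof -
  assume "comm_ring_hom h"
  then interpret h: comm_ring_hom h .
  show ?thesis by (simp add: Var_def)
qed

lemma comm_ring_hom_id: "comm_ring_hom (\<lambda>x::'a::comm_ring_1. x)"
  by unfold_locales auto

lemma comm_ring_hom_Const: "comm_ring_hom (Const :: 'r::comm_ring_1 \<Rightarrow> ('z, 'r) mpoly)"
  by unfold_locales (simp_all add: Const_def single_add mult_single)

lemma comm_ring_hom_compose: "comm_ring_hom f \<Longrightarrow> comm_ring_hom g \<Longrightarrow> comm_ring_hom (\<lambda>x. f (g x))"
proof -
  assume "comm_ring_hom f" "comm_ring_hom g"
  then interpret f: comm_ring_hom f + g: comm_ring_hom g by auto
  show ?thesis
    by unfold_locales (simp_all add: f.hom_add g.hom_add f.hom_mult g.hom_mult)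
qed

lemma power_prod_Var: "power_prod Var u = (single u 1 :: ('z::finite, 'r::comm_ring_1) mpoly)"
proof (induction u rule: poly_mapping_add_induct)
  case (single i n)
  have "Var i ^ n = (single (single i n) 1 :: ('z, 'r) mpoly)"
  proof (induction n)
    case (Suc n)
    have 1: "single i (Suc n) = single i 1 + single i n"
      by (simp add: Suc_eq_plus1_left flip: single_add)
    show ?case
      unfolding power_Suc Suc.IH 1 by (simp add: Var_def mult_single)
  qed simp
  then show ?case by simp
qed (simp add: power_prod_add mult_single)

lemma single_eq_Const_mult:
  "single u a = Const a * (single u 1 :: ('z, 'r::comm_ring_1) mpoly)"
  by (simp add: Const_def mult_single)

lemma hom_eq_peval:
  fixes p :: "('z::finite, 'r::comm_ring_1) mpoly"
  assumes "comm_ring_hom \<psi>" "\<And>a. \<psi> (Const a) = h a" "\<And>i. \<psi> (Var i) = g i"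
  shows "\<psi> p = peval h g p"
proof -
  interpret comm_ring_hom \<psi> by fact
  have "\<psi> (single u a :: ('z, 'r) mpoly) = h a * power_prod g u" for u a
    by (subst single_eq_Const_mult)
      (simp add: assms hom_mult hom_power_prod flip: power_prod_Var)
  then have "\<psi> (\<Sum>u\<in>keys p. single u (lookup p u)) = peval h g p"
    by (simp add: hom_sum peval_def)
  then show ?thesis
    by (simp add: sum_single_lookup)
qed

section \<open>Monomial ideals\<close>

definition upset :: "'u::plus set \<Rightarrow> bool" where
  "upset U \<longleftrightarrow> (\<forall>u\<in>U. \<forall>w. u + w \<in> U)"

definition up_closure :: "'u::plus set \<Rightarrow> 'u set" where
  "up_closure V = {v + w | v w. v \<in> V}"

text \<open>Given by exponents and not by generators, so that one set \<open>U\<close> names a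
  monomial ideal over the field and over R. It is an ideal when \<open>U\<close> is an
  \<open>upset\<close>.\<close>

definition monomial_ideal :: "('z \<Rightarrow>\<^sub>0 nat) set \<Rightarrow> ('z, 'r::comm_ring_1) mpoly set" where
  "monomial_ideal U = {p. keys p \<subseteq> U}"

lemma upset_up_closure: "upset (up_closure V :: 'u::ab_semigroup_add set)"
  by (auto simp: upset_def up_closure_def) (metis add.assoc)

lemma up_closure_upset: "upset U \<Longrightarrow> up_closure U = (U :: 'u::monoid_add set)"
  by (auto simp: upset_def up_closure_def) (metis add.right_neutral)

lemma subset_up_closure: "V \<subseteq> up_closure (V :: 'u::monoid_add set)"
  by (auto simp: up_closure_def) (metis add.right_neutral)

lemma lookup_single_mult:
  fixes p :: "'u::cancel_comm_monoid_add \<Rightarrow>\<^sub>0 'r::comm_semiring_1"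
  shows "lookup (single v a * p) (v + u) = a * lookup p u"
  by (induction p rule: poly_mapping_add_induct)
    (auto simp: mult_single lookup_single when_def lookup_add distrib_left)

lemma lookup_single_mult_0:
  fixes p :: "'u::cancel_comm_monoid_add \<Rightarrow>\<^sub>0 'r::comm_semiring_1"
  assumes "\<And>u. w \<noteq> v + u"
  shows "lookup (single v a * p) w = 0"
  using assms by (induction p rule: poly_mapping_add_induct)
    (auto simp: mult_single lookup_single when_def lookup_add distrib_left)

lemma keys_single_mult:
  fixes p :: "'u::cancel_comm_monoid_add \<Rightarrow>\<^sub>0 'r::comm_semiring_1"
  shows "keys (single v 1 * p) = (+) v ` keys p"
proof (intro equalityI subsetI)
  fix w assume "w \<in> keys (single v 1 * p)"
  then have w: "lookup (single v 1 * p) w \<noteq> 0" by (simp add: in_keys_iff)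
  then obtain u where "w = v + u" using lookup_single_mult_0 by metis
  then show "w \<in> (+) v ` keys p"
    using w by (auto simp: in_keys_iff lookup_single_mult)
qed (auto simp: in_keys_iff lookup_single_mult)

lemma is_ideal_monomial_ideal:
  fixes U :: "('z \<Rightarrow>\<^sub>0 nat) set"
  assumes "upset U"
  shows "is_ideal (monomial_ideal U :: ('z, 'r::comm_ring_1) mpoly set)"
proof (rule ideal.subspaceI)
  show "x + y \<in> monomial_ideal U" if "x \<in> monomial_ideal U" "y \<in> monomial_ideal U"
    for x y :: "('z, 'r) mpoly"
    using that Poly_Mapping.keys_add[of x y] by (auto simp: monomial_ideal_def)
  show "c * x \<in> monomial_ideal U" if "x \<in> monomial_ideal U" for c x :: "('z, 'r) mpoly"
    using that assms keys_mult[of x c]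
    by (fastforce simp: monomial_ideal_def upset_def mult.commute)
qed (simp add: monomial_ideal_def)

lemma single_mem_monomial_ideal: "u \<in> U \<Longrightarrow> single u a \<in> monomial_ideal U"
  by (simp add: monomial_ideal_def)

lemma ideal_gen_monomials:
  "ideal_gen ((\<lambda>v. single v 1) ` V)
     = (monomial_ideal (up_closure V) :: ('z, 'r::comm_ring_1) mpoly set)"
  (is "ideal_gen ?G = _")
proof (intro equalityI subsetI)
  show "p \<in> monomial_ideal (up_closure V)" if "p \<in> ideal_gen ?G" for p
    using that
    by (rule subsetD[OF ideal.span_minimal, rotated 2])
      (auto intro!: is_ideal_monomial_ideal upset_up_closure single_mem_monomial_ideal
        subset_up_closure[THEN subsetD])
next
  fix p :: "('z, 'r) mpoly"
  assume p: "p \<in> monomial_ideal (up_closure V)"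
  have "single u (lookup p u) \<in> ideal_gen ?G" if "u \<in> keys p" for u
  proof -
    have "u \<in> up_closure V"
      using that p by (auto simp: monomial_ideal_def)
    then obtain v w where u: "v \<in> V" "u = v + w"
      unfolding up_closure_def by blast
    have "single w (lookup p u) * single v 1 \<in> ideal_gen ?G"
      using u by (intro ideal.span_scale ideal.span_base) auto
    then show ?thesis
      by (simp add: mult_single u add.commute)
  qed
  then have "(\<Sum>u\<in>keys p. single u (lookup p u)) \<in> ideal_gen ?G"
    by (rule ideal.span_sum)
  then show "p \<in> ideal_gen ?G"
    by (simp add: sum_single_lookup)
qed

lemma monomial_ideal_eq_gen:
  "upset U \<Longrightarrow> (monomial_ideal U :: ('z, 'r::comm_ring_1) mpoly set)
     = ideal_gen ((\<lambda>v. single v 1) ` U)"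
  by (simp add: ideal_gen_monomials up_closure_upset)

lemma monomial_ideal_insert:
  fixes U :: "('z \<Rightarrow>\<^sub>0 nat) set"
  assumes "upset U"
  shows "ideal_gen (insert (single v 1) (monomial_ideal U))
    = (monomial_ideal (U \<union> up_closure {v}) :: ('z, 'r::comm_ring_1) mpoly set)"
proof -
  have 1: "up_closure (insert v U) = U \<union> up_closure {v}"
    by (subst up_closure_upset[OF assms, symmetric]) (auto simp: up_closure_def)
  have "ideal_gen (insert (single v 1) (monomial_ideal U :: ('z, 'r) mpoly set))
    = ideal_gen ((\<lambda>v. single v 1) ` insert v U)"
    unfolding ideal.span_eq
    using assms by (auto simp: monomial_ideal_eq_gen intro: ideal.span_base
        ideal.span_mono[THEN subsetD, rotated])
  then show ?thesis
    unfolding ideal_gen_monomials 1 .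
qed

lemma monomial_ideal_colon:
  "{x. single v 1 * x \<in> monomial_ideal U}
    = (monomial_ideal {u. u + v \<in> U} :: ('z, 'r::comm_ring_1) mpoly set)"
  by (auto simp: monomial_ideal_def keys_single_mult image_subset_iff add.commute subset_iff)

lemma up_closure_variables:
  "up_closure ((\<lambda>i. single i 1) ` D) = {u :: 'z \<Rightarrow>\<^sub>0 nat. \<exists>i\<in>D. lookup u i > 0}"
proof (intro equalityI subsetI)
  fix u :: "'z \<Rightarrow>\<^sub>0 nat" assume "u \<in> {u. \<exists>i\<in>D. lookup u i > 0}"
  then obtain i where i: "i \<in> D" "lookup u i > 0" by auto
  have "u = single i 1 + (u - single i 1)"
    using i(2) by (intro poly_mapping_eqI) (auto simp: lookup_add lookup_minus lookup_single when_def)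
  then show "u \<in> up_closure ((\<lambda>i. single i 1) ` D)"
    using i(1) by (auto simp: up_closure_def)
next
  fix u :: "'z \<Rightarrow>\<^sub>0 nat" assume "u \<in> up_closure ((\<lambda>i. single i 1) ` D)"
  then obtain i w where "i \<in> D" "u = single i 1 + w" by (auto simp: up_closure_def)
  then show "u \<in> {u. \<exists>i\<in>D. lookup u i > 0}"
    by (auto simp: lookup_add intro!: bexI[of _ i])
qed

lemma ideal_gen_variables:
  "ideal_gen (Var ` D)
     = (monomial_ideal {u. \<exists>i\<in>D. lookup u i > 0} :: ('z, 'r::comm_ring_1) mpoly set)"
  using ideal_gen_monomials[of "(\<lambda>i. single i 1) ` D", where 'r = 'r]
  by (simp add: up_closure_variables Var_def image_image)

section \<open>Coordinate subspaces\<close>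

lemma ideal_gen_ideal_gen_Un: "ideal_gen (ideal_gen A \<union> B) = ideal_gen (A \<union> B)"
proof (rule antisym)
  have "ideal_gen A \<subseteq> ideal_gen (A \<union> B)"
    by (rule ideal.span_mono) simp
  then show "ideal_gen (ideal_gen A \<union> B) \<subseteq> ideal_gen (A \<union> B)"
    by (intro ideal.span_minimal) (auto intro: ideal.span_base)
  show "ideal_gen (A \<union> B) \<subseteq> ideal_gen (ideal_gen A \<union> B)"
    by (rule ideal.span_mono) (auto intro: ideal.span_base)
qed

lemma power_diff_mem_ideal_gen:
  assumes "x - y \<in> ideal_gen L"
  shows "x ^ n - y ^ n \<in> ideal_gen L"
proof (induction n)
  case (Suc n)
  have "x * (x ^ n - y ^ n) + y ^ n * (x - y) \<in> ideal_gen L"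
    by (intro ideal.span_add ideal.span_scale Suc assms)
  then show ?case by (simp add: algebra_simps)
qed (simp add: ideal.span_zero)

lemma power_prod_diff_mem_ideal_gen:
  assumes "\<And>i. g i - h i \<in> ideal_gen L"
  shows "power_prod g u - power_prod h u \<in> ideal_gen L"
proof (induction u rule: poly_mapping_add_induct)
  case (add u v)
  have "power_prod g u * (power_prod g v - power_prod h v)
      + power_prod h v * (power_prod g u - power_prod h u) \<in> ideal_gen L"
    by (intro ideal.span_add ideal.span_scale add)
  then show ?case by (simp add: power_prod_add algebra_simps)
qed (simp add: power_diff_mem_ideal_gen assms)

lemma peval_diff_mem_ideal_gen:
  assumes "\<And>i. g i - g' i \<in> ideal_gen L"
  shows "peval h g p - peval h g' p \<in> ideal_gen L"
  unfolding peval_def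
  unfolding sum_subtractf[symmetric] right_diff_distrib[symmetric]
  by (intro ideal.span_sum ideal.span_scale power_prod_diff_mem_ideal_gen assms)

lemma peval_Const_Var: "peval Const Var p = (p :: ('z::finite, 'r::comm_ring_1) mpoly)"
  by (rule hom_eq_peval[symmetric, where \<psi> = "\<lambda>x. x"]) (auto intro: comm_ring_hom_id)

text \<open>For an ideal \<open>\<aa>\<close> of R this is its extension to R[z].\<close>

definition coeffs_in :: "'r::comm_ring_1 set \<Rightarrow> ('z, 'r) mpoly set" where
  "coeffs_in \<aa> = {p. \<forall>u. lookup p u \<in> \<aa>}"

lemma is_ideal_coeffs_in:
  assumes "is_ideal \<aa>"
  shows "is_ideal (coeffs_in \<aa> :: ('z, 'r::comm_ring_1) mpoly set)"
proof (rule ideal.subspaceI)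
  show "c * p \<in> coeffs_in \<aa>" if p: "p \<in> coeffs_in \<aa>" for c p :: "('z, 'r) mpoly"
  proof (induction c rule: poly_mapping_add_induct)
    case (single v a)
    have "lookup (single v a * p) w \<in> \<aa>" for w
    proof (cases "\<exists>u. w = v + u")
      case True
      then show ?thesis
        using p ideal.subspace_scale[OF assms] by (auto simp: lookup_single_mult coeffs_in_def)
    next
      case False
      then show ?thesis
        using assms by (simp add: lookup_single_mult_0 ideal.subspace_0)
    qed
    then show ?case by (simp add: coeffs_in_def)
  qed (auto simp: coeffs_in_def distrib_right lookup_add ideal.subspace_add[OF assms])
qed (auto simp: coeffs_in_def lookup_add ideal.subspace_0[OF assms] ideal.subspace_add[OF assms])

lemma coeffs_in_subset:
  assumes "\<And>x. x \<in> A \<Longrightarrow> Const x \<in> ideal_gen (L :: ('z, 'r::comm_ring_1) mpoly set)"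
    and p: "p \<in> coeffs_in (ideal_gen A)"
  shows "p \<in> ideal_gen L"
proof -
  have "single u (lookup p u) \<in> ideal_gen L" for u
  proof -
    have "Const (lookup p u) \<in> ideal_gen L"
      using p by (intro hom_mem_ideal_gen[OF comm_ring_hom_Const assms(1)]) (auto simp: coeffs_in_def)
    then show ?thesis
      by (subst single_eq_Const_mult) (rule mult_mem_ideal_gen_right)
  qed
  then have "(\<Sum>u\<in>keys p. single u (lookup p u)) \<in> ideal_gen L"
    by (intro ideal.span_sum)
  then show ?thesis by (simp add: sum_single_lookup)
qed

lemma ex_lookup_add_single_eq_0:
  fixes p :: "('z \<Rightarrow>\<^sub>0 nat) \<Rightarrow>\<^sub>0 'r::zero"
  shows "\<exists>n. lookup p (u + single i n) = 0"
proof (rule ccontr)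
  assume "\<not> ?thesis"
  then have "range (\<lambda>n. u + single i n) \<subseteq> keys p"
    by (auto simp: in_keys_iff)
  then have "finite (range (\<lambda>n. u + single i n))"
    by (rule finite_subset) simp
  moreover have "inj (\<lambda>n. u + single i n)"
    by (auto simp: inj_def dest!: arg_cong[where f = "\<lambda>w. lookup w i"])
  ultimately show False
    using finite_imageD infinite_UNIV_nat by blast
qed

text \<open>The product has the coefficient y_u - a y_(u + e_i) at u + e_i. So y_u lies in
  \<open>\<aa>\<close> once y_(u + e_i) does, and far enough in direction i the coefficients of
  \<open>y\<close> vanish.\<close>

lemma monic_linear_regular:
  fixes y :: "('z, 'r::comm_ring_1) mpoly"
  assumes \<aa>: "is_ideal \<aa>" and y: "(Var i - Const a) * y \<in> coeffs_in \<aa>"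
  shows "y \<in> coeffs_in \<aa>"
proof -
  have step: "lookup y u \<in> \<aa>" if "lookup y (u + single i 1) \<in> \<aa>" for u
  proof -
    have "lookup ((Var i - Const a) * y) (single i 1 + u)
        = lookup (single (single i 1) 1 * y) (single i 1 + u) - lookup (single 0 a * y) (0 + (single i 1 + u))"
      by (simp add: Var_def Const_def left_diff_distrib lookup_minus)
    also have "\<dots> = lookup y u - a * lookup y (u + single i 1)"
      by (simp only: lookup_single_mult) (simp add: add.commute)
    moreover have "lookup ((Var i - Const a) * y) (single i 1 + u) \<in> \<aa>"
      using y by (simp add: coeffs_in_def)
    ultimately have "lookup y u - a * lookup y (u + single i 1) \<in> \<aa>"
      by simp
    then have "(lookup y u - a * lookup y (u + single i 1)) + a * lookup y (u + single i 1) \<in> \<aa>"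
      by (intro ideal.subspace_add ideal.subspace_scale \<aa> that)
    then show ?thesis by simp
  qed
  have descend: "lookup y (u + single i n) \<in> \<aa> \<Longrightarrow> lookup y u \<in> \<aa>" for u n
  proof (induction n arbitrary: u)
    case (Suc n)
    have "u + single i (Suc n) = (u + single i n) + single i 1"
      by (simp add: add.assoc Suc_eq_plus1 flip: single_add)
    then show ?case
      using Suc.IH[of u] Suc.prems step[of "u + single i n"] by simp
  qed simp
  have "lookup y u \<in> \<aa>" for u
  proof -
    obtain n where "lookup y (u + single i n) = 0"
      using ex_lookup_add_single_eq_0[of y u i] by blast
    then show ?thesis
      using descend[of u n] ideal.subspace_0[OF \<aa>] by simp
  qed
  then show ?thesis
    by (simp add: coeffs_in_def)
qed

definition graph_gen :: "('z \<Rightarrow> 'r::comm_ring_1) \<Rightarrow> 'z \<Rightarrow> ('z, 'r) mpoly" where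
  "graph_gen f i = Var i - Const (f i)"

text \<open>Indexed by subsets of \<open>'z\<close> and not by lists of forms. The bound
  \<open>N\<close> counts the new element \<open>i\<close>, so that c-generic families have
  \<open>N = c + 1\<close>.\<close>

definition regular_subsets :: "nat \<Rightarrow> ('z::finite \<Rightarrow> 'r::comm_ring_1) \<Rightarrow> bool" where
  "regular_subsets N f \<longleftrightarrow>
     (\<forall>D i r. i \<notin> D \<longrightarrow> card (insert i D) \<le> N \<longrightarrow> f i * r \<in> ideal_gen (f ` D) \<longrightarrow> r \<in> ideal_gen (f ` D))"

text \<open>Killing z_j for j in \<open>D\<close> and setting z_j = f_j for j in \<open>E\<close>
  leaves a polynomial ring over R/(f_j : j in D and E). There the next element is -f_i if i is in
  \<open>D\<close>, and regular by hypothesis since all indices involved lie in \<open>D\<close>;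
  otherwise it is monic in z_i.\<close>

lemma regular_mod_variables:
  fixes f :: "'z::finite \<Rightarrow> 'r::comm_ring_1"
  assumes f: "regular_subsets N f" and D: "card D \<le> N"
  shows "regular_mod (graph_gen f) (ideal_gen (Var ` D))"
  unfolding regular_mod_def ideal_gen_ideal_gen_Un
proof (intro allI impI)
  fix E i x
  assume i: "i \<notin> E" and x: "graph_gen f i * x \<in> ideal_gen (Var ` D \<union> graph_gen f ` E)"
  \<comment> \<open>The substitution that eliminates the variables of \<open>D\<close> and
    \<open>E\<close>. By \<open>\<psi>_L\<close>, \<open>diff_L\<close> and \<open>C_L\<close>,
    membership of p in \<open>ideal_gen ?L\<close> means that \<open>?\<psi> p\<close> has its
    coefficients in \<open>?\<aa>\<close>.\<close>
  define G :: "'z \<Rightarrow> ('z, 'r) mpoly"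
    where "G i = (if i \<in> D then 0 else if i \<in> E then Const (f i) else Var i)" for i
  let ?\<psi> = "peval Const G" and ?\<aa> = "ideal_gen (f ` (D \<inter> E))"
    and ?L = "Var ` D \<union> graph_gen f ` E"
  have hom: "comm_ring_hom ?\<psi>"
    by (intro comm_ring_hom_peval comm_ring_hom_Const)
  interpret \<psi>: comm_ring_hom ?\<psi> by (rule hom)
  have C0: "Const 0 = (0 :: ('z, 'r) mpoly)"
    by (simp add: Const_def)
  have ideal_C: "is_ideal (coeffs_in ?\<aa> :: ('z, 'r) mpoly set)"
    by (rule is_ideal_coeffs_in) simp
  have Const_C: "Const (f j) \<in> coeffs_in ?\<aa>" if "j \<in> D" "j \<in> E" for j
    using that by (auto simp: coeffs_in_def Const_def lookup_single when_def ideal.span_zero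
        intro: ideal.span_base)
  have \<psi>_L: "?\<psi> p \<in> coeffs_in ?\<aa>" if "p \<in> ideal_gen ?L" for p
  proof -
    have "ideal_gen ?L \<subseteq> {p. ?\<psi> p \<in> coeffs_in ?\<aa>}"
    proof (rule ideal.span_minimal)
      show "is_ideal {p. ?\<psi> p \<in> coeffs_in ?\<aa>}"
        by (rule is_ideal_preimage[OF hom ideal_C])
      show "?L \<subseteq> {p. ?\<psi> p \<in> coeffs_in ?\<aa>}"
        using ideal.subspace_neg[OF ideal_C Const_C]
        by (auto simp: graph_gen_def G_def C0 comm_ring_hom_Const \<psi>.hom_minus ideal.subspace_0[OF ideal_C])
    qed
    then show ?thesis using that by blast
  qed
  have diff_L: "p - ?\<psi> p \<in> ideal_gen ?L" for p
  proof -
    have "peval Const Var p - ?\<psi> p \<in> ideal_gen ?L"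
      by (rule peval_diff_mem_ideal_gen)
        (auto simp: G_def ideal.span_zero intro!: ideal.span_base simp flip: graph_gen_def)
    then show ?thesis by (simp add: peval_Const_Var)
  qed
  have C_L: "p \<in> ideal_gen ?L" if "p \<in> coeffs_in ?\<aa>" for p
  proof (rule coeffs_in_subset[OF _ that])
    fix r assume "r \<in> f ` (D \<inter> E)"
    then obtain j where j: "j \<in> D" "j \<in> E" "r = f j" by auto
    have "Var j - graph_gen f j \<in> ideal_gen ?L"
      using j by (intro ideal.span_diff ideal.span_base) auto
    then show "Const r \<in> ideal_gen ?L"
      by (simp add: graph_gen_def j)
  qed
  have "?\<psi> (graph_gen f i) * ?\<psi> x \<in> coeffs_in ?\<aa>"
    using \<psi>_L[OF x] by (simp add: \<psi>.hom_mult)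
  moreover have "?\<psi> (graph_gen f i) = (if i \<in> D then 0 else Var i) - Const (f i)"
    using i by (simp add: graph_gen_def G_def C0 comm_ring_hom_Const \<psi>.hom_minus)
  ultimately have mem: "((if i \<in> D then 0 else Var i) - Const (f i)) * ?\<psi> x \<in> coeffs_in ?\<aa>"
    by simp
  have "?\<psi> x \<in> coeffs_in ?\<aa>"
  proof (cases "i \<in> D")
    case True
    have "card (insert i (D \<inter> E)) \<le> N"
      using True by (intro le_trans[OF card_mono D]) auto
    moreover have "f i * lookup (?\<psi> x) u \<in> ?\<aa>" for u
    proof -
      have "- (lookup (- (single 0 (f i) * ?\<psi> x)) u) \<in> ?\<aa>"
        using mem True by (intro ideal.span_neg) (auto simp: coeffs_in_def Const_def)
      then have "lookup (single 0 (f i) * ?\<psi> x) (0 + u) \<in> ?\<aa>"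
        by simp
      then show ?thesis by (simp only: lookup_single_mult)
    qed
    moreover have "i \<notin> D \<inter> E"
      using i by simp
    ultimately have "lookup (?\<psi> x) u \<in> ?\<aa>" for u
      using f unfolding regular_subsets_def by metis
    then show ?thesis
      by (simp add: coeffs_in_def)
  next
    case False
    then show ?thesis
      using mem by (simp add: monic_linear_regular[of ?\<aa> i "f i" "?\<psi> x"])
  qed
  then show "x \<in> ideal_gen ?L"
    using mem_cong_diff[OF diff_L, of x] C_L by simp
qed

section \<open>Splitting monomial ideals\<close>

text \<open>A certificate that knows neither the forms nor the coefficient ring. Whatever passes
  from the two ends of the short exact sequence to its middle follows by induction on it; this is
  done for regularity and for associated primes.\<close>

inductive splits :: "'z set set \<Rightarrow> ('z \<Rightarrow>\<^sub>0 nat) set \<Rightarrow> bool" for \<D> where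
  unit: "splits \<D> UNIV"
| leaf: "D \<in> \<D> \<Longrightarrow> splits \<D> {u. \<exists>i\<in>D. lookup u i > 0}"
| split: "upset U \<Longrightarrow> splits \<D> {u. u + single i 1 \<in> U}
    \<Longrightarrow> splits \<D> (U \<union> up_closure {single i 1}) \<Longrightarrow> splits \<D> U"

lemma splits_regular_mod:
  fixes f :: "'z::finite \<Rightarrow> 'r::comm_ring_1"
  assumes "splits \<D> U" "regular_subsets N f" "\<And>D. D \<in> \<D> \<Longrightarrow> card D \<le> N"
  shows "regular_mod (graph_gen f) (monomial_ideal U)"
  using assms(1)
proof induction
  case unit
  have "monomial_ideal UNIV = (UNIV :: ('z, 'r) mpoly set)"
    by (simp add: monomial_ideal_def)
  then show ?case by (simp add: regular_mod_UNIV)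
next
  case (leaf D)
  then show ?case
    using regular_mod_variables[OF assms(2,3)] by (simp flip: ideal_gen_variables)
next
  case (split U i)
  show ?case
    by (rule regular_mod_extension[where t = "single (single i 1) 1"])
      (use split in \<open>simp_all add: is_ideal_monomial_ideal monomial_ideal_insert monomial_ideal_colon\<close>)
qed

section \<open>Ideals given by a bound on the c largest deficits\<close>

definition bounded_sums :: "nat \<Rightarrow> nat \<Rightarrow> ('z \<Rightarrow> nat) \<Rightarrow> bool" where
  "bounded_sums c K w \<longleftrightarrow> (\<forall>A. card A \<le> c \<longrightarrow> sum w A \<le> K)"

text \<open>Made to be stable under splitting: a colon by z_i with i outside \<open>D\<close> lowers
  \<open>B i\<close>, and adding z_i puts i into \<open>D\<close>. Truncated subtraction supplies
  the maximum with 0.\<close>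

definition threshold :: "nat \<Rightarrow> nat \<Rightarrow> 'z set \<Rightarrow> ('z \<Rightarrow> nat) \<Rightarrow> ('z \<Rightarrow>\<^sub>0 nat) set" where
  "threshold c K D B = {u. (\<exists>i\<in>D. lookup u i > 0) \<or> bounded_sums c K (\<lambda>i. B i - lookup u i)}"

lemma bounded_sums_mono:
  "bounded_sums c K w \<Longrightarrow> (\<And>i. w' i \<le> w i) \<Longrightarrow> bounded_sums c K w'"
  unfolding bounded_sums_def by (meson le_trans sum_mono)

lemma upset_threshold: "upset (threshold c K D B)"
  unfolding upset_def
proof (intro ballI allI)
  fix u w :: "'a \<Rightarrow>\<^sub>0 nat"
  assume u: "u \<in> threshold c K D B"
  have "bounded_sums c K (\<lambda>i. B i - lookup (u + w) i)" if "bounded_sums c K (\<lambda>i. B i - lookup u i)"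
    by (rule bounded_sums_mono[OF that]) (simp add: lookup_add)
  then show "u + w \<in> threshold c K D B"
    using u by (auto simp: threshold_def lookup_add)
qed

lemma threshold_colon:
  assumes "i \<notin> D"
  shows "{u. u + single i 1 \<in> threshold c K D B} = threshold c K D (B(i := B i - 1))"
proof -
  have 1: "(\<lambda>j. B j - lookup (u + single i 1) j) = (\<lambda>j. (B(i := B i - 1)) j - lookup u j)" for u
    by (rule ext) (auto simp: lookup_add lookup_single when_def)
  have 2: "(\<exists>j\<in>D. lookup (u + single i 1) j > 0) \<longleftrightarrow> (\<exists>j\<in>D. lookup u j > 0)" for u
    using assms by (auto simp: lookup_add lookup_single when_def)
  show ?thesis
    unfolding threshold_def mem_Collect_eq 1 2 ..
qed

lemma up_closure_single: "up_closure {single i 1} = {u :: 'z \<Rightarrow>\<^sub>0 nat. lookup u i > 0}"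
  using up_closure_variables[of "{i}"] by simp

lemma threshold_insert:
  "threshold c K D B \<union> up_closure {single i 1} = threshold c K (insert i D) B"
  by (auto simp: threshold_def up_closure_single)

lemma ex_poly_mapping_lookup: "\<exists>u :: 'z::finite \<Rightarrow>\<^sub>0 nat. lookup u = h"
  by (rule exI[of _ "Abs_poly_mapping h"]) simp

text \<open>Exchange argument: the elements of \<open>A\<close> outside \<open>D\<close> are traded
  for as many elements of \<open>D' - A\<close>, whose values are at least as large. There are
  enough of these because \<open>card A \<le> card D'\<close>.\<close>

lemma sum_le_sum_top:
  fixes B :: "'z::finite \<Rightarrow> nat"
  assumes top: "\<And>i j. i \<in> D' \<Longrightarrow> j \<notin> D \<Longrightarrow> B j \<le> B i" and D': "D' \<subseteq> D" and A: "card A \<le> card D'"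
  shows "\<exists>A'. A' \<subseteq> D \<and> card A' \<le> card A \<and> sum B A \<le> sum B A'"
proof (cases "A \<subseteq> D")
  case False
  have "card (A - D) + card (A \<inter> D') \<le> card A"
    using D' by (subst card_Un_disjoint[symmetric]) (auto intro!: card_mono)
  then have "card (A - D) \<le> card (D' - A)"
    using A card_Diff_subset_Int[of D' A] by (simp add: Int_commute)
  then obtain X where X: "X \<subseteq> D' - A" "card X = card (A - D)"
    by (meson obtain_subset_with_card_n)
  define \<beta> where "\<beta> = Min (B ` X)"
  have "card (A - D) > 0"
    using False by (auto simp: card_gt_0_iff)
  then have "X \<noteq> {}"
    unfolding X(2)[symmetric] by (simp add: card_gt_0_iff)
  then have "\<beta> \<in> B ` X"
    unfolding \<beta>_def by (intro Min_in) auto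
  then obtain x where x: "x \<in> X" "B x = \<beta>"
    by auto
  have "B j \<le> \<beta>" if "j \<in> A - D" for j
    using top[of x j] x X(1) that by auto
  then have "sum B (A - D) \<le> card (A - D) * \<beta>"
    using sum_bounded_above[of "A - D" B \<beta>] by simp
  also have "\<dots> \<le> sum B X"
    unfolding X(2)[symmetric] using sum_bounded_below[of X \<beta> B] by (simp add: \<beta>_def)
  finally have "sum B (A \<inter> D) + sum B (A - D) \<le> sum B (A \<inter> D) + sum B X"
    by simp
  also have "\<dots> = sum B ((A \<inter> D) \<union> X)"
    using X by (intro sum.union_disjoint[symmetric]) auto
  also have "sum B (A \<inter> D) + sum B (A - D) = sum B A"
    using sum.Int_Diff[of A B D] by simp
  finally have "sum B A \<le> sum B ((A \<inter> D) \<union> X)" .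
  moreover have "card ((A \<inter> D) \<union> X) \<le> card A"
  proof -
    have "card ((A \<inter> D) \<union> X) = card (A \<inter> D) + card (A - D)"
      using X by (subst card_Un_disjoint) auto
    also have "\<dots> = card A"
      using card_Int_Diff[of A D] by simp
    finally show ?thesis by simp
  qed
  ultimately show ?thesis
    using X D' by (intro exI[of _ "(A \<inter> D) \<union> X"]) auto
qed (intro exI[of _ A], simp)

text \<open>
  The variable to split off is always one with the largest remaining exponent. Then the variables in
  \<open>D\<^sub>1\<close> dominate all others, so that once there are \<open>c\<close> of them the sums in question are settled.
\<close>
lemma splits_threshold_aux:
  fixes B B\<^sub>0 :: "'z::finite \<Rightarrow> nat"
  assumes "\<And>i j. i \<in> D\<^sub>1 \<Longrightarrow> j \<notin> D\<^sub>0 \<union> D\<^sub>1 \<Longrightarrow> B j \<le> B i" and "card D\<^sub>1 \<le> c" and "\<And>i. B i \<le> B\<^sub>0 i"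
  shows "splits {D. card D \<le> card D\<^sub>0 + c \<and> \<not> bounded_sums c K (\<lambda>i. if i \<in> D then B\<^sub>0 i else 0)}
           (threshold c K (D\<^sub>0 \<union> D\<^sub>1) B)"
  using assms
proof (induction "\<Sum>i\<in>- (D\<^sub>0 \<union> D\<^sub>1). B i" arbitrary: D\<^sub>1 B rule: less_induct)
  case less
  let ?D = "D\<^sub>0 \<union> D\<^sub>1"
  let ?\<D> = "{D. card D \<le> card D\<^sub>0 + c \<and> \<not> bounded_sums c K (\<lambda>i. if i \<in> D then B\<^sub>0 i else 0)}"
  have card_D: "card ?D \<le> card D\<^sub>0 + c"
    using card_Un_le[of D\<^sub>0 D\<^sub>1] less.prems(2) by linarith
  show ?case
  proof (cases "card D\<^sub>1 = c \<or> (\<forall>i. i \<notin> ?D \<longrightarrow> B i = 0)")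
    case True
    \<comment> \<open>Outside the ideal of the variables in \<open>?D\<close> the deficits on
      \<open>?D\<close> are still \<open>B\<close>, and in this case subsets of \<open>?D\<close>
      have the largest sums. So the bound no longer depends on \<open>u\<close>, and the ideal is
      the unit ideal or a leaf.\<close>
    have *: "bounded_sums c K B" if u: "\<forall>i\<in>?D. lookup u i = 0"
      and b: "bounded_sums c K (\<lambda>i. B i - lookup u i)" for u
      unfolding bounded_sums_def
    proof (intro allI impI)
      fix A :: "'z set" assume A: "card A \<le> c"
      have "\<exists>A'. A' \<subseteq> ?D \<and> card A' \<le> card A \<and> sum B A \<le> sum B A'"
      proof (cases "card D\<^sub>1 = c")
        case True
        then show ?thesis
          using A less.prems(1) by (intro sum_le_sum_top[of D\<^sub>1]) auto
      next
        case False
        then have "sum B A = sum B (A \<inter> ?D)"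
          using True by (intro sum.mono_neutral_right) auto
        then show ?thesis
          by (intro exI[of _ "A \<inter> ?D"]) (auto intro: card_mono)
      qed
      then obtain A' where A': "A' \<subseteq> ?D" "card A' \<le> card A" "sum B A \<le> sum B A'"
        by blast
      have "sum B A' = (\<Sum>i\<in>A'. B i - lookup u i)"
        using A'(1) u by (intro sum.cong) auto
      also have "\<dots> \<le> K"
        using b A' A by (auto simp: bounded_sums_def)
      finally show "sum B A \<le> K" using A' by simp
    qed
    show ?thesis
    proof (cases "bounded_sums c K B")
      case True
      then have "threshold c K ?D B = UNIV"
        using bounded_sums_mono[OF True] by (auto simp: threshold_def)
      then show ?thesis by (simp add: splits.unit)
    next
      case False
      have "\<exists>i\<in>?D. lookup u i > 0" if "bounded_sums c K (\<lambda>i. B i - lookup u i)" for u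
        using *[of u] that False by (metis neq0_conv)
      then have "threshold c K ?D B = {u. \<exists>i\<in>?D. lookup u i > 0}"
        unfolding threshold_def by blast
      moreover have "\<not> bounded_sums c K (\<lambda>i. if i \<in> ?D then B\<^sub>0 i else 0)"
      proof
        assume b: "bounded_sums c K (\<lambda>i. if i \<in> ?D then B\<^sub>0 i else 0)"
        \<comment> \<open>All deficits of this \<open>u\<close> sit on \<open>?D\<close>, so a bound
          for \<open>?D\<close> alone would carry over, by \<open>*\<close>, to all of
          \<open>B\<close>.\<close>
        obtain u where u: "lookup u = (\<lambda>i. if i \<in> ?D then 0 else B i)"
          using ex_poly_mapping_lookup by blast
        have "bounded_sums c K (\<lambda>i. B i - lookup u i)"
          by (rule bounded_sums_mono[OF b]) (auto simp: u less.prems(3))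
        then show False
          using *[of u] False by (simp add: u)
      qed
      ultimately show ?thesis
        using card_D splits.leaf[of ?D ?\<D>] by simp
    qed
  next
    case False
    then have ne: "B ` (- ?D) \<noteq> {}"
      by auto
    have "Max (B ` (- ?D)) \<in> B ` (- ?D)"
      using ne by (intro Max_in) auto
    then obtain i where i: "i \<notin> ?D" "B i = Max (B ` (- ?D))"
      by auto
    have max: "B j \<le> B i" if "j \<notin> ?D" for j
      using that i by simp
    have pos: "B i > 0"
      using False max by (auto intro!: gr0I)
    show ?thesis
    proof (rule splits.split[OF upset_threshold])
      have "splits ?\<D> (threshold c K ?D (B(i := B i - 1)))"
      proof (rule less.hyps)
        show "(\<Sum>j\<in>- ?D. (B(i := B i - 1)) j) < (\<Sum>j\<in>- ?D. B j)"
          using i pos by (intro sum_strict_mono_ex1) auto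
        show "(B(i := B i - 1)) k \<le> (B(i := B i - 1)) j" if "j \<in> D\<^sub>1" "k \<notin> ?D" for j k
        proof -
          have "j \<noteq> i" using that i by auto
          then show ?thesis using less.prems(1)[OF that] by auto
        qed
        show "(B(i := B i - 1)) j \<le> B\<^sub>0 j" for j
          using less.prems(3)[of j] by auto
      qed (fact less.prems(2))
      then show "splits ?\<D> {u. u + single i 1 \<in> threshold c K ?D B}"
        using threshold_colon[OF i(1)] by simp
      have "splits ?\<D> (threshold c K (D\<^sub>0 \<union> insert i D\<^sub>1) B)"
      proof (rule less.hyps)
        show "(\<Sum>j\<in>- (D\<^sub>0 \<union> insert i D\<^sub>1). B j) < (\<Sum>j\<in>- ?D. B j)"
          using i pos by (intro sum_strict_mono2) auto
        show "B k \<le> B j" if "j \<in> insert i D\<^sub>1" "k \<notin> D\<^sub>0 \<union> insert i D\<^sub>1" for j k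
          using that max less.prems(1) by auto
        show "card (insert i D\<^sub>1) \<le> c"
          using False less.prems(2) i by auto
      qed (fact less.prems(3))
      then show "splits ?\<D> (threshold c K ?D B \<union> up_closure {single i 1})"
        by (simp only: threshold_insert Un_insert_right)
    qed
  qed
qed

text \<open>\<open>D\<^sub>0\<close> is empty for the ideal itself and \<open>{i}\<close> for its
  sum with z_i, which controls a colon by z_i. That the bound fails on \<open>D\<close> is recorded
  in order to recognize later which primes can be associated.\<close>

lemma splits_threshold:
  "splits {D. card D \<le> card D\<^sub>0 + c \<and> \<not> bounded_sums c K (\<lambda>i. if i \<in> D then B i else 0)}
     (threshold c K D\<^sub>0 (B :: 'z::finite \<Rightarrow> nat))"
  using splits_threshold_aux[of "{}" D\<^sub>0 B c B K] by simp

section \<open>Ideals generated by products of forms\<close>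

text \<open>The extension to R of the monomial ideal of \<open>U\<close> along z_i -> f_i. For
  \<open>f = Var\<close> and an \<open>upset\<close> it is the monomial ideal itself.\<close>

definition power_prod_ideal ::
    "('z::finite \<Rightarrow> 'r::comm_ring_1) \<Rightarrow> ('z \<Rightarrow>\<^sub>0 nat) set \<Rightarrow> 'r set" where
  "power_prod_ideal f U = ideal_gen (power_prod f ` U)"

lemma is_ideal_power_prod_ideal [simp]: "is_ideal (power_prod_ideal f U)"
  by (simp add: power_prod_ideal_def)

lemma power_prod_mem_ideal: "u \<in> U \<Longrightarrow> power_prod f u \<in> power_prod_ideal f U"
  by (simp add: power_prod_ideal_def ideal.span_base)

lemma power_prod_ideal_mono: "U \<subseteq> V \<Longrightarrow> power_prod_ideal f U \<subseteq> power_prod_ideal f V"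
  unfolding power_prod_ideal_def by (intro ideal.span_mono image_mono)

lemma power_prod_ideal_UNIV: "power_prod_ideal f UNIV = UNIV"
  using power_prod_mem_ideal[of 0 UNIV f] by (intro ideal_one_eq_UNIV) auto

lemma power_prod_ideal_up_closure: "power_prod_ideal f (up_closure V) = ideal_gen (power_prod f ` V)"
proof (rule antisym)
  show "power_prod_ideal f (up_closure V) \<subseteq> ideal_gen (power_prod f ` V)"
    unfolding power_prod_ideal_def
  proof (rule ideal.span_minimal)
    show "power_prod f ` up_closure V \<subseteq> ideal_gen (power_prod f ` V)"
    proof
      fix x assume "x \<in> power_prod f ` up_closure V"
      then obtain v w where "v \<in> V" "x = power_prod f (v + w)"
        by (auto simp: up_closure_def)
      then show "x \<in> ideal_gen (power_prod f ` V)"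
        by (simp add: power_prod_add mult_mem_ideal_gen_right ideal.span_base)
    qed
  qed simp
  show "ideal_gen (power_prod f ` V) \<subseteq> power_prod_ideal f (up_closure V)"
    unfolding power_prod_ideal_def by (intro ideal.span_mono image_mono subset_up_closure)
qed

lemma power_prod_ideal_variables:
  "power_prod_ideal f {u. \<exists>i\<in>D. lookup u i > 0} = ideal_gen (f ` D)"
  unfolding up_closure_variables[symmetric] power_prod_ideal_up_closure
  by (simp add: image_image)

lemma power_prod_ideal_insert:
  assumes "upset U"
  shows "power_prod_ideal f (U \<union> up_closure {v}) = ideal_gen (insert (power_prod f v) (power_prod_ideal f U))"
proof -
  have 1: "U \<union> up_closure {v} = up_closure (insert v U)"
    by (subst up_closure_upset[OF assms, symmetric]) (auto simp: up_closure_def)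
  have "ideal_gen (ideal_gen (power_prod f ` U) \<union> {power_prod f v}) = ideal_gen (power_prod f ` U \<union> {power_prod f v})"
    by (rule ideal_gen_ideal_gen_Un)
  then show ?thesis
    unfolding 1 power_prod_ideal_up_closure by (simp add: power_prod_ideal_def)
qed

lemma power_prod_Const_cong:
  fixes f :: "'z::finite \<Rightarrow> 'r::comm_ring_1"
  shows "single u 1 - Const (power_prod f u) \<in> ideal_gen (range (graph_gen f))"
proof -
  interpret C: comm_ring_hom "Const :: 'r \<Rightarrow> ('z, 'r) mpoly"
    by (rule comm_ring_hom_Const)
  have "power_prod Var u - power_prod (\<lambda>i. Const (f i)) u \<in> ideal_gen (range (graph_gen f))"
    by (rule power_prod_diff_mem_ideal_gen) (auto intro!: ideal.span_base simp flip: graph_gen_def)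
  then show ?thesis
    by (simp add: power_prod_Var C.hom_power_prod)
qed

lemma peval_mem_power_prod_ideal:
  fixes f :: "'z::finite \<Rightarrow> 'r::comm_ring_1"
  assumes "p \<in> ideal_gen (monomial_ideal U \<union> range (graph_gen f))"
  shows "peval (\<lambda>x. x) f p \<in> power_prod_ideal f U"
proof -
  let ?\<pi> = "peval (\<lambda>x. x) f"
  have hom: "comm_ring_hom ?\<pi>"
    by (intro comm_ring_hom_peval comm_ring_hom_id)
  interpret \<pi>: comm_ring_hom ?\<pi> by (rule hom)
  show ?thesis
    unfolding power_prod_ideal_def
  proof (rule hom_mem_ideal_gen[OF hom _ assms])
    fix p assume "p \<in> monomial_ideal U \<union> range (graph_gen f)"
    then consider "keys p \<subseteq> U" | i where "p = graph_gen f i"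
      by (auto simp: monomial_ideal_def)
    then show "?\<pi> p \<in> ideal_gen (power_prod f ` U)"
    proof cases
      case 1
      then show ?thesis
        unfolding peval_def by (intro ideal.span_sum ideal.span_scale ideal.span_base) auto
    next
      case 2
      then show ?thesis
        by (simp add: graph_gen_def \<pi>.hom_minus comm_ring_hom_id ideal.span_zero)
    qed
  qed
qed

text \<open>Moves questions about R to S, where the regular sequence lives: modulo all z_i - f_i,
  the monomial z^u equals the constant f^u.\<close>

lemma mem_power_prod_ideal_iff:
  fixes f :: "'z::finite \<Rightarrow> 'r::comm_ring_1"
  shows "y \<in> power_prod_ideal f U \<longleftrightarrow> Const y \<in> ideal_gen (monomial_ideal U \<union> range (graph_gen f))"
    (is "_ \<longleftrightarrow> _ \<in> ideal_gen ?L")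
proof
  assume "y \<in> power_prod_ideal f U"
  then show "Const y \<in> ideal_gen ?L"
    unfolding power_prod_ideal_def
  proof (rule hom_mem_ideal_gen[OF comm_ring_hom_Const, rotated])
    fix x assume "x \<in> power_prod f ` U"
    then obtain u where u: "u \<in> U" "x = power_prod f u" by auto
    have "ideal_gen (range (graph_gen f)) \<subseteq> ideal_gen ?L"
      by (rule ideal.span_mono) simp
    then have "single u 1 - Const x \<in> ideal_gen ?L"
      unfolding u(2) using power_prod_Const_cong by blast
    moreover have "single u 1 \<in> ideal_gen ?L"
      using u(1) by (intro ideal.span_base) (simp add: single_mem_monomial_ideal)
    ultimately show "Const x \<in> ideal_gen ?L"
      using mem_cong_diff by blast
  qed
next
  assume "Const y \<in> ideal_gen ?L"
  then have "peval (\<lambda>x. x) f (Const y) \<in> power_prod_ideal f U"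
    by (rule peval_mem_power_prod_ideal)
  then show "y \<in> power_prod_ideal f U"
    by simp
qed

text \<open>This is \<open>colon_regular_mod\<close> for \<open>t = single v 1\<close> and the full
  sequence, read in R: modulo the z_i - f_i, multiplication by z^v is multiplication by f^v.\<close>

lemma power_prod_ideal_colon:
  fixes f :: "'z::finite \<Rightarrow> 'r::comm_ring_1"
  assumes U: "upset U" and reg: "regular_mod (graph_gen f) (monomial_ideal (U \<union> up_closure {v}))"
  shows "power_prod f v * y \<in> power_prod_ideal f U \<longleftrightarrow> y \<in> power_prod_ideal f {u. u + v \<in> U}"
proof -
  interpret C: comm_ring_hom "Const :: 'r \<Rightarrow> ('z, 'r) mpoly"
    by (rule comm_ring_hom_Const)
  let ?L = "monomial_ideal U \<union> range (graph_gen f)"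
  have "ideal_gen (range (graph_gen f)) \<subseteq> ideal_gen ?L"
    by (rule ideal.span_mono) simp
  then have "single v 1 - Const (power_prod f v) \<in> ideal_gen ?L"
    using power_prod_Const_cong by blast
  then have "(single v 1 - Const (power_prod f v)) * Const y \<in> ideal_gen ?L"
    by (rule mult_mem_ideal_gen_right)
  then have "single v 1 * Const y - Const (power_prod f v * y) \<in> ideal_gen ?L"
    by (simp add: left_diff_distrib C.hom_mult)
  then have "power_prod f v * y \<in> power_prod_ideal f U \<longleftrightarrow> single v 1 * Const y \<in> ideal_gen ?L"
    using mem_power_prod_ideal_iff mem_cong_diff by blast
  also have "\<dots> \<longleftrightarrow> Const y \<in> ideal_gen (monomial_ideal {u. u + v \<in> U} \<union> range (graph_gen f))"
    unfolding monomial_ideal_colon[symmetric]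
    using U reg
    by (intro colon_regular_mod) (simp_all add: is_ideal_monomial_ideal monomial_ideal_insert)
  finally show ?thesis
    by (simp add: mem_power_prod_ideal_iff)
qed

section \<open>Associated primes\<close>

text \<open>Let \<open>p\<close> be the annihilator of \<open>x\<close> modulo \<open>K\<close>. If
  some r outside \<open>p\<close> sends \<open>x\<close> to a multiple \<open>t * y\<close>, then
  \<open>p\<close> is also the annihilator of \<open>y\<close> modulo the colon ideal; if there is
  no such r, adding \<open>t\<close> does not enlarge the annihilator of \<open>x\<close>.\<close>

lemma Ass_quot_split:
  assumes K: "is_ideal K" and p: "p \<in> Ass_quot K"
  shows "p \<in> Ass_quot {x. t * x \<in> K} \<or> p \<in> Ass_quot (ideal_gen (insert t K))"
proof -
  obtain x where prime: "prime_ideal p" and x: "p = {r. r * x \<in> K}"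
    using p by (auto simp: Ass_quot_def)
  have gen: "z \<in> ideal_gen (insert t K) \<longleftrightarrow> (\<exists>y. z - t * y \<in> K)" for z
    using K by (simp add: mem_ideal_gen_insert ideal.span_eq_iff[THEN iffD2])
  show ?thesis
  proof (cases "\<exists>r. r \<notin> p \<and> r * x \<in> ideal_gen (insert t K)")
    case True
    then obtain r y where r: "r \<notin> p" "r * x - t * y \<in> K"
      by (auto simp: gen)
    have "q \<in> p \<longleftrightarrow> t * (q * y) \<in> K" for q
    proof -
      have "q \<in> p \<longleftrightarrow> q * r \<in> p"
        using prime r(1) ideal.subspace_scale[of p q r]
        by (metis prime_ideal_def ideal.subspace_scale mult.commute)
      also have "\<dots> \<longleftrightarrow> q * r * x \<in> K"
        by (simp add: x)
      also have "\<dots> \<longleftrightarrow> t * (q * y) \<in> K"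
      proof -
        have "q * (r * x - t * y) \<in> K"
          by (rule ideal.subspace_scale[OF K r(2)])
        then have "q * r * x - t * (q * y) \<in> ideal_gen K"
          using K by (simp add: right_diff_distrib mult.assoc mult.left_commute ideal.span_eq_iff[THEN iffD2])
        then have "q * r * x \<in> ideal_gen K \<longleftrightarrow> t * (q * y) \<in> ideal_gen K"
          by (rule mem_cong_diff)
        then show ?thesis
          using K by (simp add: ideal.span_eq_iff[THEN iffD2])
      qed
      finally show ?thesis .
    qed
    then have "p = {q. q * y \<in> {x. t * x \<in> K}}"
      by blast
    then show ?thesis
      using prime unfolding Ass_quot_def by blast
  next
    case False
    have "K \<subseteq> ideal_gen (insert t K)"
      by (auto intro: ideal.span_base)
    then have "p = {r. r * x \<in> ideal_gen (insert t K)}"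
      using False x by blast
    then show ?thesis
      using prime unfolding Ass_quot_def by blast
  qed
qed

text \<open>The splitting in T is carried over to R by \<open>power_prod_ideal_colon\<close>, so
  that \<open>Ass_quot_split\<close> applies at each node. Unit leaves have no associated
  primes.\<close>

lemma Ass_quot_power_prod_ideal:
  fixes f :: "'z::finite \<Rightarrow> 'r::comm_ring_1"
  assumes "splits \<D> U" "regular_subsets N f" "\<And>D. D \<in> \<D> \<Longrightarrow> card D \<le> N"
    and "p \<in> Ass_quot (power_prod_ideal f U)"
  shows "\<exists>D\<in>\<D>. p \<in> Ass_quot (ideal_gen (f ` D))"
  using assms(1,4)
proof induction
  case unit
  then show ?case
    by (auto simp: power_prod_ideal_UNIV Ass_quot_def prime_ideal_def)
next
  case (leaf D)
  then show ?case
    by (auto simp: power_prod_ideal_variables)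
next
  case (split U i)
  have "power_prod_ideal f {u. u + single i 1 \<in> U} = {x. f i * x \<in> power_prod_ideal f U}"
    using power_prod_ideal_colon[OF split.hyps(1) splits_regular_mod[OF split.hyps(3) assms(2,3)]]
    by auto
  moreover have "power_prod_ideal f (U \<union> up_closure {single i 1})
      = ideal_gen (insert (f i) (power_prod_ideal f U))"
    using power_prod_ideal_insert[OF split.hyps(1), of f "single i 1"] by simp
  ultimately show ?case
    using split.IH Ass_quot_split[OF is_ideal_power_prod_ideal split.prems, of "f i"] by auto
qed

definition noetherian :: "'r::comm_ring_1 itself \<Rightarrow> bool" where
  "noetherian _ \<longleftrightarrow> (\<forall>I :: 'r set. is_ideal I \<longrightarrow> (\<exists>G. finite G \<and> I = ideal_gen G))"

text \<open>A maximal element among the annihilators of the nonzero multiples of \<open>x\<close> is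
  prime, and all of these contain the annihilator of \<open>x\<close>. Zorn's lemma applies because
  the union of a chain is finitely generated and hence a member.\<close>

lemma ex_Ass_quot_above:
  fixes K :: "'r::comm_ring_1 set"
  assumes noeth: "noetherian TYPE('r)" and K: "is_ideal K" and x: "x \<notin> K"
  shows "\<exists>p\<in>Ass_quot K. {r. r * x \<in> K} \<subseteq> p"
proof -
  define ann where "ann y = {r. r * y \<in> K}" for y
  define \<A> where "\<A> = {ann (s * x) | s. s * x \<notin> K}"
  have ideal_ann: "is_ideal (ann y)" for y
    using is_ideal_colon[OF K, of y] by (simp add: ann_def mult.commute)
  have "\<exists>M\<in>\<A>. \<forall>X\<in>\<A>. M \<subseteq> X \<longrightarrow> X = M"
  proof (rule subset_Zorn_nonempty)
    have "1 * x \<notin> K" using x by simp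
    then show "\<A> \<noteq> {}"
      unfolding \<A>_def by blast
    fix \<C> assume \<C>: "\<C> \<noteq> {}" "subset.chain \<A> \<C>"
    then have chain: "X \<subseteq> Y \<or> Y \<subseteq> X" if "X \<in> \<C>" "Y \<in> \<C>" for X Y
      using that by (auto simp: subset.chain_def)
    have ideal_C: "is_ideal X" if "X \<in> \<C>" for X
      using that \<C>(2) ideal_ann by (auto simp: subset.chain_def \<A>_def)
    have "is_ideal (\<Union>\<C>)"
    proof (rule ideal.subspaceI)
      show "0 \<in> \<Union>\<C>"
        using \<C>(1) ideal.subspace_0[OF ideal_C] by blast
      show "a + b \<in> \<Union>\<C>" if ab: "a \<in> \<Union>\<C>" "b \<in> \<Union>\<C>" for a b
      proof -
        obtain X Y where "X \<in> \<C>" "Y \<in> \<C>" "a \<in> X" "b \<in> Y"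
          using ab by blast
        then obtain Z where "Z \<in> \<C>" "a \<in> Z" "b \<in> Z"
          using chain[of X Y] by blast
        then show ?thesis
          using ideal.subspace_add[OF ideal_C[of Z]] by blast
      qed
      show "c * a \<in> \<Union>\<C>" if "a \<in> \<Union>\<C>" for a c
        using that ideal.subspace_scale[OF ideal_C] by blast
    qed
    then obtain G where G: "finite G" "\<Union>\<C> = ideal_gen G"
      using noeth by (auto simp: noetherian_def)
    have "G \<subseteq> \<Union>\<C>"
      unfolding G(2) by (rule ideal.span_superset)
    then obtain X where X: "X \<in> \<C>" "G \<subseteq> X"
      using finite_subset_Union_chain[OF G(1) _ \<C>] by blast
    then have "ideal_gen G \<subseteq> X"
      by (intro ideal.span_minimal ideal_C)
    then have "\<Union>\<C> = X"
      using X(1) G(2) by blast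
    then show "\<Union>\<C> \<in> \<A>"
      using X(1) \<C>(2) by (auto simp: subset.chain_def)
  qed
  then obtain M where M: "M \<in> \<A>" "\<forall>X\<in>\<A>. M \<subseteq> X \<longrightarrow> X = M"
    by (rule bexE)
  from M(1) obtain s where s: "s * x \<notin> K" "M = ann (s * x)"
    unfolding \<A>_def by blast
  have max: "X = ann (s * x)" if "X \<in> \<A>" "ann (s * x) \<subseteq> X" for X
    using M(2) that s(2) by simp
  have "prime_ideal (ann (s * x))"
    unfolding prime_ideal_def
  proof (intro conjI allI impI)
    show "ann (s * x) \<noteq> UNIV"
    proof
      assume "ann (s * x) = UNIV"
      then have "1 \<in> ann (s * x)" by simp
      then show False using s(1) by (simp add: ann_def)
    qed
    fix a b assume ab: "a * b \<in> ann (s * x)"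
    show "a \<in> ann (s * x) \<or> b \<in> ann (s * x)"
    proof (cases "b \<in> ann (s * x)")
      case False
      then have "b * s * x \<notin> K"
        by (simp add: ann_def mult.assoc)
      then have "ann (b * s * x) \<in> \<A>"
        unfolding \<A>_def by blast
      moreover have "ann (s * x) \<subseteq> ann (b * s * x)"
        using ideal.subspace_scale[OF K] by (auto simp: ann_def mult.assoc mult.left_commute[of _ b])
      ultimately have "ann (b * s * x) = ann (s * x)"
        by (rule max)
      then show ?thesis
        using ab by (auto simp: ann_def mult.assoc)
    qed simp
  qed (rule ideal_ann)
  then have "ann (s * x) \<in> Ass_quot K"
    by (auto simp: Ass_quot_def ann_def)
  moreover have "{r. r * x \<in> K} \<subseteq> ann (s * x)"
    using ideal.subspace_scale[OF K] by (auto simp: ann_def mult.left_commute[of _ s])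
  ultimately show ?thesis by blast
qed

section \<open>Dickson's lemma and Hilbert's basis theorem\<close>

text \<open>Minimality is for divisibility, which is spelled out with \<open>+\<close> because
  \<open>\<le>\<close> on exponent vectors is the lexicographic order.\<close>

definition min_exponents :: "('z \<Rightarrow>\<^sub>0 nat) set \<Rightarrow> ('z \<Rightarrow>\<^sub>0 nat) set" where
  "min_exponents V = {u \<in> V. \<forall>v\<in>V. \<forall>w. u = v + w \<longrightarrow> w = 0}"

lemma subset_up_closure_min_exponents:
  fixes V :: "('z::finite \<Rightarrow>\<^sub>0 nat) set"
  shows "V \<subseteq> up_closure (min_exponents V)"
proof
  fix u assume "u \<in> V"
  then show "u \<in> up_closure (min_exponents V)"
  proof (induction "\<Sum>i\<in>UNIV. lookup u i" arbitrary: u rule: less_induct)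
    case less
    show ?case
    proof (cases "u \<in> min_exponents V")
      case True
      then show ?thesis using subset_up_closure by blast
    next
      case False
      then obtain v w where v: "v \<in> V" "u = v + w" "w \<noteq> 0"
        using less.prems unfolding min_exponents_def by blast
      obtain i where "lookup w i > 0"
        using v(3) by (metis gr0I lookup_zero poly_mapping_eqI)
      then have "(\<Sum>i\<in>UNIV. lookup v i) < (\<Sum>i\<in>UNIV. lookup u i)"
        unfolding v(2) by (intro sum_strict_mono_ex1) (auto simp: lookup_add)
      then have "v \<in> up_closure (min_exponents V)"
        using less.hyps v(1) by blast
      then show ?thesis
        using upset_up_closure[of "min_exponents V"] v(2) by (auto simp: upset_def)
    qed
  qed
qed

lemma ex_min_exponent:
  fixes V :: "('z::finite \<Rightarrow>\<^sub>0 nat) set"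
  assumes "u \<in> V"
  obtains v w where "v \<in> min_exponents V" "u = v + w"
  using subsetD[OF subset_up_closure_min_exponents assms] unfolding up_closure_def by blast

lemma nat_seq_mono_subseq:
  fixes s :: "nat \<Rightarrow> nat"
  shows "\<exists>r :: nat \<Rightarrow> nat. strict_mono r \<and> mono (\<lambda>n. s (r n))"
proof -
  obtain r :: "nat \<Rightarrow> nat" where r: "strict_mono r" "monoseq (\<lambda>n. s (r n))"
    using seq_monosub by blast
  show ?thesis
  proof (cases "mono (\<lambda>n. s (r n))")
    case False
    then have dec: "s (r n) \<le> s (r m)" if "m \<le> n" for m n
      using r(2) that by (auto simp: monoseq_def mono_def)
    obtain N where N: "\<And>n. s (r N) \<le> s (r n)"
      using ex_has_least_nat[of "\<lambda>_. True" _ "\<lambda>n. s (r n)"] by auto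
    have "s (r (N + n)) = s (r N)" for n
      using dec[of N "N + n"] N[of "N + n"] by simp
    then show ?thesis
      using r(1) by (intro exI[of _ "\<lambda>n. r (N + n)"]) (simp add: strict_mono_def mono_def)
  qed (use r in blast)
qed

lemma exponent_seq_mono_subseq:
  fixes u :: "nat \<Rightarrow> ('z \<Rightarrow>\<^sub>0 nat)"
  assumes "finite A"
  shows "\<exists>r :: nat \<Rightarrow> nat. strict_mono r \<and> (\<forall>i\<in>A. mono (\<lambda>n. lookup (u (r n)) i))"
  using assms
proof induction
  case empty
  show ?case by (intro exI[of _ id]) (simp add: strict_mono_def)
next
  case (insert i A)
  then obtain r :: "nat \<Rightarrow> nat" where r: "strict_mono r" "\<forall>i\<in>A. mono (\<lambda>n. lookup (u (r n)) i)"
    by blast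
  obtain r' :: "nat \<Rightarrow> nat" where r': "strict_mono r'" "mono (\<lambda>n. lookup (u (r (r' n))) i)"
    using nat_seq_mono_subseq[of "\<lambda>n. lookup (u (r n)) i"] by blast
  show ?case
  proof (intro exI[of _ "\<lambda>n. r (r' n)"] conjI ballI)
    show "strict_mono (\<lambda>n. r (r' n))"
      using r(1) r'(1) by (simp add: strict_mono_def)
    fix j assume "j \<in> insert i A"
    then consider "j = i" | "j \<in> A" by blast
    then show "mono (\<lambda>n. lookup (u (r (r' n))) j)"
    proof cases
      case 2
      then have "mono (\<lambda>n. lookup (u (r n)) j)"
        using r(2) by blast
      then show ?thesis
        using strict_mono_mono[OF r'(1)] by (auto simp: mono_def)
    qed (use r'(2) in simp)
  qed
qed

text \<open>Dickson's lemma: infinitely many minimal exponents would contain a sequence that is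
  monotone in every coordinate, and its second term would be divisible by the first.\<close>

lemma finite_min_exponents: "finite (min_exponents (V :: ('z::finite \<Rightarrow>\<^sub>0 nat) set))"
proof (rule ccontr)
  assume "\<not> ?thesis"
  then obtain u :: "nat \<Rightarrow> ('z \<Rightarrow>\<^sub>0 nat)" where u: "inj u" "range u \<subseteq> min_exponents V"
    using infinite_countable_subset by blast
  obtain r :: "nat \<Rightarrow> nat" where r: "strict_mono r" "\<forall>i\<in>UNIV. mono (\<lambda>n. lookup (u (r n)) i)"
    using exponent_seq_mono_subseq[of UNIV u] by auto
  have "lookup (u (r 0)) i \<le> lookup (u (r 1)) i" for i
    using r(2) by (auto simp: mono_def)
  then have 1: "u (r 1) = u (r 0) + (u (r 1) - u (r 0))"
    by (intro poly_mapping_eqI) (simp add: lookup_add lookup_minus)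
  have "u (r 0) \<in> V" "u (r 1) \<in> min_exponents V"
    using u(2) by (auto simp: min_exponents_def)
  then have "u (r 1) - u (r 0) = 0"
    using 1 unfolding min_exponents_def by blast
  then have "u (r 1) = u (r 0)"
    using 1 by simp
  then have "r 1 = r 0"
    using u(1) by (simp add: inj_eq)
  then show False
    using strict_mono_eq[OF r(1)] by auto
qed

section \<open>Hilbert's basis theorem by division with respect to the lexicographic order\<close>

lemma exponent_nonneg: "(0 :: 'x::linorder \<Rightarrow>\<^sub>0 nat) \<le> w"
proof -
  have "\<not> w < 0"
    by (auto simp: less_poly_mapping.rep_eq less_fun_def)
  then show ?thesis by simp
qed

text \<open>The least of the finitely many divisibility-minimal exponents is below everything else,
  because the order is compatible with addition and has 0 at the bottom.\<close>

lemma ex_least_exponent: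
  fixes V :: "('x::{finite, linorder} \<Rightarrow>\<^sub>0 nat) set"
  assumes "V \<noteq> {}"
  shows "\<exists>v\<in>V. \<forall>u\<in>V. v \<le> u"
proof -
  let ?M = "min_exponents V"
  have ne: "?M \<noteq> {}"
    using assms by (metis empty_iff ex_in_conv ex_min_exponent)
  have "Min ?M \<in> ?M"
    using finite_min_exponents ne by (rule Min_in)
  moreover have "Min ?M \<le> u" if u: "u \<in> V" for u
  proof -
    obtain v w where v: "v \<in> ?M" "u = v + w"
      using ex_min_exponent[OF u] .
    have "Min ?M \<le> v + 0"
      using Min_le[OF finite_min_exponents v(1)] by simp
    also have "\<dots> \<le> v + w"
      by (intro add_left_mono exponent_nonneg)
    finally show ?thesis using v(2) by simp
  qed
  moreover have "?M \<subseteq> V"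
    by (auto simp: min_exponents_def)
  ultimately show ?thesis
    by blast
qed

lemma lead_reduction:
  fixes p g :: "('x::{finite, linorder}, 'k::field) mpoly"
  assumes p: "p \<noteq> 0" and g: "g \<noteq> 0" and lm: "Max (keys p) = Max (keys g) + w"
  shows "\<exists>a. p - single w a * g = 0 \<or> Max (keys (p - single w a * g)) < Max (keys p)"
proof -
  define a where "a = lookup p (Max (keys p)) / lookup g (Max (keys g))"
  define q where "q = p - single w a * g"
  have lg: "lookup g (Max (keys g)) \<noteq> 0"
    using Max_in[of "keys g"] g by (auto simp: in_keys_iff)
  have zero: "lookup q (Max (keys p)) = 0"
    using lg lookup_single_mult[of w a g "Max (keys g)"]
    by (simp add: q_def lookup_minus lm a_def add.commute)
  have le: "u \<le> Max (keys p)" if "u \<in> keys q" for u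
  proof -
    have "lookup p u \<noteq> 0 \<or> lookup (single w a * g) u \<noteq> 0"
      using that by (auto simp: q_def in_keys_iff lookup_minus)
    then show ?thesis
    proof
      assume "lookup p u \<noteq> 0"
      then show ?thesis by (simp add: in_keys_iff)
    next
      assume u: "lookup (single w a * g) u \<noteq> 0"
      then obtain u' where u': "u = w + u'"
        using lookup_single_mult_0 by metis
      then have "u' \<in> keys g"
        using u by (auto simp: in_keys_iff lookup_single_mult)
      then have "u' \<le> Max (keys g)" by simp
      then show ?thesis
        using add_left_mono[of u' "Max (keys g)" w] by (simp add: lm u' add.commute)
    qed
  qed
  have "Max (keys q) < Max (keys p)" if "q \<noteq> 0"
  proof -
    have "Max (keys q) \<in> keys q"
      using that by (intro Max_in) auto
    then show ?thesis
      using le zero by (auto simp: in_keys_iff order.strict_iff_order)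
  qed
  then show ?thesis
    unfolding q_def by blast
qed

text \<open>Polynomials in \<open>I\<close> that realize the minimal leading exponents form a
  Groebner basis: a counterexample with least leading exponent could be reduced by one of
  them.\<close>

theorem noetherian_mpoly: "noetherian TYPE(('x::{finite, linorder}, 'k::field) mpoly)"
  unfolding noetherian_def
proof (intro allI impI)
  fix I :: "('x, 'k) mpoly set"
  assume I: "is_ideal I"
  define lm where "lm p = Max (keys p)" for p :: "('x, 'k) mpoly"
  define V where "V = lm ` (I - {0})"
  have "\<forall>v\<in>min_exponents V. \<exists>g. g \<in> I \<and> g \<noteq> 0 \<and> lm g = v"
    by (auto simp: min_exponents_def V_def)
  then obtain g where g: "\<And>v. v \<in> min_exponents V \<Longrightarrow> g v \<in> I \<and> g v \<noteq> 0 \<and> lm (g v) = v"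
    by metis
  let ?G = "g ` min_exponents V"
  have GI: "ideal_gen ?G \<subseteq> I"
    by (rule ideal.span_minimal) (use g I in auto)
  have "I \<subseteq> ideal_gen ?G"
  proof (rule ccontr)
    assume "\<not> I \<subseteq> ideal_gen ?G"
    then have "lm ` (I - ideal_gen ?G) \<noteq> {}"
      by auto
    then obtain p where p: "p \<in> I" "p \<notin> ideal_gen ?G"
      and least: "\<And>q. q \<in> I \<Longrightarrow> q \<notin> ideal_gen ?G \<Longrightarrow> lm p \<le> lm q"
      using ex_least_exponent[of "lm ` (I - ideal_gen ?G)"] by auto
    have p0: "p \<noteq> 0"
      using p(2) ideal.span_zero[of ?G] by auto
    then have "lm p \<in> V"
      using p(1) by (auto simp: V_def)
    then obtain v w where v: "v \<in> min_exponents V" "lm p = v + w"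
      by (rule ex_min_exponent)
    obtain a where a: "p - single w a * g v = 0 \<or> lm (p - single w a * g v) < lm p"
      using lead_reduction[OF p0, of "g v" w] g[OF v(1)] v(2) by (auto simp: lm_def)
    have gv: "single w a * g v \<in> ideal_gen ?G"
      using v(1) by (intro ideal.span_scale ideal.span_base) auto
    have "p - single w a * g v \<notin> ideal_gen ?G"
    proof
      assume "p - single w a * g v \<in> ideal_gen ?G"
      then show False
        using gv p(2) mem_cong_diff by blast
    qed
    moreover have "p - single w a * g v \<in> I"
      using GI gv by (intro ideal.subspace_diff[OF I p(1)]) blast
    ultimately have "lm p \<le> lm (p - single w a * g v)" "p - single w a * g v \<noteq> 0"
      using least ideal.span_zero[of ?G] by auto
    then show False
      using a by simp
  qed
  then show "\<exists>G. finite G \<and> I = ideal_gen G"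
    using GI finite_min_exponents by (intro exI[of _ ?G]) auto
qed

section \<open>Symbolic powers\<close>

lemma ex_between_sum:
  fixes l h :: "'i \<Rightarrow> nat"
  assumes "finite A" "\<And>i. i \<in> A \<Longrightarrow> l i \<le> h i" "sum l A \<le> t" "t \<le> sum h A"
  shows "\<exists>e. (\<forall>i\<in>A. l i \<le> e i \<and> e i \<le> h i) \<and> sum e A = t"
  using assms
proof (induction A arbitrary: t)
  case (insert i A)
  \<comment> \<open>The least value at \<open>i\<close> that leaves the rest no more than
    \<open>sum h A\<close> to absorb.\<close>
  define x where "x = max (l i) (t - sum h A)"
  have l: "sum l A \<le> sum h A"
    using insert.prems(1) by (intro sum_mono) auto
  have x: "l i \<le> x" "x \<le> h i" "sum l A \<le> t - x" "t - x \<le> sum h A" "x \<le> t"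
    using insert.prems(2,3) insert.prems(1)[of i] insert.hyps l by (auto simp: x_def max_def)
  obtain e where e: "\<forall>j\<in>A. l j \<le> e j \<and> e j \<le> h j" "sum e A = t - x"
    using insert.IH[OF insert.prems(1) x(3,4)] by auto
  have "sum (e(i := x)) A = sum e A"
    using insert.hyps by (intro sum.cong) auto
  then show ?case
    using e x insert.hyps by (intro exI[of _ "e(i := x)"]) auto
qed simp

text \<open>If c entries were positive, their sum would be at least c. So at most c - 1 entries are
  nonzero, and the c largest make up the total.\<close>

lemma bounded_sums_total:
  fixes w :: "'z::finite \<Rightarrow> nat"
  assumes c: "c > 0"
  shows "bounded_sums c (c - 1) w \<longleftrightarrow> sum w UNIV \<le> c - 1"
proof
  assume "sum w UNIV \<le> c - 1"
  moreover have "sum w A \<le> sum w UNIV" for A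
    by (rule sum_mono2) auto
  ultimately show "bounded_sums c (c - 1) w"
    unfolding bounded_sums_def using le_trans by blast
next
  assume b: "bounded_sums c (c - 1) w"
  let ?N = "{i. w i > 0}"
  have "card ?N < c"
  proof (rule ccontr)
    assume "\<not> card ?N < c"
    then obtain A where A: "A \<subseteq> ?N" "card A = c"
      using obtain_subset_with_card_n[of c ?N] by auto
    have "1 \<le> w i" if "i \<in> A" for i
      using A(1) that by (auto simp: One_nat_def Suc_le_eq)
    then have "card A * 1 \<le> sum w A"
      using sum_bounded_below[of A 1 w] by simp
    moreover have "sum w A \<le> c - 1"
      using b A(2) by (simp add: bounded_sums_def)
    ultimately show False using A(2) c by simp
  qed
  moreover have "sum w UNIV = sum w ?N"
    by (intro sum.mono_neutral_right) auto
  ultimately show "sum w UNIV \<le> c - 1"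
    using b by (simp add: bounded_sums_def)
qed

lemma threshold_total:
  fixes B :: "'z::finite \<Rightarrow> nat"
  assumes "c > 0"
  shows "threshold c (c - 1) {} B = {u. (\<Sum>i\<in>UNIV. B i - lookup u i) \<le> c - 1}"
  by (simp add: threshold_def bounded_sums_total[OF assms])

text \<open>A monomial z^u is a multiple of a generator iff the truncations min(u_i, b) have total
  at least \<open>a\<close>. Since a truncation and its deficit add up to \<open>b\<close>, this
  says that the deficits have total at most s b - a = c - 1.\<close>

lemma power_product_ideal_eq:
  fixes f :: "'z::finite \<Rightarrow> 'r::comm_ring_1"
  assumes f: "inj f" and c: "c > 0" and ab: "card (UNIV :: 'z set) * b = a + (c - 1)"
  shows "power_product_ideal a b (range f) = power_prod_ideal f (threshold c (c - 1) {} (\<lambda>_. b))"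
proof -
  define V where "V = {v :: 'z \<Rightarrow>\<^sub>0 nat. (\<forall>i. lookup v i \<le> b) \<and> (\<Sum>i\<in>UNIV. lookup v i) = a}"
  have "{(\<Prod>g\<in>range f. g ^ e g) | e. (\<forall>g\<in>range f. e g \<le> b) \<and> (\<Sum>g\<in>range f. e g) = a} = power_prod f ` V"
  proof (intro equalityI subsetI)
    fix x assume "x \<in> {(\<Prod>g\<in>range f. g ^ e g) | e. (\<forall>g\<in>range f. e g \<le> b) \<and> (\<Sum>g\<in>range f. e g) = a}"
    then obtain e where e: "x = (\<Prod>g\<in>range f. g ^ e g)" "\<forall>g\<in>range f. e g \<le> b" "(\<Sum>g\<in>range f. e g) = a"
      by blast
    obtain v where v: "lookup v = (\<lambda>i. e (f i))"
      using ex_poly_mapping_lookup by blast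
    have "x = power_prod f v"
      using f by (simp add: e(1) power_prod_def v prod.reindex)
    moreover have "v \<in> V"
      using e f by (simp add: V_def v sum.reindex)
    ultimately show "x \<in> power_prod f ` V" by blast
  next
    fix x assume "x \<in> power_prod f ` V"
    then obtain v where v: "v \<in> V" "x = power_prod f v" by blast
    let ?e = "\<lambda>g. lookup v (inv_into UNIV f g)"
    have "x = (\<Prod>g\<in>range f. g ^ ?e g)"
      using f by (simp add: v(2) power_prod_def prod.reindex)
    moreover have "(\<forall>g\<in>range f. ?e g \<le> b) \<and> (\<Sum>g\<in>range f. ?e g) = a"
      using f v(1) by (simp add: V_def sum.reindex)
    ultimately show "x \<in> {(\<Prod>g\<in>range f. g ^ e g) | e. (\<forall>g\<in>range f. e g \<le> b) \<and> (\<Sum>g\<in>range f. e g) = a}"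
      unfolding mem_Collect_eq by (intro exI[of _ ?e]) simp
  qed
  moreover have "up_closure V = threshold c (c - 1) {} (\<lambda>_. b)"
    unfolding threshold_total[OF c]
  proof (intro equalityI subsetI)
    have min: "(\<Sum>i\<in>UNIV. b - lookup u i) + (\<Sum>i\<in>UNIV. min (lookup u i) b) = a + (c - 1)" for u :: "'z \<Rightarrow>\<^sub>0 nat"
    proof -
      have "(\<Sum>i\<in>UNIV. (b - lookup u i) + min (lookup u i) b) = (\<Sum>i\<in>(UNIV :: 'z set). b)"
        by (intro sum.cong) auto
      then show ?thesis
        by (simp add: sum.distrib ab)
    qed
    fix u
    show "u \<in> {u. (\<Sum>i\<in>UNIV. b - lookup u i) \<le> c - 1}" if "u \<in> up_closure V"
    proof -
      obtain v w where v: "v \<in> V" "u = v + w"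
        using \<open>u \<in> up_closure V\<close> unfolding up_closure_def by blast
      have "(\<Sum>i\<in>UNIV. lookup v i) \<le> (\<Sum>i\<in>UNIV. min (lookup u i) b)"
        using v by (intro sum_mono) (auto simp: V_def lookup_add)
      then show ?thesis
        using min[of u] v(1) by (simp add: V_def)
    qed
    show "u \<in> up_closure V" if "u \<in> {u. (\<Sum>i\<in>UNIV. b - lookup u i) \<le> c - 1}"
    proof -
      have "a \<le> (\<Sum>i\<in>UNIV. min (lookup u i) b)"
        using min[of u] that by simp
      then obtain e where e: "\<And>i. e i \<le> min (lookup u i) b" "sum e UNIV = a"
        using ex_between_sum[of UNIV "\<lambda>_. 0" "\<lambda>i. min (lookup u i) b" a] by auto
      obtain v where v: "lookup v = e"
        using ex_poly_mapping_lookup by blast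
      have "u = v + (u - v)"
        using e(1) by (intro poly_mapping_eqI) (simp add: lookup_add lookup_minus v)
      moreover have "v \<in> V"
        using e by (simp add: V_def v)
      ultimately show ?thesis
        unfolding up_closure_def by blast
    qed
  qed
  ultimately show ?thesis
    unfolding power_product_ideal_def by (metis power_prod_ideal_up_closure)
qed

section \<open>Ordinary powers of the power product ideal\<close>

lemma power_prod_ideal_mult:
  "ideal_gen {x * y | x y. x \<in> power_prod_ideal f U \<and> y \<in> power_prod_ideal f V}
     = power_prod_ideal f {u + v | u v. u \<in> U \<and> v \<in> V}" (is "_ = ?W")
proof (rule antisym)
  have 1: "power_prod f u * y \<in> ?W" if u: "u \<in> U" and y: "y \<in> power_prod_ideal f V" for u y
  proof -
    have "power_prod_ideal f V \<subseteq> {y. power_prod f u * y \<in> ?W}"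
      unfolding power_prod_ideal_def[of f V]
    proof (intro ideal.span_minimal is_ideal_colon is_ideal_power_prod_ideal subsetI)
      fix z assume "z \<in> power_prod f ` V"
      then obtain v where v: "v \<in> V" "z = power_prod f v" by blast
      have "u + v \<in> {u + v | u v. u \<in> U \<and> v \<in> V}"
        using u v(1) by blast
      then have "power_prod f (u + v) \<in> ?W"
        by (rule power_prod_mem_ideal)
      then show "z \<in> {y. power_prod f u * y \<in> ?W}"
        by (simp add: v(2) power_prod_add)
    qed
    then show ?thesis using y by blast
  qed
  have "x * y \<in> ?W" if x: "x \<in> power_prod_ideal f U" and y: "y \<in> power_prod_ideal f V" for x y
  proof -
    have "power_prod_ideal f U \<subseteq> {x. y * x \<in> ?W}"
      unfolding power_prod_ideal_def[of f U]
      using 1[OF _ y] by (intro ideal.span_minimal is_ideal_colon) (auto simp: mult.commute)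
    then show ?thesis using x by (auto simp: mult.commute)
  qed
  then show "ideal_gen {x * y | x y. x \<in> power_prod_ideal f U \<and> y \<in> power_prod_ideal f V} \<subseteq> ?W"
    by (intro ideal.span_minimal) auto
  show "?W \<subseteq> ideal_gen {x * y | x y. x \<in> power_prod_ideal f U \<and> y \<in> power_prod_ideal f V}"
    unfolding power_prod_ideal_def[of f "{u + v | u v. u \<in> U \<and> v \<in> V}"]
  proof (rule ideal.span_mono, rule subsetI)
    fix z assume "z \<in> power_prod f ` {u + v | u v. u \<in> U \<and> v \<in> V}"
    then obtain u v where uv: "u \<in> U" "v \<in> V" "z = power_prod f u * power_prod f v"
      by (auto simp: power_prod_add)
    then show "z \<in> {x * y | x y. x \<in> power_prod_ideal f U \<and> y \<in> power_prod_ideal f V}"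
      using power_prod_mem_ideal by blast
  qed
qed

text \<open>Describes the m-th ordinary power: the total of all deficits is bounded, where
  \<open>threshold\<close> bounds the c largest.\<close>

definition budget :: "nat \<Rightarrow> nat \<Rightarrow> nat \<Rightarrow> ('z::finite \<Rightarrow>\<^sub>0 nat) set" where
  "budget b K m = {u. (\<Sum>i\<in>UNIV. m * b - lookup u i) \<le> m * K}"

text \<open>The coordinatewise part of \<open>budget_Suc\<close>: the exponent \<open>u\<close> with
  deficit \<open>w\<close> is cut into \<open>b - w'\<close> and the rest, which have deficits at
  most \<open>w'\<close> and \<open>w - w'\<close>.\<close>

lemma budget_Suc_arith:
  fixes w b m u w' :: nat
  assumes "w = Suc m * b - u" "w - m * b \<le> w'" "w' \<le> min w b"
  shows "b - w' \<le> u" "b - (b - w') \<le> w'" "m * b - (u - (b - w')) \<le> w - w'"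
  using assms by (auto simp: algebra_simps)

text \<open>
  Powers of polymatroidal ideals decompose: of a deficit vector \<open>w\<close> with \<open>w\<^sub>i \<le> (m + 1) b\<close> and total at
  most \<open>(m + 1) K\<close> one can split off \<open>w'\<close> with \<open>w'\<^sub>i \<le> b\<close> and total at most \<open>K\<close>, since the bounds that
  \<open>w'\<close> has to satisfy are met by the average \<open>w / (m + 1)\<close>.
\<close>
lemma budget_Suc:
  "{u + v | u v. u \<in> budget b K 1 \<and> v \<in> budget b K m} = (budget b K (Suc m) :: ('z::finite \<Rightarrow>\<^sub>0 nat) set)"
proof (intro equalityI subsetI)
  fix x :: "'z \<Rightarrow>\<^sub>0 nat" assume "x \<in> {u + v | u v. u \<in> budget b K 1 \<and> v \<in> budget b K m}"
  then obtain u v where uv: "x = u + v" "u \<in> budget b K 1" "v \<in> budget b K m"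
    by blast
  have "(\<Sum>i\<in>UNIV. Suc m * b - lookup x i) \<le> (\<Sum>i\<in>UNIV. (1 * b - lookup u i) + (m * b - lookup v i))"
    by (rule sum_mono) (simp add: uv(1) lookup_add)
  then show "x \<in> budget b K (Suc m)"
    using uv(2,3) by (simp add: budget_def sum.distrib)
next
  fix x :: "'z \<Rightarrow>\<^sub>0 nat" assume x: "x \<in> budget b K (Suc m)"
  define w where "w i = Suc m * b - lookup x i" for i
  define l h where "l i = w i - m * b" and "h i = min (w i) b" for i
  have w: "sum w UNIV \<le> Suc m * K"
    using x by (simp add: budget_def w_def)
  have wb: "w i \<le> Suc m * b" for i
    by (simp add: w_def)
  have "Suc m * l i \<le> w i" for i
  proof (cases "w i \<le> m * b")
    case False
    then obtain k where k: "w i = m * b + k"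
      by (metis le_add_diff_inverse nat_le_linear)
    then have "k \<le> b"
      using wb[of i] by simp
    then have "m * k \<le> m * b"
      by simp
    then show ?thesis by (simp add: l_def k)
  qed (simp add: l_def)
  then have "(\<Sum>i\<in>UNIV. Suc m * l i) \<le> sum w UNIV"
    by (rule sum_mono)
  then have "Suc m * sum l UNIV \<le> Suc m * K"
    unfolding sum_distrib_left[symmetric] using w by (rule le_trans)
  then have lK: "sum l UNIV \<le> K"
    by (simp only: Suc_mult_le_cancel1)
  have "w i \<le> Suc m * h i" for i
    using wb[of i] by (auto simp: h_def min_def)
  then have "sum w UNIV \<le> (\<Sum>i\<in>UNIV. Suc m * h i)"
    by (rule sum_mono)
  then have wh: "sum w UNIV \<le> Suc m * sum h UNIV"
    by (simp only: sum_distrib_left)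
  have lh: "l i \<le> h i" for i
    using wb[of i] by (auto simp: l_def h_def)
  \<comment> \<open>The first factor takes over as much deficit as possible: \<open>K\<close>, or
    all of \<open>h\<close> if that is less.\<close>
  have "sum l UNIV \<le> min K (sum h UNIV)"
    using lK lh by (simp add: sum_mono)
  then obtain w' where w': "\<And>i. l i \<le> w' i" "\<And>i. w' i \<le> h i" "sum w' UNIV = min K (sum h UNIV)"
    using ex_between_sum[of UNIV l h "min K (sum h UNIV)"] lh by auto
  have rest: "sum w UNIV - sum w' UNIV \<le> m * K"
  proof (cases "K \<le> sum h UNIV")
    case True
    then show ?thesis using w w'(3) by simp
  next
    case False
    have "sum h UNIV \<le> sum w UNIV"
      by (intro sum_mono) (simp add: h_def)
    then obtain k where k: "sum w UNIV = sum h UNIV + k"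
      by (metis le_add_diff_inverse)
    have "k \<le> m * sum h UNIV"
      using wh k by simp
    also have "\<dots> \<le> m * K"
      using False by simp
    finally show ?thesis
      using False w'(3) k by simp
  qed
  obtain u where u: "lookup u = (\<lambda>i. b - w' i)"
    using ex_poly_mapping_lookup by blast
  note arith = budget_Suc_arith[OF w_def w'(1)[unfolded l_def] w'(2)[unfolded h_def]]
  have xu: "x = u + (x - u)"
    using arith(1) by (intro poly_mapping_eqI) (simp add: lookup_add lookup_minus u)
  have "(\<Sum>i\<in>UNIV. 1 * b - lookup u i) \<le> sum w' UNIV"
    using arith(2) by (intro sum_mono) (simp add: u)
  then have "u \<in> budget b K 1"
    using w'(3) by (simp add: budget_def)
  moreover have "(\<Sum>i\<in>UNIV. m * b - lookup (x - u) i) \<le> (\<Sum>i\<in>UNIV. w i - w' i)"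
    using arith(3) by (intro sum_mono) (simp add: u lookup_minus)
  moreover have "(\<Sum>i\<in>UNIV. w i - w' i) = sum w UNIV - sum w' UNIV"
    using w'(2) by (intro sum_subtractf_nat) (simp add: h_def)
  ultimately show "x \<in> {u + v | u v. u \<in> budget b K 1 \<and> v \<in> budget b K m}"
    using rest xu by (fastforce simp: budget_def)
qed

lemma ideal_power_budget:
  fixes f :: "'z::finite \<Rightarrow> 'r::comm_ring_1"
  shows "ideal_power (power_prod_ideal f (budget b K 1)) m = power_prod_ideal f (budget b K m)"
proof (induction m)
  case 0
  have "budget b K 0 = (UNIV :: ('z \<Rightarrow>\<^sub>0 nat) set)"
    by (simp add: budget_def)
  then show ?case
    by (simp add: power_prod_ideal_UNIV)
next
  case (Suc m)
  then show ?case
    by (simp only: ideal_power.simps power_prod_ideal_mult budget_Suc)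
qed

text \<open>Lowering \<open>B i\<close> by one is a colon by f_i, so \<open>r\<close> is the product
  of the powers of f_i with exponents \<open>B i - B' i\<close>. Lower threshold ideals are thus
  colon ideals of higher ones and pass their associated primes on to them.\<close>

lemma power_prod_ideal_colon_threshold:
  fixes f :: "'z::finite \<Rightarrow> 'r::comm_ring_1"
  assumes reg: "regular_subsets (c + 1) f" and B: "\<And>i. B' i \<le> B i"
  shows "\<exists>r. \<forall>y. r * y \<in> power_prod_ideal f (threshold c K {} B)
                  \<longleftrightarrow> y \<in> power_prod_ideal f (threshold c K {} B')"
  using B
proof (induction "\<Sum>i\<in>UNIV. B i - B' i" arbitrary: B rule: less_induct)
  case less
  show ?case
  proof (cases "\<exists>i. B' i < B i")
    case False
    then have "B = B'"
      using less.prems by (intro ext) (meson antisym linorder_not_less)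
    then show ?thesis
      by (intro exI[of _ 1]) simp
  next
    case True
    then obtain i where i: "B' i < B i" by blast
    let ?B = "B(i := B i - 1)"
    have "(\<Sum>j\<in>UNIV. ?B j - B' j) < (\<Sum>j\<in>UNIV. B j - B' j)"
      using i by (intro sum_strict_mono_ex1) (auto intro!: bexI[of _ i])
    moreover have "B' j \<le> ?B j" for j
      using i less.prems[of j] by auto
    ultimately obtain r where r: "\<And>y. r * y \<in> power_prod_ideal f (threshold c K {} ?B)
        \<longleftrightarrow> y \<in> power_prod_ideal f (threshold c K {} B')"
      using less.hyps by blast
    \<comment> \<open>The extra variable allows index sets of \<open>c + 1\<close> elements, as many
      as \<open>reg\<close> covers.\<close>
    have "regular_mod (graph_gen f) (monomial_ideal (threshold c K {i} B))"
      by (rule splits_regular_mod[OF splits_threshold reg]) auto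
    then have reg_i: "regular_mod (graph_gen f) (monomial_ideal (threshold c K {} B \<union> up_closure {single i 1}))"
      by (simp only: threshold_insert)
    have "f i * y \<in> power_prod_ideal f (threshold c K {} B) \<longleftrightarrow> y \<in> power_prod_ideal f (threshold c K {} ?B)" for y
      using power_prod_ideal_colon[OF upset_threshold reg_i] threshold_colon[of i "{}" c K B] by simp
    then have "f i * r * y \<in> power_prod_ideal f (threshold c K {} B) \<longleftrightarrow> y \<in> power_prod_ideal f (threshold c K {} B')" for y
      using r by (simp add: mult.assoc)
    then show ?thesis by blast
  qed
qed

lemma prime_ideal_one: "prime_ideal p \<Longrightarrow> 1 \<notin> p"
  using ideal_one_eq_UNIV by (auto simp: prime_ideal_def)

lemma prime_ideal_power_prod:
  assumes p: "prime_ideal p" and f: "\<And>i. lookup v i > 0 \<Longrightarrow> f i \<notin> p"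
  shows "power_prod f v \<notin> p"
proof -
  have mult: "x * y \<notin> p" if "x \<notin> p" "y \<notin> p" for x y
    using p that by (auto simp: prime_ideal_def)
  have pow: "x ^ n \<notin> p" if "x \<notin> p" for x n
    by (induction n) (simp_all add: prime_ideal_one[OF p] mult that)
  have factor: "f i ^ lookup v i \<notin> p" for i
    using pow[OF f] prime_ideal_one[OF p] by (cases "lookup v i = 0") auto
  have "(\<Prod>i\<in>A. f i ^ lookup v i) \<notin> p" if "finite A" for A
    using that by induction (simp_all add: prime_ideal_one[OF p] mult factor)
  then show ?thesis
    by (simp add: power_prod_def)
qed

text \<open>
  An associated prime of the power product ideal contains only \<open>f\<^sub>i\<close> with \<open>i\<close> in some \<open>D\<close> of size at
  most \<open>c\<close>, and inverting the others maps the right-hand side into the ordinary power. Conversely, every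
  associated prime of the right-hand side is associated to \<open>(f\<^sub>i : i \<in> D)\<close> for such a \<open>D\<close>, and this
  ideal is a colon ideal of the power product ideal.
\<close>
theorem symbolic_power_power_product_ideal:
  fixes f :: "'z::finite \<Rightarrow> 'r::comm_ring_1"
  assumes noeth: "noetherian TYPE('r)" and reg: "regular_subsets (c + 1) f" and f: "inj f"
    and c: "c > 0" and ab: "card (UNIV :: 'z set) * b = a + (c - 1)" and m: "m > 0"
  shows "symbolic_power (power_product_ideal a b (range f)) m
           = power_prod_ideal f (threshold c (m * (c - 1)) {} (\<lambda>_. m * b))"
proof -
  let ?U = "threshold c (c - 1) {} (\<lambda>_. b) :: ('z \<Rightarrow>\<^sub>0 nat) set"
  let ?S = "threshold c (m * (c - 1)) {} (\<lambda>_. m * b) :: ('z \<Rightarrow>\<^sub>0 nat) set"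
  let ?I = "power_prod_ideal f ?U" and ?K = "power_prod_ideal f ?S"
  let ?W = "budget b (c - 1) m :: ('z \<Rightarrow>\<^sub>0 nat) set"
  have U: "?U = budget b (c - 1) 1"
    by (simp add: threshold_total[OF c] budget_def)
  have pow: "ideal_power ?I m = power_prod_ideal f ?W"
    unfolding U by (rule ideal_power_budget)
  have WS: "?W \<subseteq> ?S"
  proof
    fix u assume u: "u \<in> ?W"
    have "(\<Sum>i\<in>A. m * b - lookup u i) \<le> (\<Sum>i\<in>UNIV. m * b - lookup u i)" for A
      by (rule sum_mono2) auto
    then show "u \<in> ?S"
      using u by (auto simp: threshold_def bounded_sums_def budget_def intro: le_trans)
  qed
  have Ass: "\<exists>D. card D \<le> c \<and> \<not> bounded_sums c k (\<lambda>i. if i \<in> D then e else 0) \<and> p \<in> Ass_quot (ideal_gen (f ` D))"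
    if "p \<in> Ass_quot (power_prod_ideal f (threshold c k {} (\<lambda>_. e)))" for p k e
    using Ass_quot_power_prod_ideal[OF splits_threshold reg _ that] by auto
  have "symbolic_power ?I m = ?K"
  proof (intro equalityI subsetI)
    fix x assume x: "x \<in> ?K"
    show "x \<in> symbolic_power ?I m"
      unfolding symbolic_power_def
    proof (rule INT_I)
      fix p assume p: "p \<in> Ass_quot ?I"
      then have prime: "prime_ideal p" by (simp add: Ass_quot_def)
      obtain D where D: "card D \<le> c" "p \<in> Ass_quot (ideal_gen (f ` D))"
        using Ass[OF p] by blast
      then obtain y where y: "p = {r. r * y \<in> ideal_gen (f ` D)}"
        by (auto simp: Ass_quot_def)
      \<comment> \<open>Together with \<open>D\<close> these are at most \<open>c + 1\<close>
        indices, so f_i is regular modulo (f_j : j in D) and cannot annihilate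
        \<open>y\<close>.\<close>
      have fp: "f i \<notin> p" if "i \<notin> D" for i
      proof
        assume "f i \<in> p"
        then have "f i * y \<in> ideal_gen (f ` D)"
          by (simp add: y)
        moreover have "card (insert i D) \<le> c + 1"
          using that D(1) by simp
        ultimately have "y \<in> ideal_gen (f ` D)"
          using reg that unfolding regular_subsets_def by blast
        then show False
          using prime_ideal_one[OF prime] by (simp add: y)
      qed
      \<comment> \<open>This monomial erases all deficits outside \<open>D\<close>, and its value is
        invertible at \<open>p\<close>. What remains is a sum over the at most \<open>c\<close>
        indices of \<open>D\<close>, which the right-hand side bounds.\<close>
      obtain v :: "'z \<Rightarrow>\<^sub>0 nat" where v: "lookup v = (\<lambda>i. if i \<in> D then 0 else m * b)"
        using ex_poly_mapping_lookup by blast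
      have vp: "power_prod f v \<notin> p"
        by (rule prime_ideal_power_prod[OF prime]) (use fp in \<open>auto simp: v split: if_splits\<close>)
      have "?K \<subseteq> {x. power_prod f v * x \<in> power_prod_ideal f ?W}"
        unfolding power_prod_ideal_def[of f ?S]
      proof (rule ideal.span_minimal)
        show "power_prod f ` ?S \<subseteq> {x. power_prod f v * x \<in> power_prod_ideal f ?W}"
        proof
          fix z assume "z \<in> power_prod f ` ?S"
          then obtain u where u: "u \<in> ?S" "z = power_prod f u" by blast
          have "(\<Sum>i\<in>UNIV. m * b - lookup (v + u) i) = (\<Sum>i\<in>D. m * b - lookup u i)"
            by (rule sum.mono_neutral_cong_right) (auto simp: v lookup_add)
          also have "\<dots> \<le> m * (c - 1)"
            using u(1) D(1) by (simp add: threshold_def bounded_sums_def)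
          finally have "v + u \<in> ?W"
            by (simp add: budget_def)
          then show "z \<in> {x. power_prod f v * x \<in> power_prod_ideal f ?W}"
            using power_prod_mem_ideal by (simp add: u(2) flip: power_prod_add)
        qed
      qed (simp add: is_ideal_colon)
      then have "power_prod f v * x \<in> ideal_power ?I m"
        using x pow by blast
      then show "x \<in> local_contraction p (ideal_power ?I m)"
        unfolding local_contraction_def mem_Collect_eq
        using vp prime_ideal_one[OF prime] by (metis diff_self mult_zero_right)
    qed
  next
    fix x assume x: "x \<in> symbolic_power ?I m"
    show "x \<in> ?K"
    proof (rule ccontr)
      assume "x \<notin> ?K"
      then obtain p where p: "p \<in> Ass_quot ?K" "{r. r * x \<in> ?K} \<subseteq> p"
        using ex_Ass_quot_above[OF noeth is_ideal_power_prod_ideal] by blast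
      then have prime: "prime_ideal p" by (simp add: Ass_quot_def)
      obtain D where D: "card D \<le> c" "\<not> bounded_sums c (m * (c - 1)) (\<lambda>i. if i \<in> D then m * b else 0)"
        "p \<in> Ass_quot (ideal_gen (f ` D))"
        using Ass[OF p(1)] by blast
      then obtain y where y: "p = {r. r * y \<in> ideal_gen (f ` D)}"
        by (auto simp: Ass_quot_def)
      obtain A where A: "m * (c - 1) < (\<Sum>i\<in>A. if i \<in> D then m * b else 0)"
        using D(2) by (auto simp: bounded_sums_def not_le)
      also have "\<dots> = card (A \<inter> D) * (m * b)"
        by (simp add: sum.inter_restrict[symmetric])
      also have "\<dots> \<le> card D * (m * b)"
        by (intro mult_right_mono card_mono) auto
      finally have "m * (c - 1) < m * (card D * b)"
        by (simp add: mult_ac)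
      then have "c \<le> card D * b"
        by auto
      \<comment> \<open>The values of \<open>\<beta>\<close> are positive and have total
        \<open>c\<close>, one above the bound. Raising any single z_i with i in \<open>D\<close>
        repairs that, so the threshold ideal of \<open>\<beta>\<close> is (z_i : i in D). Such
        values exist because \<open>card D \<le> c \<le> card D * b\<close>.\<close>
      then obtain \<beta> where \<beta>: "\<And>i. i \<in> D \<Longrightarrow> 1 \<le> \<beta> i" "\<And>i. i \<in> D \<Longrightarrow> \<beta> i \<le> b" "sum \<beta> D = c"
        using ex_between_sum[of D "\<lambda>_. 1" "\<lambda>_. b" c] D(1) c by (cases "b = 0") auto
      let ?B = "\<lambda>i. if i \<in> D then \<beta> i else 0"
      have "(\<Sum>i\<in>UNIV. ?B i - lookup u i) \<le> c - 1 \<longleftrightarrow> (\<exists>i\<in>D. lookup u i > 0)" for u :: "'z \<Rightarrow>\<^sub>0 nat"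
      proof -
        have 1: "(\<Sum>i\<in>UNIV. ?B i - lookup u i) = (\<Sum>i\<in>D. \<beta> i - lookup u i)"
          by (rule sum.mono_neutral_cong_right) auto
        show ?thesis
        proof (cases "\<exists>i\<in>D. lookup u i > 0")
          case True
          then obtain i where i: "i \<in> D" "lookup u i > 0" by blast
          have "(\<Sum>i\<in>D. \<beta> i - lookup u i) < sum \<beta> D"
            using i \<beta>(1)[OF i(1)] by (intro sum_strict_mono_ex1) (auto intro!: bexI[of _ i])
          then show ?thesis
            using True 1 \<beta>(3) by auto
        next
          case False
          then have "(\<Sum>i\<in>D. \<beta> i - lookup u i) = c"
            unfolding \<beta>(3)[symmetric] by (intro sum.cong) auto
          then show ?thesis
            using False 1 c by auto
        qed
      qed
      then have "threshold c (c - 1) {} ?B = {u. \<exists>i\<in>D. lookup u i > 0}"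
        unfolding threshold_total[OF c] by blast
      moreover have "?B i \<le> b" for i
        using \<beta>(2) by simp
      then obtain r where "\<And>y. r * y \<in> ?I \<longleftrightarrow> y \<in> power_prod_ideal f (threshold c (c - 1) {} ?B)"
        using power_prod_ideal_colon_threshold[OF reg, of ?B "\<lambda>_. b" "c - 1"] by blast
      ultimately have "r * y \<in> ?I \<longleftrightarrow> y \<in> ideal_gen (f ` D)" for y
        by (simp add: power_prod_ideal_variables)
      then have "p = {q. q * (r * y) \<in> ?I}"
        by (auto simp: y mult.left_commute[of _ r])
      then have "p \<in> Ass_quot ?I"
        using prime unfolding Ass_quot_def by blast
      then have "x \<in> local_contraction p (ideal_power ?I m)"
        using x by (auto simp: symbolic_power_def)
      \<comment> \<open>So an element outside \<open>p\<close> multiplies \<open>x\<close> into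
        \<open>?K\<close>, although \<open>p\<close> was chosen to contain all elements that do
        so.\<close>
      then obtain z u w where z: "z \<in> ideal_power ?I m" "u \<notin> p" "w \<notin> p" "w * (u * x - z) = 0"
        unfolding local_contraction_def by blast
      have "w * u * x = w * z"
        using z(4) by (simp add: right_diff_distrib mult.assoc)
      also have "\<dots> \<in> ?K"
        using z(1) power_prod_ideal_mono[OF WS] unfolding pow
        by (intro ideal.subspace_scale) auto
      finally have "w * u \<in> p"
        using p(2) by blast
      then show False
        using prime z(2,3) by (auto simp: prime_ideal_def)
    qed
  qed
  then show ?thesis
    by (simp only: power_product_ideal_eq[OF f c ab])
qed

section \<open>Exactness modulo a regular sequence\<close>

text \<open>Vectors are plain functions, so that quotients and changes of ring act entrywise and
  need no carriers.\<close>

definition lin_app :: "nat \<Rightarrow> (nat \<Rightarrow> nat \<Rightarrow> 'a::comm_ring_1) \<Rightarrow> (nat \<Rightarrow> 'a) \<Rightarrow> nat \<Rightarrow> 'a" where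
  "lin_app c A v j = (\<Sum>k<c. A j k * v k)"

lemma lin_app_diff_scale: "lin_app c A (\<lambda>k. v k - a * w k) j = lin_app c A v j - a * lin_app c A w j"
  by (simp add: lin_app_def right_diff_distrib sum_subtractf sum_distrib_left mult.left_commute)

lemma lin_app_mem_ideal_gen: "(\<And>k. k < c \<Longrightarrow> v k \<in> ideal_gen G) \<Longrightarrow> lin_app c A v j \<in> ideal_gen G"
  unfolding lin_app_def by (intro ideal.span_sum ideal.span_scale) auto

lemma lin_app_lin_app:
  "lin_app c A (lin_app d B v) j = (\<Sum>l<d. lin_app c A (\<lambda>k. B k l) j * v l)"
proof -
  have "lin_app c A (lin_app d B v) j = (\<Sum>k<c. \<Sum>l<d. A j k * B k l * v l)"
    by (simp add: lin_app_def sum_distrib_left mult.assoc)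
  also have "\<dots> = (\<Sum>l<d. \<Sum>k<c. A j k * B k l * v l)"
    by (rule sum.swap)
  finally show ?thesis
    by (simp add: lin_app_def sum_distrib_right)
qed

text \<open>
  The matrix \<open>M n\<close>, of format \<open>r n \<times> r (n + 1)\<close>, maps to a free module over \<open>S / (J n + (Q))\<close>, and
  \<open>exact_mod\<close> is exactness at its source.
\<close>
definition exact_mod ::
    "'a::comm_ring_1 set \<Rightarrow> (nat \<Rightarrow> 'a set) \<Rightarrow> (nat \<Rightarrow> nat) \<Rightarrow> (nat \<Rightarrow> nat \<Rightarrow> nat \<Rightarrow> 'a) \<Rightarrow> nat \<Rightarrow> bool" where
  "exact_mod Q J r M n \<longleftrightarrow>
     (\<forall>v. (\<forall>j<r n. lin_app (r (Suc n)) (M n) v j \<in> ideal_gen (J n \<union> Q)) \<longrightarrow>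
       (\<exists>y. \<forall>k<r (Suc n). v k - lin_app (r (Suc (Suc n))) (M (Suc n)) y k \<in> ideal_gen (J (Suc n) \<union> Q)))"

lemma exact_modD:
  assumes "exact_mod Q J r M n"
    and "\<And>j. j < r n \<Longrightarrow> lin_app (r (Suc n)) (M n) v j \<in> ideal_gen (J n \<union> Q)"
  obtains y where "\<And>k. k < r (Suc n) \<Longrightarrow>
    v k - lin_app (r (Suc (Suc n))) (M (Suc n)) y k \<in> ideal_gen (J (Suc n) \<union> Q)"
  using assms unfolding exact_mod_def by blast

text \<open>A diagram chase. If A v = g_i w, then g_i P w = P A v = 0, so P w = 0 by regularity on
  the target of P. Exactness gives w = A y, then A (v - g_i y) = 0, and exactness one step further
  gives v = g_i y + B z.\<close>

lemma exact_mod_insert: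
  fixes g :: "'i \<Rightarrow> 'a::comm_ring_1"
  assumes J: "is_ideal (J n)" and reg: "regular_mod g (J n)" and i: "i \<notin> E"
    and dec: "J (Suc n) \<subseteq> J n"
    and complex: "\<And>j k. j < r n \<Longrightarrow> k < r (Suc (Suc n)) \<Longrightarrow>
      lin_app (r (Suc n)) (M n) (\<lambda>l. M (Suc n) l k) j \<in> J n"
    and ex: "exact_mod (g ` E) J r M n" "exact_mod (g ` E) J r M (Suc n)"
  shows "exact_mod (g ` insert i E) J r M (Suc n)"
  unfolding exact_mod_def
proof (intro allI impI)
  let ?P = "lin_app (r (Suc n)) (M n)" and ?A = "lin_app (r (Suc (Suc n))) (M (Suc n))"
    and ?B = "lin_app (r (Suc (Suc (Suc n)))) (M (Suc (Suc n)))"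
  let ?Q = "\<lambda>n. ideal_gen (J n \<union> g ` E)"
  fix v assume "\<forall>j<r (Suc n). ?A v j \<in> ideal_gen (J (Suc n) \<union> g ` insert i E)"
  then have "\<forall>j<r (Suc n). \<exists>w. ?A v j - g i * w \<in> ?Q (Suc n)"
    by (simp add: mem_ideal_gen_insert)
  then obtain w where w: "\<And>j. j < r (Suc n) \<Longrightarrow> ?A v j - g i * w j \<in> ?Q (Suc n)"
    by metis
  have QQ: "?Q (Suc n) \<subseteq> ?Q n"
    by (rule ideal.span_mono) (use dec in auto)
  have "?P w j \<in> ?Q n" if j: "j < r n" for j
  proof -
    have "?P (\<lambda>k. ?A v k - g i * w k) j \<in> ?Q n"
      by (rule lin_app_mem_ideal_gen) (use w QQ in blast)
    then have 1: "?P (?A v) j - g i * ?P w j \<in> ?Q n"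
      by (simp add: lin_app_diff_scale)
    have "?P (?A v) j \<in> ?Q n"
      unfolding lin_app_lin_app
      by (intro ideal.span_sum mult_mem_ideal_gen_right ideal.span_base) (use complex j in auto)
    then have "g i * ?P w j \<in> ?Q n"
      using mem_cong_diff[OF 1] by simp
    then show ?thesis
      by (rule regular_modD[OF reg i])
  qed
  then obtain y where y: "\<And>k. k < r (Suc n) \<Longrightarrow> w k - ?A y k \<in> ?Q (Suc n)"
    using exact_modD[OF ex(1)] by blast
  have "?A (\<lambda>k. v k - g i * y k) j \<in> ?Q (Suc n)" if j: "j < r (Suc n)" for j
  proof -
    have "(?A v j - g i * w j) + g i * (w j - ?A y j) \<in> ?Q (Suc n)"
      by (intro ideal.span_add ideal.span_scale w y j)
    then show ?thesis
      by (simp add: lin_app_diff_scale right_diff_distrib)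
  qed
  then obtain z where z: "\<And>k. k < r (Suc (Suc n)) \<Longrightarrow> v k - g i * y k - ?B z k \<in> ?Q (Suc (Suc n))"
    using exact_modD[OF ex(2), of "\<lambda>k. v k - g i * y k"] by blast
  have "v k - ?B z k \<in> ideal_gen (J (Suc (Suc n)) \<union> g ` insert i E)" if "k < r (Suc (Suc n))" for k
  proof -
    have "v k - ?B z k - g i * y k \<in> ?Q (Suc (Suc n))"
      using z[OF that] cancel_ab_semigroup_add_class.diff_right_commute[of "v k" "g i * y k" "?B z k"] by simp
    then show ?thesis
      unfolding image_insert Un_insert_right mem_ideal_gen_insert by blast
  qed
  then show "\<exists>y. \<forall>k<r (Suc (Suc n)). v k - ?B y k \<in> ideal_gen (J (Suc (Suc n)) \<union> g ` insert i E)"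
    by blast
qed

lemma exact_mod_regular:
  fixes g :: "'i \<Rightarrow> 'a::comm_ring_1"
  assumes J: "\<And>n. is_ideal (J n)" and reg: "\<And>n. regular_mod g (J n)" and dec: "\<And>n. J (Suc n) \<subseteq> J n"
    and complex: "\<And>n j k. j < r n \<Longrightarrow> k < r (Suc (Suc n)) \<Longrightarrow>
      lin_app (r (Suc n)) (M n) (\<lambda>l. M (Suc n) l k) j \<in> J n"
    and r0: "r 0 = 0" and ex: "\<And>n. exact_mod {} J r M n" and E: "finite E"
  shows "exact_mod (g ` E) J r M n"
  using E
proof (induction E arbitrary: n)
  case empty
  then show ?case using ex by simp
next
  case (insert i E)
  show ?case
  proof (cases n)
    case 0
    \<comment> \<open>As position 0 has rank 0, exactness here is surjectivity, which quotients
      inherit.\<close>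
    have "ideal_gen (J (Suc 0) \<union> {}) \<subseteq> ideal_gen (J (Suc 0) \<union> g ` insert i E)"
      by (rule ideal.span_mono) auto
    then show ?thesis
      using ex[of 0] unfolding 0 exact_mod_def r0 by blast
  next
    case (Suc m)
    then show ?thesis
      using exact_mod_insert[OF J reg insert.hyps(2) dec complex insert.IH insert.IH] by simp
  qed
qed

section \<open>Extension of coefficients\<close>

text \<open>S is free over T on the monomials of R, and this is the T-linear coordinate at the
  monomial with exponent \<open>\<alpha>\<close>.\<close>

definition coeff_part :: "'v \<Rightarrow> ('z, 'v \<Rightarrow>\<^sub>0 'k::comm_ring_1) mpoly \<Rightarrow> ('z, 'k) mpoly" where
  "coeff_part \<alpha> P = (\<Sum>u\<in>keys P. single u (lookup (lookup P u) \<alpha>))"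

definition coeff_ext :: "('z::finite, 'k::comm_ring_1) mpoly \<Rightarrow> ('z, ('x, 'k) mpoly) mpoly" where
  "coeff_ext = peval (\<lambda>a. Const (Const a)) Var"

lemma lookup_coeff_part: "lookup (coeff_part \<alpha> P) u = lookup (lookup P u) \<alpha>"
  by (auto simp: coeff_part_def lookup_sum lookup_single when_def in_keys_iff sum.delta)

lemma Const_0: "Const 0 = 0"
  by (simp add: Const_def)

lemma comm_ring_hom_coeff_ext:
  "comm_ring_hom (coeff_ext :: ('z::finite, 'k::comm_ring_1) mpoly \<Rightarrow> ('z, ('x, 'k) mpoly) mpoly)"
  unfolding coeff_ext_def
  by (rule comm_ring_hom_peval[OF comm_ring_hom_compose[OF comm_ring_hom_Const comm_ring_hom_Const]])

lemma coeff_ext_eq_sum: "coeff_ext p = (\<Sum>u\<in>keys p. single u (Const (lookup p u)))"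
  by (simp add: coeff_ext_def peval_def power_prod_Var flip: single_eq_Const_mult)

lemma lookup_coeff_ext: "lookup (coeff_ext p) u = Const (lookup p u)"
  by (auto simp: coeff_ext_eq_sum lookup_sum lookup_single when_def in_keys_iff sum.delta Const_def)

lemma coeff_part_add: "coeff_part \<alpha> (P + Q) = coeff_part \<alpha> P + coeff_part \<alpha> Q"
  by (rule poly_mapping_eqI) (simp add: lookup_coeff_part lookup_add)

lemma coeff_part_sum: "coeff_part \<alpha> (sum P A) = (\<Sum>k\<in>A. coeff_part \<alpha> (P k))"
  by (rule poly_mapping_eqI) (simp add: lookup_coeff_part lookup_sum)

lemma coeff_part_ext_mult:
  fixes P :: "('z::finite, ('x, 'k::comm_ring_1) mpoly) mpoly"
  shows "coeff_part \<alpha> (coeff_ext a * P) = a * coeff_part \<alpha> P"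
proof (induction a rule: poly_mapping_add_induct)
  case (single v c)
  have ext: "coeff_ext (single v c) = (single v (Const c) :: ('z, ('x, 'k) mpoly) mpoly)"
    by (rule poly_mapping_eqI) (simp add: lookup_coeff_ext lookup_single when_def Const_def)
  show ?case
  proof (rule poly_mapping_eqI)
    fix w
    show "lookup (coeff_part \<alpha> (coeff_ext (single v c) * P)) w = lookup (single v c * coeff_part \<alpha> P) w"
    proof (cases "\<exists>u. w = v + u")
      case True
      then obtain u where w: "w = v + u" by blast
      have "lookup (Const c * lookup P u) (0 + \<alpha>) = c * lookup (lookup P u) \<alpha>"
        unfolding Const_def by (rule lookup_single_mult)
      then show ?thesis
        by (simp add: ext w lookup_coeff_part lookup_single_mult)
    next
      case False
      then show ?thesis
        by (simp add: ext lookup_coeff_part lookup_single_mult_0)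
    qed
  qed
next
  case (add p q)
  interpret e: comm_ring_hom "coeff_ext :: ('z, 'k) mpoly \<Rightarrow> ('z, ('x, 'k) mpoly) mpoly"
    by (rule comm_ring_hom_coeff_ext)
  show ?case
    by (simp add: e.hom_add distrib_right coeff_part_add add)
qed

lemma sum_coeff_parts:
  fixes P :: "('z::finite, ('x, 'k::comm_ring_1) mpoly) mpoly"
  assumes "finite F" "\<And>u. keys (lookup P u) \<subseteq> F"
  shows "(\<Sum>\<alpha>\<in>F. Const (single \<alpha> 1) * coeff_ext (coeff_part \<alpha> P)) = P"
proof (rule poly_mapping_eqI)
  fix u
  have "lookup (Const (single \<alpha> 1) * coeff_ext (coeff_part \<alpha> P)) (0 + u) = single \<alpha> (lookup (lookup P u) \<alpha>)" for \<alpha>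
    unfolding Const_def[of "single \<alpha> 1"] lookup_single_mult lookup_coeff_ext lookup_coeff_part
    by (simp add: Const_def mult_single)
  then have "lookup (\<Sum>\<alpha>\<in>F. Const (single \<alpha> 1) * coeff_ext (coeff_part \<alpha> P)) u
      = (\<Sum>\<alpha>\<in>F. single \<alpha> (lookup (lookup P u) \<alpha>))"
    by (simp add: lookup_sum)
  also have "\<dots> = (\<Sum>\<alpha>\<in>keys (lookup P u). single \<alpha> (lookup (lookup P u) \<alpha>))"
    using assms by (intro sum.mono_neutral_right) (auto simp: in_keys_iff)
  finally show "lookup (\<Sum>\<alpha>\<in>F. Const (single \<alpha> 1) * coeff_ext (coeff_part \<alpha> P)) u = lookup P u"
    by (simp add: sum_single_lookup)
qed

lemma coeff_part_monomial_ideal: "P \<in> monomial_ideal U \<Longrightarrow> coeff_part \<alpha> P \<in> monomial_ideal U"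
  by (auto simp: monomial_ideal_def in_keys_iff lookup_coeff_part subset_iff) (metis lookup_zero)

lemma coeff_ext_monomial_ideal: "p \<in> monomial_ideal U \<Longrightarrow> coeff_ext p \<in> monomial_ideal U"
  by (auto simp: monomial_ideal_def in_keys_iff lookup_coeff_ext subset_iff Const_def)
    (metis single_zero)

lemma coeff_part_lin_app:
  "coeff_part \<alpha> (lin_app c (\<lambda>j k. coeff_ext (A j k)) v j) = lin_app c A (\<lambda>k. coeff_part \<alpha> (v k)) j"
  by (simp add: lin_app_def coeff_part_sum coeff_part_ext_mult)

text \<open>\<open>coeff_ext\<close> is flat: its target is free over its source, on the monomials in the inner variables.\<close>
lemma exact_mod_coeff_ext:
  fixes M :: "nat \<Rightarrow> nat \<Rightarrow> nat \<Rightarrow> ('z::finite, 'k::comm_ring_1) mpoly"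
  assumes up: "\<And>n. upset (U n)" and ex: "exact_mod {} (\<lambda>n. monomial_ideal (U n)) r M n"
  shows "exact_mod {} (\<lambda>n. monomial_ideal (U n)) r
           (\<lambda>n j k. coeff_ext (M n j k) :: ('z, ('x, 'k) mpoly) mpoly) n"
  unfolding exact_mod_def
proof (intro allI impI)
  have gen: "ideal_gen (monomial_ideal (U n) \<union> {}) = (monomial_ideal (U n) :: ('z, 'c::comm_ring_1) mpoly set)" for n
    using is_ideal_monomial_ideal[OF up] by (simp add: ideal.span_eq_iff[THEN iffD2])
  let ?e = "coeff_ext :: ('z, 'k) mpoly \<Rightarrow> ('z, ('x, 'k) mpoly) mpoly"
  interpret e: comm_ring_hom ?e by (rule comm_ring_hom_coeff_ext)
  fix v :: "nat \<Rightarrow> ('z, ('x, 'k) mpoly) mpoly"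
  assume "\<forall>j<r n. lin_app (r (Suc n)) (\<lambda>j k. ?e (M n j k)) v j \<in> ideal_gen (monomial_ideal (U n) \<union> {})"
  then have v_mem: "lin_app (r (Suc n)) (\<lambda>j k. ?e (M n j k)) v j \<in> monomial_ideal (U n)" if "j < r n" for j
    using that unfolding gen by blast
  have "lin_app (r (Suc n)) (M n) (\<lambda>k. coeff_part \<alpha> (v k)) j \<in> ideal_gen (monomial_ideal (U n) \<union> {})"
    if "j < r n" for j \<alpha>
    unfolding gen coeff_part_lin_app[symmetric]
    by (rule coeff_part_monomial_ideal[OF v_mem[OF that]])
  then have "\<forall>\<alpha>. \<exists>y. \<forall>k<r (Suc n). coeff_part \<alpha> (v k) - lin_app (r (Suc (Suc n))) (M (Suc n)) y k
      \<in> ideal_gen (monomial_ideal (U (Suc n)) \<union> {})"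
    using ex unfolding exact_mod_def by blast
  then obtain y where y: "\<And>\<alpha> k. k < r (Suc n) \<Longrightarrow>
      coeff_part \<alpha> (v k) - lin_app (r (Suc (Suc n))) (M (Suc n)) (y \<alpha>) k \<in> monomial_ideal (U (Suc n))"
    unfolding gen by metis
  \<comment> \<open>Finitely many basis monomials occur in \<open>v\<close>; along these the
    solutions \<open>y \<alpha>\<close> for the coordinates are put together.\<close>
  define F where "F = (\<Union>k<r (Suc n). \<Union>u\<in>keys (v k). keys (lookup (v k) u))"
  have F: "finite F"
    by (simp add: F_def)
  define Y where "Y l = (\<Sum>\<alpha>\<in>F. Const (single \<alpha> 1) * ?e (y \<alpha> l))" for l
  show "\<exists>y. \<forall>k<r (Suc n). v k - lin_app (r (Suc (Suc n))) (\<lambda>j k. ?e (M (Suc n) j k)) y k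
      \<in> ideal_gen (monomial_ideal (U (Suc n)) \<union> {})"
  proof (intro exI[of _ Y] allI impI)
    fix k assume k: "k < r (Suc n)"
    have keys_F: "keys (lookup (v k) u) \<subseteq> F" for u
    proof (cases "u \<in> keys (v k)")
      case True
      then show ?thesis using k unfolding F_def by blast
    next
      case False
      then show ?thesis by (simp add: in_keys_iff)
    qed
    note v = sum_coeff_parts[OF F keys_F, symmetric]
    have "lin_app (r (Suc (Suc n))) (\<lambda>j k. ?e (M (Suc n) j k)) Y k
        = (\<Sum>l<r (Suc (Suc n)). \<Sum>\<alpha>\<in>F. Const (single \<alpha> 1) * (?e (M (Suc n) k l) * ?e (y \<alpha> l)))"
      by (simp add: lin_app_def Y_def sum_distrib_left mult.left_commute)
    also have "\<dots> = (\<Sum>\<alpha>\<in>F. Const (single \<alpha> 1) * ?e (lin_app (r (Suc (Suc n))) (M (Suc n)) (y \<alpha>) k))"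
      by (subst sum.swap) (simp add: lin_app_def sum_distrib_left e.hom_sum e.hom_mult)
    finally have "v k - lin_app (r (Suc (Suc n))) (\<lambda>j k. ?e (M (Suc n) j k)) Y k
        = (\<Sum>\<alpha>\<in>F. Const (single \<alpha> 1) * ?e (coeff_part \<alpha> (v k) - lin_app (r (Suc (Suc n))) (M (Suc n)) (y \<alpha>) k))"
      by (subst v) (simp add: e.hom_minus right_diff_distrib sum_subtractf)
    also have "\<dots> \<in> monomial_ideal (U (Suc n))"
      using is_ideal_monomial_ideal[OF up] y[OF k]
      by (intro ideal.subspace_sum ideal.subspace_scale coeff_ext_monomial_ideal)
    finally show "v k - lin_app (r (Suc (Suc n))) (\<lambda>j k. ?e (M (Suc n) j k)) Y k
        \<in> ideal_gen (monomial_ideal (U (Suc n)) \<union> {})"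
      by (simp only: gen)
  qed
qed

section \<open>Base change of exact sequences\<close>

text \<open>\<open>\<phi>\<close> factors through S: exactness survives T -> S by freeness, then the
  passage to S/(g_1, ..., g_s) by regularity, and this quotient is R.\<close>

theorem base_change_exact:
  fixes M :: "nat \<Rightarrow> nat \<Rightarrow> nat \<Rightarrow> ('z::finite, 'k::comm_ring_1) mpoly"
    and f :: "'z \<Rightarrow> ('x, 'k) mpoly"
  assumes up: "\<And>n. upset (U n)" and dec: "\<And>n. U (Suc n) \<subseteq> U n"
    and reg: "\<And>n. regular_mod (graph_gen f) (monomial_ideal (U n))"
    and complex: "\<And>n j k. j < r n \<Longrightarrow> k < r (Suc (Suc n)) \<Longrightarrow>
      lin_app (r (Suc n)) (M n) (\<lambda>l. M (Suc n) l k) j \<in> monomial_ideal (U n)"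
    and r0: "r 0 = 0" and ex: "\<And>n. exact_mod {} (\<lambda>n. monomial_ideal (U n)) r M n"
    and \<phi>: "comm_ring_hom \<phi>" "\<And>a. \<phi> (Const a) = Const a" "\<And>i. \<phi> (Var i) = f i"
  shows "exact_mod {} (\<lambda>n. power_prod_ideal f (U n)) r (\<lambda>n j k. \<phi> (M n j k)) n"
  unfolding exact_mod_def
proof (intro allI impI)
  let ?e = "coeff_ext :: ('z, 'k) mpoly \<Rightarrow> ('z, ('x, 'k) mpoly) mpoly"
  let ?J = "\<lambda>n. monomial_ideal (U n) :: ('z, ('x, 'k) mpoly) mpoly set"
  let ?\<pi> = "peval (\<lambda>x. x) f"
  interpret e: comm_ring_hom ?e by (rule comm_ring_hom_coeff_ext)
  interpret C: comm_ring_hom "Const :: ('x, 'k) mpoly \<Rightarrow> ('z, ('x, 'k) mpoly) mpoly"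
    by (rule comm_ring_hom_Const)
  interpret \<pi>: comm_ring_hom ?\<pi>
    by (intro comm_ring_hom_peval comm_ring_hom_id)
  have gen: "ideal_gen (power_prod_ideal f V \<union> {}) = power_prod_ideal f V" for V
    by (simp add: power_prod_ideal_def)
  have \<pi>_e: "?\<pi> (?e p) = \<phi> p" for p
  proof -
    have "?\<pi> (?e p) = peval Const f p"
      by (rule hom_eq_peval[OF comm_ring_hom_compose[OF \<pi>.comm_ring_hom_axioms e.comm_ring_hom_axioms]])
        (simp_all add: coeff_ext_def comm_ring_hom_id Const_0
          comm_ring_hom_compose[OF comm_ring_hom_Const comm_ring_hom_Const])
    also have "\<dots> = \<phi> p"
      by (rule hom_eq_peval[symmetric]) (use \<phi> in auto)
    finally show ?thesis .
  qed
  \<comment> \<open>Modulo the graph generators the two images of \<open>p\<close> in S agree, so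
    either matrix may be used there.\<close>
  have e_\<phi>: "?e p - Const (\<phi> p) \<in> ideal_gen (range (graph_gen f))" for p
  proof -
    have 1: "Const (\<phi> p) = peval (\<lambda>a. Const (Const a)) (\<lambda>i. Const (f i)) p"
      by (rule hom_eq_peval[OF comm_ring_hom_compose[OF comm_ring_hom_Const \<phi>(1)]])
        (simp_all add: \<phi>)
    show ?thesis
      unfolding coeff_ext_def 1
      by (rule peval_diff_mem_ideal_gen) (auto intro!: ideal.span_base simp flip: graph_gen_def)
  qed
  have "exact_mod (range (graph_gen f)) ?J r (\<lambda>n j k. ?e (M n j k)) n"
  proof (rule exact_mod_regular)
    show "lin_app (r (Suc n)) (\<lambda>j k. ?e (M n j k)) (\<lambda>l. ?e (M (Suc n) l k)) j \<in> ?J n"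
      if "j < r n" "k < r (Suc (Suc n))" for n j k
    proof -
      have "lin_app (r (Suc n)) (\<lambda>j k. ?e (M n j k)) (\<lambda>l. ?e (M (Suc n) l k)) j
          = ?e (lin_app (r (Suc n)) (M n) (\<lambda>l. M (Suc n) l k) j)"
        by (simp add: lin_app_def e.hom_sum e.hom_mult)
      then show ?thesis
        using complex[OF that] by (simp add: coeff_ext_monomial_ideal)
    qed
    show "?J (Suc n) \<subseteq> ?J n" for n
      using dec[of n] by (auto simp: monomial_ideal_def)
    show "exact_mod {} ?J r (\<lambda>n j k. ?e (M n j k)) n" for n
      by (rule exact_mod_coeff_ext[OF up ex])
  qed (simp_all add: is_ideal_monomial_ideal up reg r0)
  moreover fix v :: "nat \<Rightarrow> ('x, 'k) mpoly"
  assume v: "\<forall>j<r n. lin_app (r (Suc n)) (\<lambda>j k. \<phi> (M n j k)) v j \<in> ideal_gen (power_prod_ideal f (U n) \<union> {})"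
  \<comment> \<open>A cycle over R is lifted to S by constants; the solution found in S is sent back
    by \<open>?\<pi>\<close>.\<close>
  have "lin_app (r (Suc n)) (\<lambda>j k. ?e (M n j k)) (\<lambda>k. Const (v k)) j \<in> ideal_gen (?J n \<union> range (graph_gen f))"
    if j: "j < r n" for j
  proof -
    have "lin_app (r (Suc n)) (\<lambda>j k. ?e (M n j k)) (\<lambda>k. Const (v k)) j
          - Const (lin_app (r (Suc n)) (\<lambda>j k. \<phi> (M n j k)) v j)
        = (\<Sum>k<r (Suc n). (?e (M n j k) - Const (\<phi> (M n j k))) * Const (v k))"
      by (simp add: lin_app_def C.hom_sum C.hom_mult left_diff_distrib sum_subtractf)
    also have "\<dots> \<in> ideal_gen (range (graph_gen f))"
      by (intro ideal.span_sum mult_mem_ideal_gen_right e_\<phi>)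
    also have "\<dots> \<subseteq> ideal_gen (?J n \<union> range (graph_gen f))"
      by (rule ideal.span_mono) simp
    finally show ?thesis
      using v j unfolding gen mem_power_prod_ideal_iff using mem_cong_diff by blast
  qed
  ultimately obtain y where y: "\<And>k. k < r (Suc n) \<Longrightarrow>
      Const (v k) - lin_app (r (Suc (Suc n))) (\<lambda>j k. ?e (M (Suc n) j k)) y k
        \<in> ideal_gen (?J (Suc n) \<union> range (graph_gen f))"
    using exact_modD by blast
  have "v k - lin_app (r (Suc (Suc n))) (\<lambda>j k. \<phi> (M (Suc n) j k)) (\<lambda>l. ?\<pi> (y l)) k
      \<in> power_prod_ideal f (U (Suc n))" if k: "k < r (Suc n)" for k
  proof -
    have "?\<pi> (Const (v k) - lin_app (r (Suc (Suc n))) (\<lambda>j k. ?e (M (Suc n) j k)) y k)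
        \<in> power_prod_ideal f (U (Suc n))"
      by (rule peval_mem_power_prod_ideal[OF y[OF k]])
    then show ?thesis
      by (simp add: \<pi>.hom_minus lin_app_def \<pi>.hom_sum \<pi>.hom_mult \<pi>_e)
  qed
  then show "\<exists>y. \<forall>k<r (Suc n). v k - lin_app (r (Suc (Suc n))) (\<lambda>j k. \<phi> (M (Suc n) j k)) y k
      \<in> ideal_gen (power_prod_ideal f (U (Suc n)) \<union> {})"
    unfolding gen by blast
qed

section \<open>Resolutions as exact sequences\<close>

text \<open>
  The augmented resolution \<open>\<dots> \<rightarrow> F\<^sub>0 \<rightarrow> P / J \<rightarrow> 0\<close> as a single sequence: position \<open>0\<close> is the zero module,
  position \<open>1\<close> is \<open>P / J\<close> and position \<open>i + 2\<close> is \<open>F\<^sub>i\<close>.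
\<close>
definition res_ideal :: "'a::comm_ring_1 set \<Rightarrow> nat \<Rightarrow> 'a set" where
  "res_ideal J n = (case n of 0 \<Rightarrow> UNIV | Suc n \<Rightarrow> (case n of 0 \<Rightarrow> J | Suc n \<Rightarrow> {0}))"

definition res_rank :: "'a free_complex \<Rightarrow> nat \<Rightarrow> nat" where
  "res_rank C n = (case n of 0 \<Rightarrow> 0 | Suc n \<Rightarrow> (case n of 0 \<Rightarrow> 1 | Suc n \<Rightarrow> frank C n))"

definition res_mat :: "'a::zero free_complex \<Rightarrow> nat \<Rightarrow> nat \<Rightarrow> nat \<Rightarrow> 'a" where
  "res_mat C n j k =
     (case n of 0 \<Rightarrow> 0 | Suc n \<Rightarrow> (case n of 0 \<Rightarrow> faug C $ k | Suc n \<Rightarrow> fdiff C n $$ (j, k)))"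

lemma res_simps [simp]:
  "res_ideal J 0 = UNIV" "res_ideal J (Suc 0) = J" "res_ideal J (Suc (Suc n)) = {0}"
  "res_rank C 0 = 0" "res_rank C (Suc 0) = 1" "res_rank C (Suc (Suc n)) = frank C n"
  "res_mat C (Suc 0) = (\<lambda>j k. faug C $ k)" "res_mat C (Suc (Suc n)) = (\<lambda>j k. fdiff C n $$ (j, k))"
  by (auto simp: res_ideal_def res_rank_def res_mat_def fun_eq_iff)

lemma mult_mat_vec_eq_lin_app:
  assumes "A \<in> carrier_mat r c" "v \<in> carrier_vec c" "j < r"
  shows "(A *\<^sub>v v) $ j = lin_app c (\<lambda>j k. A $$ (j, k)) (\<lambda>k. v $ k) j"
  using assms by (simp add: scalar_prod_def lin_app_def atLeast0LessThan)

lemma scalar_prod_eq_lin_app: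
  assumes "a \<in> carrier_vec c" "v \<in> carrier_vec c"
  shows "a \<bullet> v = lin_app c (\<lambda>j k. a $ k) (\<lambda>k. v $ k) j"
  using assms by (simp add: scalar_prod_def lin_app_def atLeast0LessThan)

text \<open>The inclusion from left to right is exactness; the other one is the complex property,
  tested on the columns of \<open>B\<close>. The ideal \<open>J\<close> admits the augmentation,
  with target P/J, along with the differentials, where it is \<open>{0}\<close>.\<close>

lemma mat_image_eq_iff:
  fixes A B :: "'a::comm_ring_1 mat"
  assumes A: "A \<in> carrier_mat r c" and B: "B \<in> carrier_mat c l" and J: "is_ideal J"
  shows "{v \<in> carrier_vec c. \<forall>j<r. (A *\<^sub>v v) $ j \<in> J} = mat_image B \<longleftrightarrow>
    (\<forall>v. (\<forall>j<r. lin_app c (\<lambda>j k. A $$ (j, k)) v j \<in> J) \<longrightarrow>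
       (\<exists>y. \<forall>k<c. v k = lin_app l (\<lambda>j k. B $$ (j, k)) y k)) \<and>
    (\<forall>j<r. \<forall>k<l. lin_app c (\<lambda>j k. A $$ (j, k)) (\<lambda>i. B $$ (i, k)) j \<in> J)"
    (is "?K = _ \<longleftrightarrow> ?ex \<and> ?cx")
proof -
  let ?A = "\<lambda>j k. A $$ (j, k)" and ?B = "\<lambda>j k. B $$ (j, k)"
  have app: "lin_app c ?A v j = (A *\<^sub>v vec c v) $ j" if "j < r" for v j
    using mult_mat_vec_eq_lin_app[OF A _ that, of "vec c v"] by (simp add: lin_app_def)
  have "?ex \<longleftrightarrow> ?K \<subseteq> mat_image B"
  proof
    assume ex: ?ex
    show "?K \<subseteq> mat_image B"
    proof
      fix v assume v: "v \<in> ?K"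
      have "lin_app c ?A (\<lambda>k. v $ k) j \<in> J" if "j < r" for j
      proof -
        have "(A *\<^sub>v v) $ j \<in> J"
          using v that by blast
        then show ?thesis
          using v mult_mat_vec_eq_lin_app[OF A _ that, of v] by simp
      qed
      then obtain y where y: "\<forall>k<c. v $ k = lin_app l ?B y k"
        using ex by blast
      have "v = B *\<^sub>v vec l y"
      proof (rule eq_vecI)
        show "dim_vec v = dim_vec (B *\<^sub>v vec l y)"
          using v B by simp
        fix k assume "k < dim_vec (B *\<^sub>v vec l y)"
        then have k: "k < c" using B by simp
        show "v $ k = (B *\<^sub>v vec l y) $ k"
          using y k mult_mat_vec_eq_lin_app[OF B _ k, of "vec l y"] by (simp add: lin_app_def)
      qed
      then show "v \<in> mat_image B"
        using B by (auto simp: mat_image_def)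
    qed
  next
    assume sub: "?K \<subseteq> mat_image B"
    show ?ex
    proof (intro allI impI)
      fix v assume "\<forall>j<r. lin_app c ?A v j \<in> J"
      then have "vec c v \<in> ?K"
        by (simp add: app)
      then have "vec c v \<in> mat_image B"
        using sub by blast
      then obtain w where w: "w \<in> carrier_vec l" "vec c v = B *\<^sub>v w"
        using B by (auto simp: mat_image_def)
      have "v k = lin_app l ?B (\<lambda>k. w $ k) k" if "k < c" for k
        using mult_mat_vec_eq_lin_app[OF B w(1) that] that by (simp flip: w(2))
      then show "\<exists>y. \<forall>k<c. v k = lin_app l ?B y k"
        by blast
    qed
  qed
  moreover have "?cx \<longleftrightarrow> mat_image B \<subseteq> ?K"
  proof
    assume cx: ?cx
    show "mat_image B \<subseteq> ?K"
    proof
      fix v assume "v \<in> mat_image B"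
      then obtain w where w: "w \<in> carrier_vec l" "v = B *\<^sub>v w"
        using B by (auto simp: mat_image_def)
      have v: "v \<in> carrier_vec c"
        using B w by simp
      have "(A *\<^sub>v v) $ j \<in> J" if j: "j < r" for j
      proof -
        have "(A *\<^sub>v v) $ j = lin_app c ?A (lin_app l ?B (\<lambda>k. w $ k)) j"
          unfolding mult_mat_vec_eq_lin_app[OF A v j] lin_app_def[of c]
          using mult_mat_vec_eq_lin_app[OF B w(1)] by (intro sum.cong) (simp_all add: w(2))
        also have "\<dots> = (\<Sum>k<l. w $ k * lin_app c ?A (\<lambda>i. B $$ (i, k)) j)"
          by (simp add: lin_app_lin_app mult.commute)
        also have "\<dots> \<in> J"
          using cx j J by (intro ideal.subspace_sum ideal.subspace_scale) auto
        finally show ?thesis .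
      qed
      then show "v \<in> ?K"
        using v by simp
    qed
  next
    assume sub: "mat_image B \<subseteq> ?K"
    show ?cx
    proof (intro allI impI)
      fix j k assume jk: "j < r" "k < l"
      have col: "B *\<^sub>v unit_vec l k = vec c (\<lambda>i. B $$ (i, k))"
        using B jk(2) by (intro eq_vecI) auto
      have "B *\<^sub>v unit_vec l k \<in> mat_image B"
        using B by (auto simp: mat_image_def)
      then show "lin_app c ?A (\<lambda>i. B $$ (i, k)) j \<in> J"
        unfolding app[OF jk(1)] col using sub jk(1) by blast
    qed
  qed
  ultimately show ?thesis by blast
qed

definition res_exact :: "'a::comm_ring_1 free_complex \<Rightarrow> 'a set \<Rightarrow> nat \<Rightarrow> bool" where
  "res_exact C J n \<longleftrightarrow> exact_mod {} (res_ideal J) (res_rank C) (res_mat C) n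
     \<and> (\<forall>j<res_rank C n. \<forall>k<res_rank C (Suc (Suc n)).
         lin_app (res_rank C (Suc n)) (res_mat C n) (\<lambda>l. res_mat C (Suc n) l k) j \<in> res_ideal J n)"

lemma resolves_quotient_iff:
  fixes C :: "'a::comm_ring_1 free_complex"
  assumes J: "is_ideal J" and aug: "faug C \<in> carrier_vec (frank C 0)"
    and diff: "\<And>i. fdiff C i \<in> carrier_mat (frank C i) (frank C (Suc i))"
  shows "resolves_quotient C J \<longleftrightarrow> (\<forall>n. res_exact C J n)"
proof -
  have gJ: "ideal_gen J = J"
    using J by simp
  have g0: "ideal_gen {0} = {0 :: 'a}"
    by simp
  have 0: "(\<forall>y. \<exists>v\<in>carrier_vec (frank C 0). y - faug C \<bullet> v \<in> J) \<longleftrightarrow> res_exact C J 0"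
  proof -
    have "res_exact C J 0 \<longleftrightarrow> (\<forall>v :: nat \<Rightarrow> 'a. \<exists>y. v 0 - lin_app (frank C 0) (\<lambda>j k. faug C $ k) y 0 \<in> J)"
      by (simp add: res_exact_def exact_mod_def gJ res_mat_def One_nat_def lin_app_def)
    also have "\<dots> \<longleftrightarrow> (\<forall>y. \<exists>v\<in>carrier_vec (frank C 0). y - faug C \<bullet> v \<in> J)"
    proof (intro iffI allI)
      fix y assume "\<forall>v :: nat \<Rightarrow> 'a. \<exists>y. v 0 - lin_app (frank C 0) (\<lambda>j k. faug C $ k) y 0 \<in> J"
      then obtain w where "y - lin_app (frank C 0) (\<lambda>j k. faug C $ k) w 0 \<in> J"
        by (auto dest: spec[of _ "\<lambda>_. y"])
      then show "\<exists>v\<in>carrier_vec (frank C 0). y - faug C \<bullet> v \<in> J"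
        using scalar_prod_eq_lin_app[OF aug, of "vec (frank C 0) w" 0]
        by (intro bexI[of _ "vec (frank C 0) w"]) (simp_all add: lin_app_def)
    next
      fix v :: "nat \<Rightarrow> 'a" assume "\<forall>y. \<exists>v\<in>carrier_vec (frank C 0). y - faug C \<bullet> v \<in> J"
      then obtain w where "w \<in> carrier_vec (frank C 0)" "v 0 - faug C \<bullet> w \<in> J"
        by blast
      then show "\<exists>y. v 0 - lin_app (frank C 0) (\<lambda>j k. faug C $ k) y 0 \<in> J"
        using scalar_prod_eq_lin_app[OF aug, of w 0] by auto
    qed
    finally show ?thesis by simp
  qed
  have 1: "{v \<in> carrier_vec (frank C 0). faug C \<bullet> v \<in> J} = mat_image (fdiff C 0) \<longleftrightarrow> res_exact C J (Suc 0)"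
  proof -
    \<comment> \<open>The augmentation as a one-row matrix.\<close>
    let ?A = "mat 1 (frank C 0) (\<lambda>(j, k). faug C $ k)"
    have A: "?A \<in> carrier_mat 1 (frank C 0)"
      by simp
    have "(?A *\<^sub>v v) $ 0 = faug C \<bullet> v" if "v \<in> carrier_vec (frank C 0)" for v
      using mult_mat_vec_eq_lin_app[OF A that, of 0] scalar_prod_eq_lin_app[OF aug that, of 0]
      by (simp add: lin_app_def)
    then have eq: "{v \<in> carrier_vec (frank C 0). faug C \<bullet> v \<in> J}
        = {v \<in> carrier_vec (frank C 0). \<forall>j<1. (?A *\<^sub>v v) $ j \<in> J}"
      by (auto simp: One_nat_def simp del: index_mult_mat_vec)
    show ?thesis
      unfolding eq mat_image_eq_iff[OF A diff J]
      by (simp add: res_exact_def exact_mod_def gJ g0 lin_app_def One_nat_def)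
  qed
  have 2: "mat_kernel (fdiff C i) = mat_image (fdiff C (Suc i)) \<longleftrightarrow> res_exact C J (Suc (Suc i))" for i
  proof -
    have eq: "mat_kernel (fdiff C i) = {v \<in> carrier_vec (frank C (Suc i)). \<forall>j<frank C i. (fdiff C i *\<^sub>v v) $ j \<in> {0}}"
      using diff[of i] by (auto simp: mat_kernel_def vec_eq_iff simp del: index_mult_mat_vec)
    show ?thesis
      unfolding eq mat_image_eq_iff[OF diff diff ideal.subspace_single_0]
      by (simp add: res_exact_def exact_mod_def gJ g0)
  qed
  have "(\<forall>n. res_exact C J n) \<longleftrightarrow>
      res_exact C J 0 \<and> res_exact C J (Suc 0) \<and> (\<forall>i. res_exact C J (Suc (Suc i)))"
    by (metis not0_implies_Suc)
  then show ?thesis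
    unfolding resolves_quotient_def 0 1 2 by simp
qed

section \<open>Homogeneous polynomials\<close>

lemma tdeg_add: "tdeg (u + v) = tdeg u + tdeg v"
  by (simp add: tdeg_def lookup_add sum.distrib)

lemma homogeneous_0 [simp]: "homogeneous e 0"
  by (simp add: homogeneous_def)

lemma homogeneous_Const: "homogeneous 0 (Const c)"
  by (simp add: homogeneous_def Const_def tdeg_def)

lemma homogeneous_add: "homogeneous e p \<Longrightarrow> homogeneous e q \<Longrightarrow> homogeneous e (p + q)"
  using Poly_Mapping.keys_add[of p q] by (auto simp: homogeneous_def)

lemma homogeneous_sum: "(\<And>i. i \<in> A \<Longrightarrow> homogeneous e (p i)) \<Longrightarrow> homogeneous e (sum p A)"
  by (induction A rule: infinite_finite_induct) (auto intro: homogeneous_add)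

lemma homogeneous_mult:
  "homogeneous e p \<Longrightarrow> homogeneous e' q \<Longrightarrow> homogeneous (e + e') (p * q :: ('x::finite, 'k::comm_ring_1) mpoly)"
  using keys_mult[of p q] by (fastforce simp: homogeneous_def tdeg_add)

lemma homogeneous_power_prod:
  fixes f :: "'z::finite \<Rightarrow> ('x::finite, 'k::comm_ring_1) mpoly"
  assumes f: "\<And>i. homogeneous (int d) (f i)"
  shows "homogeneous (int d * int (tdeg u)) (power_prod f u)"
proof -
  have one: "homogeneous 0 (1 :: ('x, 'k) mpoly)"
    using homogeneous_Const[of "1 :: 'k"] by (simp add: Const_def)
  have pow: "homogeneous (int d * int n) (f i ^ n)" for i n
  proof (induction n)
    case (Suc n)
    show ?case
      using homogeneous_mult[OF f[of i] Suc] by (simp add: algebra_simps)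
  qed (simp add: one)
  have "homogeneous (int d * int (\<Sum>i\<in>A. lookup u i)) (\<Prod>i\<in>A. f i ^ lookup u i)" if "finite A" for A
    using that
  proof induction
    case (insert i A)
    show ?case
      using homogeneous_mult[OF pow[of "lookup u i" i] insert.IH] insert.hyps
      by (simp add: distrib_left)
  qed (simp add: one)
  then show ?thesis
    by (simp add: power_prod_def tdeg_def)
qed

lemma homogeneous_peval_Const:
  fixes f :: "'z::finite \<Rightarrow> ('x::finite, 'k::comm_ring_1) mpoly"
  assumes f: "\<And>i. homogeneous (int d) (f i)" and p: "homogeneous e p"
  shows "homogeneous (int d * e) (peval Const f p)"
  unfolding peval_def
proof (rule homogeneous_sum)
  fix u assume "u \<in> keys p"
  then have "e = int (tdeg u)"
    using p by (simp add: homogeneous_def)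
  then show "homogeneous (int d * e) (Const (lookup p u) * power_prod f u)"
    using homogeneous_mult[OF homogeneous_Const homogeneous_power_prod[OF f]] by simp
qed

lemma form_mem_maximal_ideal:
  assumes "is_form d (p :: ('x::finite, 'k::comm_ring_1) mpoly)"
  shows "p \<in> ideal_gen (range Var)"
proof -
  have "\<exists>i. lookup t i > 0" if "t \<in> keys p" for t
  proof (rule ccontr)
    assume "\<not> ?thesis"
    then have "tdeg t = 0" by (simp add: tdeg_def)
    then show False
      using assms that by (simp add: is_form_def homogeneous_def)
  qed
  then show ?thesis
    unfolding ideal_gen_variables by (auto simp: monomial_ideal_def)
qed

lemma one_not_mem_maximal_ideal: "(1 :: ('x, 'k::comm_ring_1) mpoly) \<notin> ideal_gen (range Var)"
  unfolding ideal_gen_variables by (simp add: monomial_ideal_def)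

section \<open>Base change along forms\<close>

text \<open>Enumerate \<open>D\<close> first and put \<open>i\<close> last; the claim is regularity
  at the last place of this list.\<close>

lemma regular_subsets_generic:
  assumes f: "inj f" and gen: "generic c (range f)"
  shows "regular_subsets (c + 1) f"
  unfolding regular_subsets_def
proof (intro allI impI)
  fix D i r
  assume i: "i \<notin> D" and card: "card (insert i D) \<le> c + 1" and r: "f i * r \<in> ideal_gen (f ` D)"
  obtain ds where ds: "set ds = D" "distinct ds"
    using finite_distinct_list[of D] by auto
  let ?fs = "map f (ds @ [i])"
  have "distinct ?fs"
    using i ds f by (auto simp: distinct_map inj_on_def inj_def)
  moreover have "length ?fs \<le> c + 1"
    using card i ds distinct_card[OF ds(2)] by simp
  moreover have "set ?fs \<subseteq> range f"
    by auto
  ultimately have "regular_sequence ?fs"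
    using gen unfolding generic_def by blast
  then have "?fs ! length ds * r \<in> ideal_gen (set (take (length ds) ?fs))
      \<longrightarrow> r \<in> ideal_gen (set (take (length ds) ?fs))"
    unfolding regular_sequence_def by (metis length_append_singleton length_map lessI)
  then show "r \<in> ideal_gen (f ` D)"
    using r ds(1) by (simp add: nth_append)
qed

text \<open>Multiplying by z_i does not affect whether a variable from \<open>D\<close> occurs,
  whatever the size of \<open>D\<close>. This lets the results on R apply to T.\<close>

lemma regular_subsets_Var: "regular_subsets N (Var :: 'z::finite \<Rightarrow> ('z, 'k::comm_ring_1) mpoly)"
  unfolding regular_subsets_def ideal_gen_variables
proof (intro allI impI)
  fix D :: "'z set" and i r
  let ?U = "{u. \<exists>j\<in>D. lookup u j > 0}"
  assume i: "i \<notin> D" and r: "Var i * r \<in> monomial_ideal ?U"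
  have U: "{u. u + single i 1 \<in> ?U} = ?U"
    using i by (auto simp: lookup_add lookup_single when_def)
  have "r \<in> {x. single (single i 1) 1 * x \<in> monomial_ideal ?U}"
    using r by (simp add: Var_def)
  then show "r \<in> monomial_ideal ?U"
    unfolding monomial_ideal_colon U .
qed

lemma power_prod_ideal_Var:
  "upset U \<Longrightarrow> power_prod_ideal Var U = (monomial_ideal U :: ('z::finite, 'k::comm_ring_1) mpoly set)"
  unfolding power_prod_ideal_def by (simp add: monomial_ideal_eq_gen power_prod_Var image_def)

lemma hom_mem_power_prod_ideal:
  fixes f :: "'z::finite \<Rightarrow> ('x, 'k::comm_ring_1) mpoly"
  assumes \<phi>: "comm_ring_hom \<phi>" "\<And>a. \<phi> (Const a) = Const a" "\<And>i. \<phi> (Var i) = f i"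
    and p: "p \<in> monomial_ideal U"
  shows "\<phi> p \<in> power_prod_ideal f U"
proof -
  have "\<phi> p = peval Const f p"
    by (rule hom_eq_peval) (use \<phi> in auto)
  also have "\<dots> \<in> power_prod_ideal f U"
    unfolding peval_def power_prod_ideal_def
    using p by (intro ideal.span_sum ideal.span_scale ideal.span_base) (auto simp: monomial_ideal_def)
  finally show ?thesis .
qed

text \<open>Every generating set of monomials contains the divisibility-minimal ones, which already
  generate; this is the uniqueness that \<open>THE\<close> relies on.\<close>

lemma minimal_monomial_gens_monomial_ideal:
  fixes U :: "('z::finite \<Rightarrow>\<^sub>0 nat) set"
  assumes U: "upset U"
  shows "minimal_monomial_gens (monomial_ideal U :: ('z, 'k::comm_ring_1) mpoly set)
    = (\<lambda>u. single u 1) ` min_exponents U"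
proof -
  let ?m = "\<lambda>u. single u (1 :: 'k)"
  have upc: "up_closure V = U" if "min_exponents U \<subseteq> V" "V \<subseteq> U" for V
  proof (rule antisym)
    show "up_closure V \<subseteq> U"
      using that(2) U by (auto simp: up_closure_def upset_def)
    have "up_closure (min_exponents U) \<subseteq> up_closure V"
      using that(1) by (auto simp: up_closure_def)
    then show "U \<subseteq> up_closure V"
      using subset_up_closure_min_exponents by blast
  qed
  have MU: "min_exponents U \<subseteq> U"
    by (auto simp: min_exponents_def)
  have inj: "V = W" if "monomial_ideal V = (monomial_ideal W :: ('z, 'k) mpoly set)" for V W :: "('z \<Rightarrow>\<^sub>0 nat) set"
  proof -
    have "u \<in> V \<longleftrightarrow> ?m u \<in> monomial_ideal V" for u and V :: "('z \<Rightarrow>\<^sub>0 nat) set"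
      by (simp add: monomial_ideal_def)
    then show ?thesis using that by blast
  qed
  have sub: "min_exponents U \<subseteq> V" if "up_closure V = U" for V
  proof
    fix u assume u: "u \<in> min_exponents U"
    then have "u \<in> up_closure V"
      using that MU by blast
    then obtain v w where v: "v \<in> V" "u = v + w"
      unfolding up_closure_def by blast
    then have "v \<in> U"
      using that subset_up_closure by blast
    then have "w = 0"
      using u v unfolding min_exponents_def by blast
    then show "u \<in> V" using v by simp
  qed
  have gen: "ideal_gen (?m ` min_exponents U) = monomial_ideal U"
    unfolding ideal_gen_monomials using upc[OF order_refl MU] by simp
  have repr: "\<exists>V. H = ?m ` V \<and> up_closure V = U"
    if H: "H \<subseteq> monomials" "ideal_gen H = monomial_ideal U" for H
  proof -
    obtain V where V: "H = ?m ` V"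
      using H(1) unfolding monomials_def by (metis subset_imageE)
    then have "monomial_ideal (up_closure V) = (monomial_ideal U :: ('z, 'k) mpoly set)"
      using H(2) ideal_gen_monomials by metis
    then show ?thesis
      using V inj by blast
  qed
  have min: "minimal_generating_set (?m ` min_exponents U) (monomial_ideal U)"
    unfolding minimal_generating_set_def
  proof (intro conjI allI impI notI gen)
    fix H assume H: "H \<subset> ?m ` min_exponents U" "ideal_gen H = monomial_ideal U"
    then have "H \<subseteq> monomials"
      by (auto simp: monomials_def)
    then obtain V where V: "H = ?m ` V" "up_closure V = U"
      using repr H(2) by blast
    then have "?m ` min_exponents U \<subseteq> H"
      using sub by blast
    then show False using H(1) by blast
  qed
  show ?thesis
    unfolding minimal_monomial_gens_def
  proof (rule the_equality)
    show "?m ` min_exponents U \<subseteq> monomials \<and> minimal_generating_set (?m ` min_exponents U) (monomial_ideal U)"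
      using min by (auto simp: monomials_def)
    fix G :: "('z, 'k) mpoly set"
    assume "G \<subseteq> monomials \<and> minimal_generating_set G (monomial_ideal U)"
    then have G: "G \<subseteq> monomials" "ideal_gen G = monomial_ideal U"
      and min_G: "\<And>H. H \<subset> G \<Longrightarrow> ideal_gen H \<noteq> monomial_ideal U"
      by (simp_all add: minimal_generating_set_def)
    from repr[OF G] obtain V where V: "G = ?m ` V" "up_closure V = U"
      by blast
    have "?m ` min_exponents U \<subseteq> G"
      unfolding V(1) by (intro image_mono sub V(2))
    then show "G = ?m ` min_exponents U"
      using gen min_G[of "?m ` min_exponents U"] by blast
  qed
qed

text \<open>If f^u were redundant, its colon into the ideal of the other generators would contain 1.
  But this colon is extended from T, where u being minimal keeps it inside the ideal of all z_i, so
  in R it lies in (f_1, ..., f_s), a part of the maximal ideal.\<close>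

lemma minimal_generating_set_power_prod:
  fixes f :: "'z::finite \<Rightarrow> ('x::finite, 'k::comm_ring_1) mpoly"
  assumes U: "upset U" and reg: "regular_mod (graph_gen f) (monomial_ideal U)"
    and f: "\<And>i. f i \<in> ideal_gen (range Var)"
  shows "minimal_generating_set (power_prod f ` min_exponents U) (power_prod_ideal f U)"
  unfolding minimal_generating_set_def
proof (intro conjI allI impI notI)
  let ?M = "min_exponents U"
  have MU: "?M \<subseteq> U"
    by (auto simp: min_exponents_def)
  have upc: "up_closure ?M = U"
    using subset_up_closure_min_exponents[of U] MU U by (auto simp: up_closure_def upset_def)
  show gen: "ideal_gen (power_prod f ` ?M) = power_prod_ideal f U"
    using power_prod_ideal_up_closure[of f ?M] by (simp add: upc)
  fix H assume H: "H \<subset> power_prod f ` ?M" "ideal_gen H = power_prod_ideal f U"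
  then obtain u where u: "u \<in> ?M" "power_prod f u \<notin> H"
    by blast
  let ?V = "up_closure (?M - {u})"
  have "H \<subseteq> power_prod f ` (?M - {u})"
    using H(1) u(2) by blast
  then have "ideal_gen H \<subseteq> power_prod_ideal f ?V"
    unfolding power_prod_ideal_up_closure by (rule ideal.span_mono)
  moreover have "power_prod f u \<in> power_prod_ideal f U"
    using u(1) MU by (intro power_prod_mem_ideal) auto
  ultimately have "power_prod f u * 1 \<in> power_prod_ideal f ?V"
    using H(2) by auto
  \<comment> \<open>Hence the regularity that the colon by f^u requires is exactly
    \<open>reg\<close>.\<close>
  moreover have "?V \<union> up_closure {u} = U"
    using u(1) by (subst upc[symmetric]) (auto simp: up_closure_def)
  ultimately have one: "1 \<in> power_prod_ideal f {w. w + u \<in> ?V}"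
    using power_prod_ideal_colon[OF upset_up_closure, of f "?M - {u}" u 1] reg by simp
  have "\<exists>i\<in>UNIV. lookup w i > 0" if "w + u \<in> ?V" for w
  proof (rule ccontr)
    assume "\<not> ?thesis"
    then have "w = 0"
      by (intro poly_mapping_eqI) simp
    then have "u \<in> ?V"
      using that by simp
    then obtain v w' where v: "v \<in> ?M - {u}" "u = v + w'"
      unfolding up_closure_def by blast
    then have "w' = 0"
      using u(1) MU unfolding min_exponents_def by blast
    then show False using v by simp
  qed
  then have "power_prod_ideal f {w. w + u \<in> ?V} \<subseteq> power_prod_ideal f {w. \<exists>i\<in>UNIV. lookup w i > 0}"
    by (intro power_prod_ideal_mono) blast
  also have "\<dots> \<subseteq> ideal_gen (range Var)"
    unfolding power_prod_ideal_variables by (rule ideal.span_minimal) (use f in auto)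
  finally show False
    using one one_not_mem_maximal_ideal by blast
qed

section \<open>Transport of graded minimal free resolutions along the forms\<close>

lemma base_change_resolves_quotient:
  fixes f :: "'z::finite \<Rightarrow> ('x, 'k::comm_ring_1) mpoly"
  assumes U: "upset U" and reg: "regular_mod (graph_gen f) (monomial_ideal U)"
    and reg0: "regular_mod (graph_gen f) (monomial_ideal {})"
    and \<phi>: "comm_ring_hom \<phi>" "\<And>a. \<phi> (Const a) = Const a" "\<And>i. \<phi> (Var i) = f i"
    and aug: "faug C \<in> carrier_vec (frank C 0)"
    and diff: "\<And>i. fdiff C i \<in> carrier_mat (frank C i) (frank C (Suc i))"
    and res: "resolves_quotient C (monomial_ideal U)"
  shows "resolves_quotient (base_change \<phi> d C) (power_prod_ideal f U)"
proof -
  interpret \<phi>: comm_ring_hom \<phi> by (rule \<phi>)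
  let ?C = "base_change \<phi> d C"
  \<comment> \<open>The exponent sets behind \<open>res_ideal\<close>: the unit ideal, the resolved
    ideal, and the zero ideal for the free modules.\<close>
  let ?U = "\<lambda>n. (case n of 0 \<Rightarrow> UNIV | Suc n \<Rightarrow> (case n of 0 \<Rightarrow> U | Suc n \<Rightarrow> {}))"
  have mon: "res_ideal (monomial_ideal U) = (\<lambda>n. monomial_ideal (?U n))"
    by (rule ext) (auto simp: res_ideal_def monomial_ideal_def split: nat.splits)
  have pow: "res_ideal (power_prod_ideal f U) = (\<lambda>n. power_prod_ideal f (?U n))"
    by (rule ext) (auto simp: res_ideal_def power_prod_ideal_UNIV power_prod_ideal_def[of f "{}"] split: nat.splits)
  have rank: "res_rank ?C = res_rank C"
    by (rule ext) (simp add: res_rank_def base_change_def split: nat.splits)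
  \<comment> \<open>Limited to the format of the matrices, since entries outside it are unspecified
    after \<open>map_mat\<close> and \<open>map_vec\<close>.\<close>
  have mat: "res_mat ?C n j k = \<phi> (res_mat C n j k)"
    if "j < res_rank C n" "k < res_rank C (Suc n)" for n j k
    using that aug carrier_matD[OF diff] by (auto simp: res_mat_def res_rank_def base_change_def split: nat.splits)
  have app: "lin_app (res_rank C (Suc n)) (res_mat ?C n) v j = lin_app (res_rank C (Suc n)) (\<lambda>j k. \<phi> (res_mat C n j k)) v j"
    if "j < res_rank C n" for n v j
    unfolding lin_app_def using mat that by (intro sum.cong) auto
  have ex: "res_exact C (monomial_ideal U) n" for n
    using res resolves_quotient_iff[OF is_ideal_monomial_ideal[OF U] aug diff] by blast
  have ex_\<phi>: "exact_mod {} (\<lambda>n. power_prod_ideal f (?U n)) (res_rank C) (\<lambda>n j k. \<phi> (res_mat C n j k)) n" for n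
  proof (rule base_change_exact[OF _ _ _ _ _ _ \<phi>])
    show "upset (?U n)" for n
      using U by (auto simp: upset_def split: nat.splits)
    show "?U (Suc n) \<subseteq> ?U n" for n
      by (auto split: nat.splits)
    show "regular_mod (graph_gen f) (monomial_ideal (?U n))" for n
      using reg reg0 regular_mod_UNIV[of "graph_gen f"] by (auto simp: monomial_ideal_def[of UNIV] split: nat.splits)
    show "lin_app (res_rank C (Suc n)) (res_mat C n) (\<lambda>l. res_mat C (Suc n) l k) j \<in> monomial_ideal (?U n)"
      if "j < res_rank C n" "k < res_rank C (Suc (Suc n))" for n j k
      using ex[of n] that unfolding res_exact_def mon by blast
    show "exact_mod {} (\<lambda>n. monomial_ideal (?U n)) (res_rank C) (res_mat C) n" for n
      using ex[of n] unfolding res_exact_def mon by blast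
  qed simp
  have "res_exact ?C (power_prod_ideal f U) n" for n
    unfolding res_exact_def pow rank
  proof (intro conjI allI impI)
    show "exact_mod {} (\<lambda>n. power_prod_ideal f (?U n)) (res_rank C) (res_mat ?C) n"
      using ex_\<phi>[of n] unfolding exact_mod_def by (simp add: app del: res_simps)
    fix j k assume jk: "j < res_rank C n" "k < res_rank C (Suc (Suc n))"
    have "lin_app (res_rank C (Suc n)) (res_mat ?C n) (\<lambda>l. res_mat ?C (Suc n) l k) j
        = \<phi> (lin_app (res_rank C (Suc n)) (res_mat C n) (\<lambda>l. res_mat C (Suc n) l k) j)"
      unfolding lin_app_def \<phi>.hom_sum \<phi>.hom_mult using mat jk by (intro sum.cong) auto
    moreover have "lin_app (res_rank C (Suc n)) (res_mat C n) (\<lambda>l. res_mat C (Suc n) l k) j \<in> monomial_ideal (?U n)"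
      using ex[of n] jk unfolding res_exact_def mon by blast
    ultimately show "lin_app (res_rank C (Suc n)) (res_mat ?C n) (\<lambda>l. res_mat ?C (Suc n) l k) j
        \<in> power_prod_ideal f (?U n)"
      using hom_mem_power_prod_ideal[OF \<phi>] by metis
  qed
  then show ?thesis
    using resolves_quotient_iff[of "power_prod_ideal f U" ?C] aug diff by (simp add: base_change_def)
qed

lemma graded_base_change:
  fixes f :: "'z::finite \<Rightarrow> ('x::finite, 'k::comm_ring_1) mpoly"
  assumes \<phi>: "comm_ring_hom \<phi>" "\<And>a. \<phi> (Const a) = Const a" "\<And>i. \<phi> (Var i) = f i"
    and f: "\<And>i. is_form d (f i)" and C: "graded_free_sequence C"
  shows "graded_free_sequence (base_change \<phi> d C)"
proof -
  have hom: "homogeneous (int d * e) (\<phi> p)" if "homogeneous e p" for e p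
  proof -
    have "\<phi> p = peval Const f p"
      by (rule hom_eq_peval) (use \<phi> in auto)
    then show ?thesis
      using homogeneous_peval_Const[of d f e p] that f by (simp add: is_form_def)
  qed
  have aug: "faug C \<in> carrier_vec (frank C 0)" "\<And>j. j < frank C 0 \<Longrightarrow> homogeneous (fdeg C 0 j) (faug C $ j)"
    and diff: "\<And>i. fdiff C i \<in> carrier_mat (frank C i) (frank C (Suc i))"
      "\<And>i j k. j < frank C i \<Longrightarrow> k < frank C (Suc i) \<Longrightarrow>
        homogeneous (fdeg C (Suc i) k - fdeg C i j) (fdiff C i $$ (j, k))"
    using C unfolding graded_free_sequence_def by auto
  have "homogeneous (int d * fdeg C (Suc i) k - int d * fdeg C i j) (map_mat \<phi> (fdiff C i) $$ (j, k))"
    if "j < frank C i" "k < frank C (Suc i)" for i j k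
    using hom[OF diff(2)[OF that]] diff(1)[of i] that by (simp add: right_diff_distrib)
  moreover have "homogeneous (int d * fdeg C 0 j) (map_vec \<phi> (faug C) $ j)" if "j < frank C 0" for j
    using hom[OF aug(2)[OF that]] aug(1) that by simp
  ultimately show ?thesis
    using aug(1) diff(1) by (simp add: graded_free_sequence_def base_change_def)
qed

lemma minimal_base_change:
  fixes f :: "'z::finite \<Rightarrow> ('x, 'k::comm_ring_1) mpoly"
  assumes \<phi>: "comm_ring_hom \<phi>" "\<And>i. \<phi> (Var i) = f i"
    and f: "\<And>i. f i \<in> ideal_gen (range Var)"
    and diff: "\<And>i. fdiff C i \<in> carrier_mat (frank C i) (frank C (Suc i))"
    and C: "minimal_sequence C"
  shows "minimal_sequence (base_change \<phi> d C)"
proof -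
  have "v $ j \<in> ideal_gen (range Var)"
    if v: "v \<in> mat_image (map_mat \<phi> (fdiff C i))" and j: "j < frank C i" for i v j
  proof -
    obtain w where w: "w \<in> carrier_vec (frank C (Suc i))" "v = map_mat \<phi> (fdiff C i) *\<^sub>v w"
      using v diff[of i] by (auto simp: mat_image_def)
    have entry: "\<phi> (fdiff C i $$ (j, k)) \<in> ideal_gen (range Var)" if k: "k < frank C (Suc i)" for k
    proof -
      \<comment> \<open>Minimality speaks of images; unit vectors bring out the single entries,
        which \<open>\<phi>\<close> maps into the maximal ideal.\<close>
      have "fdiff C i *\<^sub>v unit_vec (frank C (Suc i)) k \<in> mat_image (fdiff C i)"
        using diff[of i] by (auto simp: mat_image_def)
      then have "(fdiff C i *\<^sub>v unit_vec (frank C (Suc i)) k) $ j \<in> ideal_gen (range Var)"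
        using C j unfolding minimal_sequence_def by blast
      then have "fdiff C i $$ (j, k) \<in> ideal_gen (range Var)"
        using diff[of i] j k by simp
      then show ?thesis
        by (rule hom_mem_ideal_gen[OF \<phi>(1), rotated]) (use \<phi>(2) f in auto)
    qed
    have "v $ j = (\<Sum>k<frank C (Suc i). \<phi> (fdiff C i $$ (j, k)) * w $ k)"
      using w diff[of i] j by (simp add: scalar_prod_def atLeast0LessThan)
    also have "\<dots> \<in> ideal_gen (range Var)"
      by (intro ideal.span_sum mult_mem_ideal_gen_right entry) simp
    finally show ?thesis .
  qed
  then show ?thesis
    by (simp add: minimal_sequence_def base_change_def)
qed

theorem proposition4p11:
  fixes a b n s \<delta> d m :: nat
    and f :: "'z::{finite, linorder} \<Rightarrow> ('x::{finite, linorder}, 'k::field) mpoly"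
    and \<phi> :: "('z, 'k) mpoly \<Rightarrow> ('x, 'k) mpoly"
    and \<F> :: "('x, 'k) mpoly set"
    and \<F>z :: "('z, 'k) mpoly set"
  assumes "infinite (UNIV :: 'k set)"
    and "card (UNIV :: 'x set) = n + 1" and "card (UNIV :: 'z set) = s"
    and "a > 0" and "b > 0" and "n > 0" and "s > 0"
    and "s \<ge> n + 1"
    and "b * (s - n) + 1 \<le> a" and "a \<le> s * b"
    and "a > (b - 1) * s + 1"
    and "\<delta> = a - (b - 1) * s - 1" and "\<delta> \<ge> s - n"
    and "inj f" and "\<F> = range f"
    and "\<forall>g\<in>\<F>. is_form d g" and "generic (s - \<delta>) \<F>"
    and "\<F>z = range Var"
    and "comm_ring_hom \<phi>" and "\<forall>c. \<phi> (Const c) = Const c" and "\<forall>i. \<phi> (Var i) = f i"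
    and "m > 0"
  shows "symbolic_power (power_product_ideal a b \<F>) m
           = ideal_gen (\<phi> ` symbolic_power (power_product_ideal a b \<F>z) m)
       \<and> (\<forall>C. graded_minimal_free_resolution C (symbolic_power (power_product_ideal a b \<F>z) m)
            \<longrightarrow> graded_minimal_free_resolution (base_change \<phi> d C)
                  (symbolic_power (power_product_ideal a b \<F>) m))
       \<and> minimal_generating_set
           (\<phi> ` minimal_monomial_gens (symbolic_power (power_product_ideal a b \<F>z) m))
           (symbolic_power (power_product_ideal a b \<F>) m)"
proof -
  define c where "c = s - \<delta>"
  define U :: "('z \<Rightarrow>\<^sub>0 nat) set" where "U = threshold c (m * (c - 1)) {} (\<lambda>_. m * b)"
  \<comment> \<open>With a = (b - 1) s + 1 + \<open>\<delta>\<close> this gives s b - a = s -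
    \<open>\<delta>\<close> - 1 = c - 1, and \<open>a \<le> s * b\<close> makes \<open>c\<close>
    positive.\<close>
  have "s * b = (b - 1) * s + s"
    using \<open>b > 0\<close> by (cases b) (simp_all add: mult.commute)
  then have c: "c > 0" and ab: "card (UNIV :: 'z set) * b = a + (c - 1)"
    using assms(3,10-12) by (simp_all add: c_def)
  have \<phi>: "comm_ring_hom \<phi>" "\<And>a. \<phi> (Const a) = Const a" "\<And>i. \<phi> (Var i) = f i"
    using assms(19-21) by auto
  have form: "is_form d (f i)" for i
    using assms(15,16) by blast
  have f_max: "f i \<in> ideal_gen (range Var)" for i
    by (rule form_mem_maximal_ideal[OF form])
  have reg: "regular_subsets (c + 1) f"
    using assms(14,15,17) by (intro regular_subsets_generic) (simp_all add: c_def)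
  have inj_Var: "inj (Var :: 'z \<Rightarrow> ('z, 'k) mpoly)"
  proof (rule injI)
    fix i j assume "Var i = (Var j :: ('z, 'k) mpoly)"
    then have "keys (Var i :: ('z, 'k) mpoly) = keys (Var j :: ('z, 'k) mpoly)"
      by simp
    then have "keys (single i (1 :: nat)) = keys (single j (1 :: nat))"
      by (simp add: Var_def)
    then show "i = j" by simp
  qed
  have U: "upset U"
    unfolding U_def by (rule upset_threshold)
  have reg_U: "regular_mod (graph_gen f) (monomial_ideal U)"
    unfolding U_def by (rule splits_regular_mod[OF splits_threshold reg]) auto
  \<comment> \<open>The leaf of the empty index set is the zero ideal: the sequence is regular on S
    itself, as the free modules of the resolution require.\<close>
  have "splits {{}} ({} :: ('z \<Rightarrow>\<^sub>0 nat) set)"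
    using splits.leaf[of "{} :: 'z set" "{{}}"] by simp
  then have reg_0: "regular_mod (graph_gen f) (monomial_ideal {})"
    by (rule splits_regular_mod[OF _ reg]) auto
  have symb: "symbolic_power (power_product_ideal a b \<F>) m = power_prod_ideal f U"
    unfolding assms(15) U_def
    by (rule symbolic_power_power_product_ideal[OF noetherian_mpoly reg assms(14) c ab assms(22)])
  have "symbolic_power (power_product_ideal a b \<F>z) m = power_prod_ideal Var U"
    unfolding assms(18) U_def
    by (rule symbolic_power_power_product_ideal[OF noetherian_mpoly regular_subsets_Var inj_Var c ab assms(22)])
  then have symb_z: "symbolic_power (power_product_ideal a b \<F>z) m = monomial_ideal U"
    by (simp only: power_prod_ideal_Var[OF U])
  have \<phi>_single: "\<phi> (single u 1) = power_prod f u" for u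
  proof -
    interpret comm_ring_hom \<phi> by (rule \<phi>(1))
    show ?thesis
      by (simp add: hom_power_prod \<phi>(3) flip: power_prod_Var)
  qed
  have "ideal_gen (\<phi> ` monomial_ideal U) = power_prod_ideal f U"
  proof (rule antisym)
    show "ideal_gen (\<phi> ` monomial_ideal U) \<subseteq> power_prod_ideal f U"
      by (rule ideal.span_minimal) (auto intro: hom_mem_power_prod_ideal[OF \<phi>])
    have "power_prod f u \<in> \<phi> ` monomial_ideal U" if "u \<in> U" for u
      using single_mem_monomial_ideal[OF that, of "1 :: 'k"] by (simp flip: \<phi>_single)
    then show "power_prod_ideal f U \<subseteq> ideal_gen (\<phi> ` monomial_ideal U)"
      unfolding power_prod_ideal_def by (intro ideal.span_mono) auto
  qed
  moreover have "graded_minimal_free_resolution (base_change \<phi> d C) (power_prod_ideal f U)"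
    if C: "graded_minimal_free_resolution C (monomial_ideal U)" for C
  proof -
    have graded: "graded_free_sequence C" and res: "resolves_quotient C (monomial_ideal U)"
      and minimal: "minimal_sequence C"
      using C by (simp_all add: graded_minimal_free_resolution_def)
    then have aug: "faug C \<in> carrier_vec (frank C 0)"
      and diff: "\<And>i. fdiff C i \<in> carrier_mat (frank C i) (frank C (Suc i))"
      by (simp_all add: graded_free_sequence_def)
    show ?thesis
      unfolding graded_minimal_free_resolution_def
      using graded_base_change[OF \<phi> form graded]
        base_change_resolves_quotient[OF U reg_U reg_0 \<phi> aug diff res]
        minimal_base_change[OF \<phi>(1,3) f_max diff minimal] by blast
  qed
  moreover have "\<phi> ` minimal_monomial_gens (monomial_ideal U) = power_prod f ` min_exponents U"
    by (simp add: minimal_monomial_gens_monomial_ideal[OF U] image_image \<phi>_single)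
  ultimately show ?thesis
    using minimal_generating_set_power_prod[OF U reg_U f_max] by (simp add: symb symb_z)
qed

end
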